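(* Let $s\in(\frac34,1)$, $t\in(0,1)$. Assume that $f$ satisfies $(f_0)$, $(f_1)$, $(f_2)$ (see context) and that the positive continuous functions $V,K,Q:\mathbb{R}^3\to\mathbb{R}$ satisfy $$V(x)\ge V_\infty=\lim_{|x|\to\infty}V(x)=V_0,\qquad K(x)\le K_\infty,\qquad Q(x)\le Q_\infty\qquad\text{for all }x\in\mathbb{R}^3,$$ where at least one of these inequalities is strict on a subset of positive measure. Then for any $\varepsilon>0$ the system $$\begin{cases}\varepsilon^{2s}(-\Delta)^su+V(x)u+\phi u=K(x)f(u)+Q(x)|u|^{2_s^*-2}u & \text{in }\mathbb{R}^3,\\ \varepsilon^{2t}(-\Delta)^t\phi=u^2 & \text{in }\mathbb{R}^3\end{cases}$$ has no ground state solution.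
   Context: $2_s^*=\frac{6}{3-2s}$; $V_0=\inf_{\mathbb{R}^3}V>0$; $K_\infty=\lim_{|x|\to\infty}K(x)\in(0,\infty)$ and $Q_\infty=\lim_{|x|\to\infty}Q(x)\in(0,\infty)$. Hypotheses on $f$: $(f_0)$ $f\in C^1(\mathbb{R})$, $f(\tau)=o(\tau^3)$ as $\tau\to0$, $f(\tau)\tau>0$ for $\tau>0$, $f(\tau)=0$ for $\tau\le0$. $(f_1)$ $f(\tau)/\tau^3$ is strictly increasing on $(0,\infty)$. $(f_2)$ $f(\tau)\ge c_0\tau^{q-1}$ for $\tau\ge0$ and $|f'(\tau)|\le c_1(1+|\tau|^{p-2})$ for some constants $c_0,c_1>0$, where $4<q<p<2_s^*$. $F(\tau)=\int_0^\tau f$. For $u\in H^s(\mathbb{R}^3)$, $\phi_u^t(x)=c_t\int_{\mathbb{R}^3}\frac{u^2(y)}{|x-y|^{3-2t}}dy$, $c_t=\pi^{-3/2}2^{-2t}\frac{\Gamma(\frac{3-2t}{2})}{\Gamma(t)}$, is the unique weak solution in $\mathcal{D}^{t,2}(\mathbb{R}^3)$ (completion of $C_0^\infty(\mathbb{R}^3)$ under $\|(-\Delta)^{t/2}u\|_2$) of $(-\Delta)^t\phi=u^2$. After the change of variables $x\mapsto\varepsilon x$ the system is equivalent to $$(-\Delta)^su+V(\varepsilon x)u+\phi_u^tu=K(\varepsilon x)f(u)+Q(\varepsilon x)|u|^{2_s^*-2}u\quad\text{in }\mathbb{R}^3,$$ whose weak solutions are the critical points on $H^s(\mathbb{R}^3)$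 of $$I_\varepsilon(u)=\tfrac12\int(|(-\Delta)^{s/2}u|^2+V(\varepsilon x)u^2)dx+\tfrac14\int\phi_u^tu^2dx-\int K(\varepsilon x)F(u)dx-\tfrac1{2_s^*}\int Q(\varepsilon x)|u|^{2_s^*}dx.$$ With $\mathcal N_\varepsilon=\{u\in H^s(\mathbb{R}^3)\setminus\{0\}:\langle I_\varepsilon'(u),u\rangle=0\}$ and $c_\varepsilon=\inf_{\mathcal N_\varepsilon}I_\varepsilon$, a ground state solution (in the rescaled form) is a $u\in\mathcal N_\varepsilon$ with $I_\varepsilon(u)=c_\varepsilon$; the theorem says that $c_\varepsilon$ is not attained. *)

theory Defs
  imports "HOL-Analysis.Analysis" "HOL-Library.Landau_Symbols"
begin

type_synonym R3 = "real ^ 3"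

text \<open>
  Elements of Lebesgue and Sobolev spaces are represented by Borel functions; two functions
  that agree almost everywhere represent the same element.
\<close>

definition L2 :: "(R3 \<Rightarrow> complex) set" where
  "L2 = {g \<in> borel_measurable lborel. integrable lborel (\<lambda>x. (cmod (g x))\<^sup>2)}"

text \<open>
  The unitary Fourier transform (for \<open>\<sigma> = -1\<close>) and its inverse (for \<open>\<sigma> = 1\<close>), first as an
  absolutely convergent integral, then on \<open>L2\<close> as the limit in mean of the transforms of
  the truncations to balls.
\<close>

definition fourier_integral :: "real \<Rightarrow> (R3 \<Rightarrow> complex) \<Rightarrow> R3 \<Rightarrow> complex" where
  "fourier_integral \<sigma> g \<xi> =
     of_real ((2 * pi) powr (- 3 / 2)) * (LINT x|lborel. cis (\<sigma> * (\<xi> \<bullet> x)) * g x)"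

definition is_fourier_L2 :: "real \<Rightarrow> (R3 \<Rightarrow> complex) \<Rightarrow> (R3 \<Rightarrow> complex) \<Rightarrow> bool" where
  "is_fourier_L2 \<sigma> g h \<longleftrightarrow> h \<in> L2 \<and>
     (\<lambda>n. \<integral>\<^sup>+ \<xi>. ennreal ((cmod (h \<xi> -
        fourier_integral \<sigma> (\<lambda>x. if x \<in> ball 0 (real n) then g x else 0) \<xi>))\<^sup>2) \<partial>lborel)
     \<longlonglongrightarrow> 0"

text \<open>For \<open>g \<in> L2\<close> such a limit exists and is unique up to a null set.\<close>

definition fourier_L2 :: "(R3 \<Rightarrow> complex) \<Rightarrow> R3 \<Rightarrow> complex" where
  "fourier_L2 g = (SOME h. is_fourier_L2 (- 1) g h)"

definition inv_fourier_L2 :: "(R3 \<Rightarrow> complex) \<Rightarrow> R3 \<Rightarrow> complex" where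
  "inv_fourier_L2 g = (SOME h. is_fourier_L2 1 g h)"

definition frac_laplacian :: "real \<Rightarrow> (R3 \<Rightarrow> real) \<Rightarrow> R3 \<Rightarrow> complex" where
  "frac_laplacian a u =
     inv_fourier_L2 (\<lambda>\<xi>. of_real (norm \<xi> powr (2 * a)) * fourier_L2 (\<lambda>x. of_real (u x)) \<xi>)"

definition Hs :: "real \<Rightarrow> (R3 \<Rightarrow> real) set" where
  "Hs s = {u \<in> borel_measurable lborel. integrable lborel (\<lambda>x. (u x)\<^sup>2) \<and>
     integrable lborel (\<lambda>\<xi>. norm \<xi> powr (2 * s) * (cmod (fourier_L2 (\<lambda>x. of_real (u x)) \<xi>))\<^sup>2)}"

definition crit_exp :: "real \<Rightarrow> real" where
  "crit_exp s = 6 / (3 - 2 * s)"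

definition riesz_const :: "real \<Rightarrow> real" where
  "riesz_const t = pi powr (- 3 / 2) * 2 powr (- 2 * t) * Gamma ((3 - 2 * t) / 2) / Gamma t"

definition poisson_potential :: "real \<Rightarrow> (R3 \<Rightarrow> real) \<Rightarrow> R3 \<Rightarrow> real" where
  "poisson_potential t u x =
     riesz_const t * (LINT y|lborel. (u y)\<^sup>2 / norm (x - y) powr (3 - 2 * t))"

definition primitive :: "(real \<Rightarrow> real) \<Rightarrow> real \<Rightarrow> real" where
  "primitive f \<tau> = (LBINT r=ereal 0..ereal \<tau>. f r)"

text \<open>The energy functional of the system after the change of variables \<open>x \<mapsto> \<epsilon> x\<close>.\<close>

definition energy ::
  "real \<Rightarrow> real \<Rightarrow> (real \<Rightarrow> real) \<Rightarrow> (R3 \<Rightarrow> real) \<Rightarrow> (R3 \<Rightarrow> real) \<Rightarrow> (R3 \<Rightarrow> real) \<Rightarrow> real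
    \<Rightarrow> (R3 \<Rightarrow> real) \<Rightarrow> real" where
  "energy s t f V K Q \<epsilon> u =
     1 / 2 * (LINT x|lborel. (cmod (frac_laplacian (s / 2) u x))\<^sup>2 + V (\<epsilon> *\<^sub>R x) * (u x)\<^sup>2)
     + 1 / 4 * (LINT x|lborel. poisson_potential t u x * (u x)\<^sup>2)
     - (LINT x|lborel. K (\<epsilon> *\<^sub>R x) * primitive f (u x))
     - 1 / crit_exp s * (LINT x|lborel. Q (\<epsilon> *\<^sub>R x) * \<bar>u x\<bar> powr crit_exp s)"

text \<open>
  The pairing of the derivative of the energy at \<open>u\<close> with \<open>v\<close>. The functional is \<open>C\<^sup>1\<close> on the
  Sobolev space, so its derivative acts on \<open>v\<close> as the directional derivative.
\<close>

definition energy_deriv ::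
  "real \<Rightarrow> real \<Rightarrow> (real \<Rightarrow> real) \<Rightarrow> (R3 \<Rightarrow> real) \<Rightarrow> (R3 \<Rightarrow> real) \<Rightarrow> (R3 \<Rightarrow> real) \<Rightarrow> real
    \<Rightarrow> (R3 \<Rightarrow> real) \<Rightarrow> (R3 \<Rightarrow> real) \<Rightarrow> real" where
  "energy_deriv s t f V K Q \<epsilon> u v =
     deriv (\<lambda>\<tau>. energy s t f V K Q \<epsilon> (\<lambda>x. u x + \<tau> * v x)) 0"

definition nehari ::
  "real \<Rightarrow> real \<Rightarrow> (real \<Rightarrow> real) \<Rightarrow> (R3 \<Rightarrow> real) \<Rightarrow> (R3 \<Rightarrow> real) \<Rightarrow> (R3 \<Rightarrow> real) \<Rightarrow> real
    \<Rightarrow> (R3 \<Rightarrow> real) set" where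
  "nehari s t f V K Q \<epsilon> =
     {u \<in> Hs s. \<not> (AE x in lborel. u x = 0) \<and> energy_deriv s t f V K Q \<epsilon> u u = 0}"

definition ground_level ::
  "real \<Rightarrow> real \<Rightarrow> (real \<Rightarrow> real) \<Rightarrow> (R3 \<Rightarrow> real) \<Rightarrow> (R3 \<Rightarrow> real) \<Rightarrow> (R3 \<Rightarrow> real) \<Rightarrow> real \<Rightarrow> real"
  where
  "ground_level s t f V K Q \<epsilon> = (INF u\<in>nehari s t f V K Q \<epsilon>. energy s t f V K Q \<epsilon> u)"

text \<open>
  A ground state of the system in rescaled form; the corresponding solution of the system in the
  original variables has the components \<open>x \<mapsto> u (x /\<^sub>R \<epsilon>)\<close> and
  \<open>x \<mapsto> poisson_potential t u (x /\<^sub>R \<epsilon>)\<close>.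
\<close>

definition ground_state_solution ::
  "real \<Rightarrow> real \<Rightarrow> (real \<Rightarrow> real) \<Rightarrow> (R3 \<Rightarrow> real) \<Rightarrow> (R3 \<Rightarrow> real) \<Rightarrow> (R3 \<Rightarrow> real) \<Rightarrow> real
    \<Rightarrow> (R3 \<Rightarrow> real) \<Rightarrow> bool" where
  "ground_state_solution s t f V K Q \<epsilon> u \<longleftrightarrow>
     u \<in> nehari s t f V K Q \<epsilon> \<and> energy s t f V K Q \<epsilon> u = ground_level s t f V K Q \<epsilon>"

end

theory Submission
  imports Defs "HOL-Probability.Characteristic_Functions"
begin

text \<open>
  Along each ray \<open>\<tau> \<mapsto> \<tau> u\<close> the energy has a unique critical point, its maximum, so the ground level \<open>c\<close>
  is the minimum over \<open>u\<close> of these maxima. Let \<open>u\<close> attain it. Passing to \<open>\<bar>u\<bar>\<close> does not increase the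
  energy along the ray, because the \<open>H\<^sup>s\<close> seminorm is a Gagliardo seminorm (Plancherel). Testing \<open>c\<close>
  with translates of \<open>\<bar>u\<bar>\<close> that escape to infinity bounds \<open>c\<close> by the maximum of the limit energy along
  the ray of \<open>\<bar>u\<bar>\<close>, which lies below the energy with the actual coefficients; equality forces \<open>u = 0\<close>
  almost everywhere on the open set where some coefficient differs from its limit. Adding \<open>\<delta> \<phi>\<close> to
  \<open>\<bar>u\<bar>\<close>, with a bump \<open>\<phi> \<ge> 0\<close> in that set, lowers the seminorm at first order in \<open>\<delta>\<close> because the
  fractional Laplacian is nonlocal, while all other terms grow by at most \<open>O(\<delta>\<^sup>2)\<close>. This contradicts
  the minimality of \<open>c\<close>.
\<close>

section \<open>Square-integrable functions\<close>

text \<open>The limit coefficients are the most favourable ones, so a ground state for the actual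
  coefficients could at best tie with the limit problem, and the real task is to refute a tie. Only
  energies are compared for this; no Euler-Lagrange equation is used. A bump placed where
  \<open>w\<close> vanishes has no overlap with it, so all local products drop out, the
  \<open>F\<close> term and the critical term can only lower the energy, and the one first-order
  contribution is the cross term of the seminorm written as a double integral. Two obstacles shape
  the development. The energy is defined by Fourier transforms picked with SOME, so Plancherel's
  theorem must be established before the seminorm becomes a double integral. And the level
  \<open>c\<close> is compared with a ray at an unknown parameter \<open>\<tau>\<close>, so
  \<open>\<tau>\<close> must be bounded by some \<open>T\<close> uniformly in the translation or in
  \<open>\<delta>\<close>. This rests on \<open>c > 0\<close> and on \<open>4 < crit_exp s\<close>,
  that is, on \<open>3 / 4 < s\<close>: the critical power then beats the quartic Coulomb
  term.\<close>

lemma lborel_distr_translate: "distr lborel borel (\<lambda>x. x + a) = (lborel :: 'a::euclidean_space measure)"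
  using lborel_affine[of 1 a] by (simp add: density_1 add.commute)

lemma nn_integral_translate:
  fixes a :: "'a::euclidean_space"
  assumes [measurable]: "g \<in> borel_measurable borel"
  shows "(\<integral>\<^sup>+x. g (x + a) \<partial>lborel) = (\<integral>\<^sup>+x. g x \<partial>lborel)"
  by (subst (2) lborel_distr_translate[of a, symmetric]) (simp add: nn_integral_distr)

lemma integrable_translate:
  fixes a :: "'a::euclidean_space" and g :: "'a \<Rightarrow> 'b::{banach, second_countable_topology}"
  assumes [measurable]: "g \<in> borel_measurable borel"
  shows "integrable lborel (\<lambda>x. g (x + a)) \<longleftrightarrow> integrable lborel g"
  by (subst (2) lborel_distr_translate[of a, symmetric]) (simp add: integrable_distr_eq)

lemma integral_translate:
  fixes a :: "'a::euclidean_space" and g :: "'a \<Rightarrow> 'b::{banach, second_countable_topology}"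
  assumes [measurable]: "g \<in> borel_measurable borel"
  shows "(LINT x|lborel. g (x + a)) = (LINT x|lborel. g x)"
  by (subst (2) lborel_distr_translate[of a, symmetric]) (simp add: integral_distr)

lemma AE_translate:
  fixes a :: "'a::euclidean_space"
  assumes "AE x in lborel. P x"
  shows "AE x in lborel. P (x + a)"
proof -
  obtain N where N: "{x \<in> space lborel. \<not> P x} \<subseteq> N" "N \<in> null_sets lborel"
    using assms by (auto elim!: AE_E simp: null_setsI)
  have "AE x in distr lborel borel (\<lambda>x. x + a). x \<notin> N"
    unfolding lborel_distr_translate by (rule AE_not_in[OF N(2)])
  then have "AE x in lborel. x + a \<notin> N"
    by (subst (asm) AE_distr_iff) (use N(2) in \<open>auto simp: null_sets_def\<close>)
  then show ?thesis by eventually_elim (use N(1) in auto)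
qed

lemma nn_integral_scaleR:
  fixes g :: "'a::euclidean_space \<Rightarrow> ennreal"
  assumes [measurable]: "g \<in> borel_measurable borel" and c: "c \<noteq> 0"
  shows "(\<integral>\<^sup>+x. g x \<partial>lborel) = ennreal (\<bar>c\<bar> ^ DIM('a)) * (\<integral>\<^sup>+x. g (c *\<^sub>R x) \<partial>lborel)"
  by (subst lborel_affine[OF c, of 0])
     (simp add: nn_integral_density nn_integral_distr nn_integral_cmult ennreal_power)

text \<open>Extended-valued, so that inequalities and limits can be stated before finiteness is
  known.\<close>

definition nsq :: "(R3 \<Rightarrow> complex) \<Rightarrow> ennreal" where
  "nsq g = (\<integral>\<^sup>+x. ennreal ((cmod (g x))\<^sup>2) \<partial>lborel)"

lemma L2_iff_nsq: "g \<in> L2 \<longleftrightarrow> g \<in> borel_measurable lborel \<and> nsq g < \<infinity>"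
  unfolding L2_def nsq_def by (auto simp: integrable_iff_bounded)

lemma norm_add_sq_le: "(norm (a + b))\<^sup>2 \<le> 2 * (norm a)\<^sup>2 + 2 * (norm b)\<^sup>2"
proof -
  have "(norm (a + b))\<^sup>2 \<le> (norm a + norm b)\<^sup>2"
    by (intro power_mono norm_triangle_ineq) auto
  also have "\<dots> \<le> 2 * (norm a)\<^sup>2 + 2 * (norm b)\<^sup>2"
    using sum_squares_bound[of "norm a" "norm b"] by (simp add: power2_sum)
  finally show ?thesis .
qed

lemma nsq_add_le:
  assumes [measurable]: "f \<in> borel_measurable borel" "g \<in> borel_measurable borel"
  shows "nsq (\<lambda>x. f x + g x) \<le> 2 * nsq f + 2 * nsq g"
proof -
  have "nsq (\<lambda>x. f x + g x)
      \<le> (\<integral>\<^sup>+x. 2 * ennreal ((cmod (f x))\<^sup>2) + 2 * ennreal ((cmod (g x))\<^sup>2) \<partial>lborel)"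
    unfolding nsq_def
  proof (rule nn_integral_mono)
    fix x
    have "ennreal ((cmod (f x + g x))\<^sup>2) \<le> ennreal (2 * (cmod (f x))\<^sup>2 + 2 * (cmod (g x))\<^sup>2)"
      by (intro ennreal_leI norm_add_sq_le)
    then show "ennreal ((cmod (f x + g x))\<^sup>2) \<le> 2 * ennreal ((cmod (f x))\<^sup>2) + 2 * ennreal ((cmod (g x))\<^sup>2)"
      by (simp add: ennreal_mult)
  qed
  also have "\<dots> = 2 * nsq f + 2 * nsq g"
    unfolding nsq_def by (simp add: nn_integral_add nn_integral_cmult)
  finally show ?thesis .
qed

lemma nsq_minus_commute: "nsq (\<lambda>x. f x - g x) = nsq (\<lambda>x. g x - f x)"
  by (simp add: nsq_def norm_minus_commute)

lemma nsq_diff_le: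
  assumes [measurable]: "f \<in> borel_measurable borel" "g \<in> borel_measurable borel" "h \<in> borel_measurable borel"
  shows "nsq (\<lambda>x. f x - h x) \<le> 2 * nsq (\<lambda>x. f x - g x) + 2 * nsq (\<lambda>x. g x - h x)"
  using nsq_add_le[of "\<lambda>x. f x - g x" "\<lambda>x. g x - h x"] by simp

lemma nsq_translate:
  assumes "g \<in> borel_measurable borel"
  shows "nsq (\<lambda>x. g (x + a)) = nsq g"
  using nn_integral_translate[of "\<lambda>x. ennreal ((cmod (g x))\<^sup>2)" a] assms by (simp add: nsq_def)

text \<open>Young's inequality for the mixed term of \<open>(norm y + norm (x - y))^2\<close>. The
  bound has the shape "main term plus small errors" and contains no subtraction, so it survives the
  passage to \<open>ennreal\<close>.\<close>

lemma norm_sq_perturb: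
  fixes x y :: "'a::real_normed_vector"
  assumes "0 < \<eta>"
  shows "(norm x)\<^sup>2 \<le> (norm y)\<^sup>2 + ((1 + 1 / \<eta>) * (norm (x - y))\<^sup>2 + \<eta> * (norm y)\<^sup>2)"
proof -
  let ?a = "norm y" and ?b = "norm (x - y)"
  have "norm x \<le> ?a + ?b" using norm_triangle_ineq[of y "x - y"] by simp
  then have "(norm x)\<^sup>2 \<le> (?a + ?b)\<^sup>2" by (intro power_mono) auto
  moreover have "(sqrt \<eta> * ?a - ?b / sqrt \<eta>)\<^sup>2 = \<eta> * ?a\<^sup>2 + ?b\<^sup>2 / \<eta> - 2 * ?a * ?b"
    using assms by (simp add: power2_diff power_mult_distrib power_divide)
  then have "2 * ?a * ?b \<le> \<eta> * ?a\<^sup>2 + ?b\<^sup>2 / \<eta>"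
    using zero_le_power2[of "sqrt \<eta> * ?a - ?b / sqrt \<eta>"] by linarith
  ultimately show ?thesis by (simp add: power2_sum field_simps)
qed

lemma ennreal_lincomb:
  assumes "0 \<le> a" "0 \<le> b" "0 \<le> c" "0 \<le> d" "0 \<le> e"
  shows "ennreal a + (ennreal b * ennreal c + ennreal d * ennreal e) = ennreal (a + (b * c + d * e))"
  using assms by (simp flip: ennreal_mult ennreal_plus)

text \<open>Takes the place of Minkowski's inequality without square roots: \<open>\<eta>\<close> is
  fixed first, then the large factor \<open>1 + 1 / \<eta>\<close> is beaten by a distance tending
  to 0.\<close>

lemma nsq_perturb:
  assumes [measurable]: "f \<in> borel_measurable borel" "g \<in> borel_measurable borel" and "0 < \<eta>"
  shows "nsq f \<le> nsq g + (ennreal (1 + 1 / \<eta>) * nsq (\<lambda>x. f x - g x) + ennreal \<eta> * nsq g)"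
proof -
  have "nsq f \<le> (\<integral>\<^sup>+x. ennreal ((cmod (g x))\<^sup>2) + (ennreal (1 + 1 / \<eta>) * ennreal ((cmod (f x - g x))\<^sup>2)
      + ennreal \<eta> * ennreal ((cmod (g x))\<^sup>2)) \<partial>lborel)"
    unfolding nsq_def
  proof (rule nn_integral_mono)
    fix x
    have "ennreal ((cmod (f x))\<^sup>2) \<le> ennreal ((cmod (g x))\<^sup>2 + ((1 + 1 / \<eta>) * (cmod (f x - g x))\<^sup>2
      + \<eta> * (cmod (g x))\<^sup>2))"
      by (intro ennreal_leI norm_sq_perturb assms)
    also have "\<dots> = ennreal ((cmod (g x))\<^sup>2) + (ennreal (1 + 1 / \<eta>) * ennreal ((cmod (f x - g x))\<^sup>2)
      + ennreal \<eta> * ennreal ((cmod (g x))\<^sup>2))"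
      using assms(3) by (intro ennreal_lincomb[symmetric]) auto
    finally show "ennreal ((cmod (f x))\<^sup>2) \<le> \<dots>" .
  qed
  also have "\<dots> = nsq g + (ennreal (1 + 1 / \<eta>) * nsq (\<lambda>x. f x - g x) + ennreal \<eta> * nsq g)"
    unfolding nsq_def by (simp add: nn_integral_add nn_integral_cmult)
  finally show ?thesis .
qed

text \<open>Continuity of the norm: \<open>nsq_perturb\<close> is applied in both
  directions.\<close>

lemma nsq_tendsto:
  assumes [measurable]: "\<And>n. f n \<in> borel_measurable borel" "g \<in> borel_measurable borel"
    and fin: "nsq g < \<infinity>"
    and lim: "(\<lambda>n. nsq (\<lambda>x. f n x - g x)) \<longlonglongrightarrow> 0"
  shows "(\<lambda>n. nsq (f n)) \<longlonglongrightarrow> nsq g"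
proof -
  define A where "A = enn2real (nsq g)"
  define D where "D n = enn2real (nsq (\<lambda>x. f n x - g x))" for n
  define F where "F n = enn2real (nsq (f n))" for n
  have A: "nsq g = ennreal A" "A \<ge> 0" using fin by (auto simp: A_def)
  have D0: "D \<longlonglongrightarrow> 0"
    unfolding D_def using tendsto_enn2real[OF lim[folded ennreal_0]] by simp
  have ev: "eventually (\<lambda>n. nsq (\<lambda>x. f n x - g x) < \<infinity>) sequentially"
    using order_tendstoD(2)[OF lim, of \<infinity>] by simp
  have evF: "eventually (\<lambda>n. nsq (f n) = ennreal (F n) \<and> nsq (\<lambda>x. f n x - g x) = ennreal (D n)) sequentially"
    using ev
  proof eventually_elim
    case (elim n)
    have "nsq (f n) < \<infinity>"
      using nsq_perturb[of "f n" g 1] elim fin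
      by (auto simp: ennreal_mult_less_top ennreal_add_eq_top less_top[symmetric] top_unique
        ennreal_mult_eq_top_iff)
    with elim show ?case by (auto simp: F_def D_def)
  qed
  have "F \<longlonglongrightarrow> A"
  proof (rule LIMSEQ_I)
    fix e :: real assume e: "0 < e"
    \<comment> \<open>Small enough for two uses: against \<open>A\<close> in the upper bound for
      \<open>F n\<close>, and against \<open>A + e\<close> in the lower bound, where
      \<open>F n\<close> itself is the main term and is first estimated by
      \<open>A + e\<close>.\<close>
    define \<eta> where "\<eta> = e / (8 * (A + 1 + e))"
    have pos: "0 < A + 1 + e" using A(2) e by simp
    have \<eta>_le: "\<eta> * b < e / 8" if "b < A + 1 + e" for b
    proof -
      have "\<eta> * b = e / 8 * (b / (A + 1 + e))" by (simp add: \<eta>_def)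
      also have "\<dots> < e / 8 * 1" using that pos e by (intro mult_strict_left_mono) auto
      finally show ?thesis by simp
    qed
    have \<eta>: "0 < \<eta>" "\<eta> * A < e / 8" "\<eta> * (A + e) < e / 8"
      using A(2) e pos \<eta>_le[of A] \<eta>_le[of "A + e"] by (auto simp: \<eta>_def)
    have "eventually (\<lambda>n. D n < e / (2 * (1 + 1 / \<eta>))) sequentially"
      using order_tendstoD(2)[OF D0, of "e / (2 * (1 + 1 / \<eta>))"] e \<eta> by (simp add: add_pos_pos)
    then have "eventually (\<lambda>n. norm (F n - A) < e) sequentially"
      using evF
    proof eventually_elim
      case (elim n)
      have Fn: "F n \<ge> 0" "D n \<ge> 0" by (auto simp: F_def D_def)
      have D: "(1 + 1 / \<eta>) * D n < e / 2" using elim(1) \<eta> by (simp add: field_simps add_pos_pos)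
      have "ennreal (F n) \<le> ennreal (A + ((1 + 1 / \<eta>) * D n + \<eta> * A))"
        using nsq_perturb[of "f n" g \<eta>] \<eta>(1) elim Fn A ennreal_lincomb[of A "1 + 1 / \<eta>" "D n" \<eta> A]
        by simp
      then have 1: "F n \<le> A + ((1 + 1 / \<eta>) * D n + \<eta> * A)"
        by (subst (asm) ennreal_le_iff) (use A Fn \<eta> in auto)
      have "ennreal A \<le> ennreal (F n + ((1 + 1 / \<eta>) * D n + \<eta> * F n))"
        using nsq_perturb[of g "f n" \<eta>] \<eta>(1) elim Fn A ennreal_lincomb[of "F n" "1 + 1 / \<eta>" "D n" \<eta> "F n"]
        by (simp add: nsq_minus_commute[of g])
      then have 2: "A \<le> F n + ((1 + 1 / \<eta>) * D n + \<eta> * F n)"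
        by (subst (asm) ennreal_le_iff) (use A Fn \<eta> in auto)
      have Fe: "F n \<le> A + e" using 1 D \<eta> e by linarith
      have "\<eta> * F n \<le> \<eta> * (A + e)" using Fe \<eta> by (intro mult_left_mono) auto
      then have "\<eta> * F n < e / 8" using \<eta>(3) by linarith
      then show ?case unfolding real_norm_def abs_less_iff using 1 2 D \<eta>(2) e by linarith
    qed
    then show "\<exists>no. \<forall>n\<ge>no. norm (F n - A) < e" by (simp add: eventually_sequentially)
  qed
  then have "(\<lambda>n. ennreal (F n)) \<longlonglongrightarrow> nsq g" unfolding A(1) by (rule tendsto_ennrealI)
  then show ?thesis
    by (rule Lim_transform_eventually) (use evF in \<open>auto elim: eventually_mono\<close>)
qed

text \<open>Riesz-Fischer: a fast subsequence converges almost everywhere, and Fatou's lemma turns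
  the Cauchy bound into a bound for the distance to the pointwise limit.\<close>

lemma nsq_complete:
  fixes h :: "nat \<Rightarrow> R3 \<Rightarrow> complex"
  assumes [measurable]: "\<And>n. h n \<in> borel_measurable borel"
    and cauchy: "\<And>e. 0 < e \<Longrightarrow> \<exists>N. \<forall>m\<ge>N. \<forall>n\<ge>N. nsq (\<lambda>x. h m x - h n x) \<le> ennreal e"
  obtains H where "H \<in> borel_measurable borel" "(\<lambda>n. nsq (\<lambda>x. h n x - H x)) \<longlonglongrightarrow> 0"
proof -
  have "\<exists>N. \<forall>m\<ge>N. \<forall>n\<ge>N. nsq (\<lambda>x. h m x - h n x) \<le> ennreal ((1/8)^k)" for k :: nat
    by (rule cauchy) simp
  then obtain N0 where N0: "\<And>k m n. N0 k \<le> m \<Longrightarrow> N0 k \<le> n \<Longrightarrow> nsq (\<lambda>x. h m x - h n x) \<le> ennreal ((1/8)^k)"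
    by metis
  \<comment> \<open>The sum makes both \<open>r k\<close> and \<open>r (Suc k)\<close> exceed
    \<open>N0 k\<close>; the summand \<open>k\<close> makes \<open>r\<close> tend to
    infinity.\<close>
  define r where "r k = (\<Sum>i\<le>k. N0 i) + k" for k
  have r: "N0 k \<le> r k" "N0 k \<le> r (Suc k)" for k
  proof -
    show *: "N0 k \<le> r k" unfolding r_def using member_le_sum[of k "{..k}" N0] by simp
    show "N0 k \<le> r (Suc k)" using * by (simp add: r_def)
  qed
  have rge: "k \<le> r k" for k by (simp add: r_def)
  define \<Delta> where "\<Delta> k x = h (r (Suc k)) x - h (r k) x" for k x
  have [measurable]: "\<Delta> k \<in> borel_measurable borel" for k unfolding \<Delta>_def by simp
  have d: "nsq (\<Delta> k) \<le> ennreal ((1/8)^k)" for k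
    unfolding \<Delta>_def using N0[OF r(2) r(1)] .
  \<comment> \<open>The weight \<open>4^k\<close> still leaves a summable \<open>(1/2)^k\<close> out
    of the bound \<open>(1/8)^k\<close>. Where the weighted sum is finite, with value
    \<open>S\<close>, each increment is at most \<open>sqrt S * (1/2)^k\<close>.\<close>
  have "(\<integral>\<^sup>+x. (\<Sum>k. ennreal (4^k) * ennreal ((cmod (\<Delta> k x))\<^sup>2)) \<partial>lborel) = (\<Sum>k. ennreal (4^k) * nsq (\<Delta> k))"
    unfolding nsq_def by (simp add: nn_integral_suminf nn_integral_cmult)
  also have "\<dots> \<le> (\<Sum>k. ennreal ((1/2)^k))"
  proof (rule suminf_le)
    fix k
    have "ennreal (4^k) * nsq (\<Delta> k) \<le> ennreal (4^k) * ennreal ((1/8)^k)"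
      by (intro mult_left_mono d) simp
    also have "\<dots> = ennreal ((1/2)^k)" by (simp flip: ennreal_mult power_mult_distrib)
    finally show "ennreal (4^k) * nsq (\<Delta> k) \<le> ennreal ((1/2)^k)" .
  qed auto
  also have "\<dots> = ennreal (\<Sum>k. (1/2)^k)"
    by (rule suminf_ennreal2) (auto intro: summable_geometric)
  also have "\<dots> < \<infinity>" by simp
  finally have "AE x in lborel. (\<Sum>k. ennreal (4^k) * ennreal ((cmod (\<Delta> k x))\<^sup>2)) \<noteq> \<infinity>"
    by (intro nn_integral_PInf_AE) auto
  then have conv: "AE x in lborel. convergent (\<lambda>k. h (r k) x)"
  proof eventually_elim
    case (elim x)
    let ?a = "\<lambda>k. ennreal (4^k) * ennreal ((cmod (\<Delta> k x))\<^sup>2)"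
    obtain S where S: "(\<Sum>k. ?a k) = ennreal S" "S \<ge> 0" using elim by (cases "\<Sum>k. ?a k") auto
    have "cmod (\<Delta> k x) \<le> sqrt S * (1/2)^k" for k
    proof -
      have "?a k \<le> (\<Sum>k. ?a k)" using sum_le_suminf[of ?a "{k}"] by simp
      then have "ennreal (4^k * (cmod (\<Delta> k x))\<^sup>2) \<le> ennreal S" using S by (simp add: ennreal_mult)
      then have *: "4^k * (cmod (\<Delta> k x))\<^sup>2 \<le> S" using S by (simp add: ennreal_le_iff)
      have "(2^k * cmod (\<Delta> k x))\<^sup>2 \<le> S"
      proof -
        have "(2^k * cmod (\<Delta> k x))\<^sup>2 = (2^k * 2^k) * (cmod (\<Delta> k x))\<^sup>2" by (simp add: power2_eq_square)
        also have "(2::real)^k * 2^k = 4^k" by (simp flip: power_mult_distrib)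
        finally show ?thesis using * by simp
      qed
      then have "2^k * cmod (\<Delta> k x) \<le> sqrt S" by (rule real_le_rsqrt)
      then show ?thesis by (simp add: field_simps)
    qed
    moreover have "summable (\<lambda>k. sqrt S * (1/2)^k)"
      by (rule summable_mult, rule summable_geometric) simp
    ultimately have "summable (\<lambda>k. \<Delta> k x)"
      by - (rule summable_comparison_test'[of "\<lambda>k. sqrt S * (1/2)^k" 0], auto)
    then have "convergent (\<lambda>n. \<Sum>k<n. \<Delta> k x)" by (simp add: summable_iff_convergent)
    moreover have "(\<Sum>k<n. \<Delta> k x) = h (r n) x - h (r 0) x" for n
      by (induction n) (auto simp: \<Delta>_def)
    ultimately have "convergent (\<lambda>n. h (r n) x - h (r 0) x)" by simp
    then show ?case using convergent_add[OF _ convergent_const[of "h (r 0) x"]] by fastforce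
  qed
  define H where "H x = lim (\<lambda>k. h (r k) x)" for x
  have H[measurable]: "H \<in> borel_measurable borel"
    unfolding H_def by (intro borel_measurable_lim_metric) simp
  have "(\<lambda>n. nsq (\<lambda>x. h n x - H x)) \<longlonglongrightarrow> 0"
  proof (rule order_tendstoI)
    fix e :: ennreal assume "0 < e"
    then obtain e0 where e0: "0 < e0" "e0 < e" using dense by blast
    then obtain e' where e': "ennreal e' < e" "e' > 0" by (cases e0) auto
    obtain N where N: "\<And>m n. N \<le> m \<Longrightarrow> N \<le> n \<Longrightarrow> nsq (\<lambda>x. h m x - h n x) \<le> ennreal e'"
      using cauchy[OF e'(2)] by metis
    have "nsq (\<lambda>x. h n x - H x) \<le> ennreal e'" if "N \<le> n" for n
    proof -
      have "nsq (\<lambda>x. h n x - H x) = (\<integral>\<^sup>+x. liminf (\<lambda>k. ennreal ((cmod (h n x - h (r k) x))\<^sup>2)) \<partial>lborel)"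
        unfolding nsq_def
      proof (rule nn_integral_cong_AE, use conv in eventually_elim)
        case (elim x)
        then have "(\<lambda>k. h (r k) x) \<longlonglongrightarrow> H x" by (simp add: H_def convergent_LIMSEQ_iff)
        then have "(\<lambda>k. ennreal ((cmod (h n x - h (r k) x))\<^sup>2)) \<longlonglongrightarrow> ennreal ((cmod (h n x - H x))\<^sup>2)"
          by (intro tendsto_intros tendsto_ennrealI)
        then show ?case by (rule lim_imp_Liminf[OF sequentially_bot, symmetric])
      qed
      also have "\<dots> \<le> liminf (\<lambda>k. nsq (\<lambda>x. h n x - h (r k) x))"
        unfolding nsq_def by (intro nn_integral_liminf) simp
      also have "\<dots> \<le> ennreal e'"
      proof (rule Liminf_le)
        have "eventually (\<lambda>k. N \<le> k) sequentially" by (rule eventually_ge_at_top)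
        then show "eventually (\<lambda>k. nsq (\<lambda>x. h n x - h (r k) x) \<le> ennreal e') sequentially"
          by eventually_elim (use N that rge le_trans in blast)
      qed simp
      finally show ?thesis .
    qed
    then show "eventually (\<lambda>n. nsq (\<lambda>x. h n x - H x) < e) sequentially"
      unfolding eventually_sequentially using e'(1) by (meson le_less_trans)
  qed simp
  with H show ?thesis by (rule that)
qed

text \<open>For \<open>R > 0\<close> this is the radial retraction of the plane onto the disc of
  radius \<open>R\<close>. It is bounded and continuous, so pointwise limits pass through
  it.\<close>

definition radial_clip :: "real \<Rightarrow> complex \<Rightarrow> complex" where
  "radial_clip R z = z /\<^sub>R max 1 (norm z / R)"

lemma norm_radial_clip_le:
  assumes "0 < R"
  shows "norm (radial_clip R z) \<le> R" "norm (radial_clip R z) \<le> norm z"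
proof -
  have m: "max 1 (norm z / R) \<ge> 1" "norm z / R \<le> max 1 (norm z / R)" by auto
  have eq: "norm (radial_clip R z) = norm z / max 1 (norm z / R)"
    unfolding radial_clip_def using m(1) by (simp add: divide_inverse mult.commute)
  have "norm z \<le> R * max 1 (norm z / R)" using mult_left_mono[OF m(2), of R] assms by simp
  then show "norm (radial_clip R z) \<le> R" unfolding eq using m(1) by (simp add: pos_divide_le_eq)
  show "norm (radial_clip R z) \<le> norm z" unfolding eq
    using m(1) mult_left_mono[of 1 "max 1 (norm z / R)" "norm z"] by (simp add: pos_divide_le_eq)
qed

lemma continuous_radial_clip: "0 < R \<Longrightarrow> continuous_on UNIV (radial_clip R)"
  unfolding radial_clip_def[abs_def] by (intro continuous_intros) (auto simp: max_def)

lemma radial_clip_eq: "norm z \<le> R \<Longrightarrow> 0 < R \<Longrightarrow> radial_clip R z = z"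
  by (simp add: radial_clip_def max_def divide_simps)

text \<open>Two approximations. Clipping values and support of \<open>g\<close> is harmless by
  dominated convergence. Then \<open>g\<close> is replaced by continuous functions converging almost
  everywhere, under the same clipping, which supplies the common bound and support that dominated
  convergence needs.\<close>

lemma L2_approx_continuous:
  assumes [measurable]: "g \<in> borel_measurable borel" and fin: "nsq g < \<infinity>" and e: "0 < e"
  obtains \<phi> R where "continuous_on UNIV \<phi>" "\<And>x. cmod (\<phi> x) \<le> R" "\<And>x. R \<le> norm x \<Longrightarrow> \<phi> x = 0"
    "nsq (\<lambda>x. g x - \<phi> x) < ennreal e"
proof -
  define cut :: "real \<Rightarrow> R3 \<Rightarrow> real" where "cut R x = max 0 (min 1 (R - norm x))" for R x
  have cut: "0 \<le> cut R x" "cut R x \<le> 1" "R \<le> norm x \<Longrightarrow> cut R x = 0" "norm x \<le> R - 1 \<Longrightarrow> cut R x = 1" for R x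
    by (auto simp: cut_def)
  have cont_cut: "continuous_on UNIV (cut R)" for R unfolding cut_def by (intro continuous_intros)
  then have [measurable]: "cut R \<in> borel_measurable borel" for R by (rule borel_measurable_continuous_onI)
  have [measurable]: "radial_clip R \<in> borel_measurable borel" if "0 < R" for R
    by (rule borel_measurable_continuous_onI[OF continuous_radial_clip[OF that]])
  define c where "c R z x = of_real (cut R x) * radial_clip R z" for R z x
  have c_le: "cmod (c R z x) \<le> cmod z" "cmod (c R z x) \<le> R" if "0 < R" for R z x
  proof -
    have "cmod (c R z x) \<le> 1 * cmod (radial_clip R z)"
      unfolding c_def norm_mult norm_of_real using cut[where R=R and x=x] by (intro mult_right_mono) auto
    then show "cmod (c R z x) \<le> cmod z" "cmod (c R z x) \<le> R"
      using norm_radial_clip_le[OF that, of z] by auto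
  qed
  have [measurable]: "(\<lambda>x. c R (G x) x) \<in> borel_measurable borel"
    if [measurable]: "G \<in> borel_measurable borel" "0 < R" for G R
    unfolding c_def by measurable
  have "(\<lambda>n. nsq (\<lambda>x. g x - c (real (Suc n)) (g x) x)) \<longlonglongrightarrow> (\<integral>\<^sup>+x. 0 \<partial>(lborel :: R3 measure))"
    unfolding nsq_def
  proof (rule nn_integral_dominated_convergence[where w="\<lambda>x. 4 * ennreal ((cmod (g x))\<^sup>2)"])
    show "(\<integral>\<^sup>+ x. 4 * ennreal ((cmod (g x))\<^sup>2) \<partial>lborel) < \<infinity>"
      using fin by (simp add: nn_integral_cmult nsq_def ennreal_mult_less_top)
    show "AE x in lborel. ennreal ((cmod (g x - c (real (Suc j)) (g x) x))\<^sup>2)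
      \<le> 4 * ennreal ((cmod (g x))\<^sup>2)" for j
    proof (rule AE_I2)
      fix x
      have "cmod (g x - c (real (Suc j)) (g x) x) \<le> 2 * cmod (g x)"
        using norm_triangle_ineq4[of "g x" "c (real (Suc j)) (g x) x"] c_le(1)[of "real (Suc j)" "g x" x]
          by simp
      then have "(cmod (g x - c (real (Suc j)) (g x) x))\<^sup>2 \<le> (2 * cmod (g x))\<^sup>2" by (intro power_mono) auto
      also have "\<dots> = 4 * (cmod (g x))\<^sup>2" by (simp add: power_mult_distrib)
      finally have "ennreal ((cmod (g x - c (real (Suc j)) (g x) x))\<^sup>2) \<le> ennreal (4 * (cmod (g x))\<^sup>2)"
        by (rule ennreal_leI)
      then show "ennreal ((cmod (g x - c (real (Suc j)) (g x) x))\<^sup>2) \<le> 4 * ennreal ((cmod (g x))\<^sup>2)"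
        by (simp add: ennreal_mult)
    qed
    show "AE x in lborel. (\<lambda>i. ennreal ((cmod (g x - c (real (Suc i)) (g x) x))\<^sup>2)) \<longlonglongrightarrow> 0"
    proof (rule AE_I2)
      fix x
      obtain N where N: "norm x + cmod (g x) + 1 \<le> real N" using real_arch_simple by blast
      have "g x - c (real (Suc i)) (g x) x = 0" if "N \<le> i" for i
      proof -
        have "norm x + cmod (g x) + 1 \<le> real (Suc i)" using N that by simp
        then have "norm x \<le> real (Suc i) - 1" "cmod (g x) \<le> real (Suc i)"
          using norm_ge_zero[of x] norm_ge_zero[of "g x"] by linarith+
        then show ?thesis by (simp add: c_def cut(4) radial_clip_eq del: of_nat_Suc)
      qed
      then have "eventually (\<lambda>i. ennreal ((cmod (g x - c (real (Suc i)) (g x) x))\<^sup>2) = 0) sequentially"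
        unfolding eventually_sequentially by (intro exI[of _ N]) simp
      then show "(\<lambda>i. ennreal ((cmod (g x - c (real (Suc i)) (g x) x))\<^sup>2)) \<longlonglongrightarrow> 0"
        by (rule tendsto_eventually)
    qed
  qed auto
  then have "eventually (\<lambda>n. nsq (\<lambda>x. g x - c (real (Suc n)) (g x) x) < ennreal (e / 4)) sequentially"
    using e by (intro order_tendstoD(2)) auto
  then obtain R where R: "0 < R" "nsq (\<lambda>x. g x - c R (g x) x) < ennreal (e / 4)"
    unfolding eventually_sequentially by (metis le_refl of_nat_0_less_iff zero_less_Suc)
  \<comment> \<open>Unfolded, this gives continuous functions that converge to \<open>g\<close> off
    a negligible set.\<close>
  have "g measurable_on UNIV"
    by (rule lebesgue_measurable_imp_measurable_on) (auto intro: measurable_completion)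
  then obtain N G where N: "negligible N" and G: "\<And>n. continuous_on UNIV (G n)"
    and lim: "\<And>x. x \<notin> N \<Longrightarrow> (\<lambda>n. G n x) \<longlonglongrightarrow> g x"
    by (auto simp: measurable_on_def)
  have [measurable]: "G n \<in> borel_measurable borel" for n
    by (rule borel_measurable_continuous_onI[OF G])
  have "AE x in lebesgue. x \<notin> N" using N by (intro AE_not_in) (simp add: negligible_iff_null_sets)
  then have AE_N: "AE x in lborel. x \<notin> N" by (simp add: AE_completion_iff)
  have "(\<lambda>n. nsq (\<lambda>x. c R (g x) x - c R (G n x) x)) \<longlonglongrightarrow> (\<integral>\<^sup>+x. 0 \<partial>(lborel :: R3 measure))"
    unfolding nsq_def
  proof (rule nn_integral_dominated_convergence[where w="\<lambda>x. ennreal ((2 * R)\<^sup>2) * indicator (ball 0 R) x"])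
    show "(\<integral>\<^sup>+ x. ennreal ((2 * R)\<^sup>2) * indicator (ball 0 R) (x :: R3) \<partial>lborel) < \<infinity>"
      using emeasure_lborel_ball_finite[of "0::R3" R]
      by (subst nn_integral_cmult_indicator) (auto simp: ennreal_mult_less_top less_top)
    show "AE x in lborel. ennreal ((cmod (c R (g x) x - c R (G j x) x))\<^sup>2)
      \<le> ennreal ((2 * R)\<^sup>2) * indicator (ball 0 R) x" for j
    proof (rule AE_I2)
      fix x
      have "cmod (c R (g x) x - c R (G j x) x) \<le> 2 * R"
        using norm_triangle_ineq4[of "c R (g x) x" "c R (G j x) x"] c_le(2)[OF R(1), of "g x" x]
          c_le(2)[OF R(1), of "G j x" x] by simp
      then have "(cmod (c R (g x) x - c R (G j x) x))\<^sup>2 \<le> (2 * R)\<^sup>2" by (intro power_mono) auto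
      then show "ennreal ((cmod (c R (g x) x - c R (G j x) x))\<^sup>2)
        \<le> ennreal ((2 * R)\<^sup>2) * indicator (ball 0 R) x"
        by (auto simp: indicator_def c_def cut(3) intro!: ennreal_leI)
    qed
    show "AE x in lborel. (\<lambda>i. ennreal ((cmod (c R (g x) x - c R (G i x) x))\<^sup>2)) \<longlonglongrightarrow> 0"
      using AE_N
    proof eventually_elim
      case (elim x)
      have "continuous_on UNIV (\<lambda>z. c R z x)" unfolding c_def
        by (intro continuous_intros continuous_radial_clip R)
      then have "isCont (\<lambda>z. c R z x) (g x)" by (simp add: continuous_on_eq_continuous_at)
      then have "(\<lambda>n. c R (G n x) x) \<longlonglongrightarrow> c R (g x) x"
        by (rule isCont_tendsto_compose[OF _ lim[OF elim]])
      then have "(\<lambda>i. ennreal ((cmod (c R (g x) x - c R (G i x) x))\<^sup>2))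
        \<longlonglongrightarrow> ennreal ((cmod (c R (g x) x - c R (g x) x))\<^sup>2)"
        by (intro tendsto_ennrealI tendsto_intros)
      then show ?case by simp
    qed
  qed (use R in \<open>auto intro!: borel_measurable_times_ennreal borel_measurable_indicator\<close>)
  then have "eventually (\<lambda>n. nsq (\<lambda>x. c R (g x) x - c R (G n x) x) < ennreal (e / 4)) sequentially"
    using e by (intro order_tendstoD(2)) auto
  then obtain n where n: "nsq (\<lambda>x. c R (g x) x - c R (G n x) x) < ennreal (e / 4)"
    unfolding eventually_sequentially by blast
  show ?thesis
  proof (rule that)
    have "continuous_on UNIV (\<lambda>x. radial_clip R (G n x))"
      by (rule continuous_on_compose2[OF continuous_radial_clip[OF R(1)] G]) auto
    then show "continuous_on UNIV (\<lambda>x. c R (G n x) x)"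
      unfolding c_def by (intro continuous_intros cont_cut)
    show "cmod (c R (G n x) x) \<le> R" for x by (rule c_le[OF R(1)])
    show "c R (G n x) x = 0" if "R \<le> norm x" for x using cut(3)[OF that] by (simp add: c_def)
    have "nsq (\<lambda>x. g x - c R (G n x) x)
        \<le> 2 * nsq (\<lambda>x. g x - c R (g x) x) + 2 * nsq (\<lambda>x. c R (g x) x - c R (G n x) x)"
      using R by (intro nsq_diff_le) auto
    also have "\<dots> < 2 * ennreal (e / 4) + 2 * ennreal (e / 4)"
      using R(2) n by (intro add_strict_mono ennreal_mult_strict_left_mono) auto
    also have "\<dots> = ennreal (2 * (e / 4)) + ennreal (2 * (e / 4))"
      using e by (subst (1 2) ennreal_mult) auto
    also have "\<dots> = ennreal e" using e by (subst ennreal_plus[symmetric]) auto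
    finally show "nsq (\<lambda>x. g x - c R (G n x) x) < ennreal e" .
  qed
qed

text \<open>For a continuous function of bounded support this is dominated convergence; translation
  invariance of \<open>nsq\<close> carries it to all square-integrable functions.\<close>

lemma nsq_translate_diff_tendsto:
  assumes [measurable]: "g \<in> borel_measurable borel" and fin: "nsq g < \<infinity>" and a: "a \<longlonglongrightarrow> 0"
  shows "(\<lambda>n. nsq (\<lambda>x. g (x + a n) - g x)) \<longlonglongrightarrow> 0"
proof (rule order_tendstoI)
  fix e :: ennreal assume "0 < e"
  then obtain e0 where e0: "0 < e0" "e0 < e" using dense by blast
  then obtain e' where e': "ennreal e' < e" "e' > 0" by (cases e0) auto
  \<comment> \<open>Two applications of \<open>nsq_diff_le\<close> add up to ten of these
    tolerances, so a sixteenth of \<open>e'\<close> is enough.\<close>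
  obtain \<phi> R where \<phi>: "continuous_on UNIV \<phi>" "\<And>x. cmod (\<phi> x) \<le> R" "\<And>x. R \<le> norm x \<Longrightarrow> \<phi> x = 0"
    "nsq (\<lambda>x. g x - \<phi> x) < ennreal (e' / 16)"
    using L2_approx_continuous[OF assms(1) fin, of "e' / 16"] e' by auto
  have [measurable]: "\<phi> \<in> borel_measurable borel" by (rule borel_measurable_continuous_onI[OF \<phi>(1)])
  obtain B where B: "\<And>n. norm (a n) \<le> B"
    using a convergent_imp_Bseq[of a] by (auto simp: convergent_def Bseq_def)
  have "(\<lambda>n. nsq (\<lambda>x. \<phi> (x + a n) - \<phi> x)) \<longlonglongrightarrow> (\<integral>\<^sup>+x. 0 \<partial>(lborel :: R3 measure))"
    unfolding nsq_def
  proof (rule nn_integral_dominated_convergence[where w="\<lambda>x. ennreal ((2 * R)\<^sup>2)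
    * indicator (ball 0 (R + B)) x"])
    show "(\<integral>\<^sup>+ x. ennreal ((2 * R)\<^sup>2) * indicator (ball 0 (R + B)) (x :: R3) \<partial>lborel) < \<infinity>"
      using emeasure_lborel_ball_finite[of "0::R3" "R + B"]
      by (subst nn_integral_cmult_indicator) (auto simp: ennreal_mult_less_top less_top)
    show "AE x in lborel. ennreal ((cmod (\<phi> (x + a j) - \<phi> x))\<^sup>2)
      \<le> ennreal ((2 * R)\<^sup>2) * indicator (ball 0 (R + B)) x" for j
    proof (rule AE_I2)
      fix x
      have "cmod (\<phi> (x + a j) - \<phi> x) \<le> 2 * R"
        using norm_triangle_ineq4[of "\<phi> (x + a j)" "\<phi> x"] \<phi>(2)[of x] \<phi>(2)[of "x + a j"] by simp
      then have 1: "(cmod (\<phi> (x + a j) - \<phi> x))\<^sup>2 \<le> (2 * R)\<^sup>2" by (intro power_mono) auto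
      have 2: "\<phi> (x + a j) = 0 \<and> \<phi> x = 0" if "R + B \<le> norm x"
      proof
        have "norm x \<le> norm (x + a j) + norm (a j)" using norm_triangle_ineq4[of "x + a j" "a j"] by simp
        then show "\<phi> (x + a j) = 0" using B[of j] that by (intro \<phi>(3)) linarith
        have "0 \<le> B" using order_trans[OF norm_ge_zero B[of 0]] .
        then show "\<phi> x = 0" using that by (intro \<phi>(3)) linarith
      qed
      show "ennreal ((cmod (\<phi> (x + a j) - \<phi> x))\<^sup>2) \<le> ennreal ((2 * R)\<^sup>2) * indicator (ball 0 (R + B)) x"
        using 1 2 by (auto simp: indicator_def intro!: ennreal_leI)
    qed
    show "AE x in lborel. (\<lambda>i. ennreal ((cmod (\<phi> (x + a i) - \<phi> x))\<^sup>2)) \<longlonglongrightarrow> 0"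
    proof (rule AE_I2)
      fix x
      have "isCont \<phi> (x + 0)" using \<phi>(1) by (simp add: continuous_on_eq_continuous_at)
      moreover have "(\<lambda>n. x + a n) \<longlonglongrightarrow> x + 0" by (intro tendsto_intros a)
      ultimately have "(\<lambda>n. \<phi> (x + a n)) \<longlonglongrightarrow> \<phi> (x + 0)" by (rule isCont_tendsto_compose)
      then have "(\<lambda>i. ennreal ((cmod (\<phi> (x + a i) - \<phi> x))\<^sup>2)) \<longlonglongrightarrow> ennreal ((cmod (\<phi> (x + 0) - \<phi> x))\<^sup>2)"
        by (intro tendsto_ennrealI tendsto_intros)
      then show "(\<lambda>i. ennreal ((cmod (\<phi> (x + a i) - \<phi> x))\<^sup>2)) \<longlonglongrightarrow> 0" by simp
    qed
  qed (auto intro!: borel_measurable_times_ennreal borel_measurable_indicator)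
  then have "eventually (\<lambda>n. nsq (\<lambda>x. \<phi> (x + a n) - \<phi> x) < ennreal (e' / 16)) sequentially"
    using e' by (intro order_tendstoD(2)) auto
  then show "eventually (\<lambda>n. nsq (\<lambda>x. g (x + a n) - g x) < e) sequentially"
  proof eventually_elim
    case (elim n)
    let ?d = "ennreal (e' / 16)"
    have 1: "nsq (\<lambda>x. g (x + a n) - \<phi> (x + a n)) \<le> ?d"
      using nsq_translate[of "\<lambda>x. g x - \<phi> x" "a n"] \<phi>(4) by (simp add: less_imp_le)
    have "nsq (\<lambda>x. g (x + a n) - g x)
        \<le> 2 * nsq (\<lambda>x. g (x + a n) - \<phi> (x + a n)) + 2 * nsq (\<lambda>x. \<phi> (x + a n) - g x)"
      by (intro nsq_diff_le) auto
    also have "\<dots> \<le> 2 * ?d + 2 * (2 * nsq (\<lambda>x. \<phi> (x + a n) - \<phi> x) + 2 * nsq (\<lambda>x. \<phi> x - g x))"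
      by (intro add_mono mult_left_mono nsq_diff_le 1) auto
    also have "\<dots> \<le> 2 * ?d + 2 * (2 * ?d + 2 * ?d)"
      using \<phi>(4) elim by (intro add_mono mult_left_mono) (auto simp: nsq_minus_commute[of \<phi>])
    also have "\<dots> = ennreal (2 * (e' / 16) + 2 * (2 * (e' / 16) + 2 * (e' / 16)))"
    proof -
      have two: "2 * ennreal x = ennreal (2 * x)" if "0 \<le> x" for x using that by (simp add: ennreal_mult)
      show ?thesis using e' by (simp add: two flip: ennreal_plus)
    qed
    also have "\<dots> \<le> ennreal e'" using e' by (intro ennreal_leI) simp
    finally show ?case using e'(1) by (rule le_less_trans)
  qed
qed simp

section \<open>Gaussians\<close>

text \<open>The characteristic function of the standard normal distribution at \<open>a / b\<close>,
  after the substitution of \<open>b * x\<close>.\<close>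

lemma gaussian_integral_1d:
  fixes a b :: real
  assumes b: "0 < b"
  shows "integrable lborel (\<lambda>x. cis (a * x) * of_real (exp (- (b * x)\<^sup>2 / 2)))"
    and "(LINT x|lborel. cis (a * x) * of_real (exp (- (b * x)\<^sup>2 / 2))) =
      of_real (sqrt (2 * pi) / b * exp (- (a / b)\<^sup>2 / 2))"
proof -
  let ?f = "\<lambda>t x. cis (t * x) * complex_of_real (exp (- x\<^sup>2 / 2))"
  have eq: "?f t x = of_real (sqrt (2 * pi)) * (std_normal_density x *\<^sub>R iexp (t * x))" for t x
    by (simp add: std_normal_density_def cis_conv_exp scaleR_conv_of_real)
  interpret P: real_distribution std_normal_distribution by (rule real_dist_normal_dist)
  have "integrable std_normal_distribution (\<lambda>x. iexp (t * x))" for t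
    by (rule P.integrable_iexp) auto
  then have i: "integrable lborel (\<lambda>x. std_normal_density x *\<^sub>R iexp (t * x))" for t
    by (subst (asm) integrable_density) auto
  then have int: "integrable lborel (?f t)" for t unfolding eq by (intro integrable_mult_right)
  have std: "(LINT x|lborel. std_normal_density x *\<^sub>R iexp (t * x)) = exp (- (t^2) / 2)" for t :: real
    using fun_cong[OF char_std_normal_distribution, of t] unfolding char_def
    by (subst (asm) integral_density) auto
  then have val: "integral\<^sup>L lborel (?f t) = of_real (sqrt (2 * pi) * exp (- t\<^sup>2 / 2))" for t
    unfolding eq integral_mult_right_zero std by simp
  have f: "?f (a / b) (0 + b * x) = cis (a * x) * of_real (exp (- (b * x)\<^sup>2 / 2))" for x
    using b by simp
  show "integrable lborel (\<lambda>x. cis (a * x) * of_real (exp (- (b * x)\<^sup>2 / 2)))"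
    using lborel_integrable_real_affine[OF int[of "a / b"], of b 0] b unfolding f by simp
  have "of_real (sqrt (2 * pi) * exp (- (a / b)\<^sup>2 / 2)) = \<bar>b\<bar> *\<^sub>R (LINT x|lborel. ?f (a / b) (0 + b * x))"
    using lborel_integral_real_affine[of b "?f (a / b)" 0] b val[of "a / b"] by simp
  then show "(LINT x|lborel. cis (a * x) * of_real (exp (- (b * x)\<^sup>2 / 2))) =
      of_real (sqrt (2 * pi) / b * exp (- (a / b)\<^sup>2 / 2))"
    unfolding f using b by (simp add: field_simps scaleR_conv_of_real)
qed

lemma inner_sum_scaleR_Basis:
  "b \<in> Basis \<Longrightarrow> (\<Sum>c\<in>Basis. f c *\<^sub>R c) \<bullet> (b :: 'a::euclidean_space) = f b"
  by (simp add: inner_sum_left_Basis)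

lemma norm_sq_eq_sum_Basis: "(norm (x :: 'a::euclidean_space))\<^sup>2 = (\<Sum>b\<in>Basis. (x \<bullet> b)\<^sup>2)"
  unfolding power2_norm_eq_inner by (subst euclidean_inner) (simp add: power2_eq_square)

lemma cis_sum: "finite A \<Longrightarrow> cis (\<Sum>a\<in>A. g a) = (\<Prod>a\<in>A. cis (g a))"
  by (induction A rule: finite_induct) (auto simp: cis_mult[symmetric])

text \<open>\<open>lborel\<close> is the image of a product of one-dimensional Lebesgue measures
  under the coordinate map, and the integrand factors over the coordinates.\<close>

lemma gaussian_integral:
  fixes \<xi> :: "'a::euclidean_space" and b :: real
  assumes b: "0 < b"
  shows "integrable lborel (\<lambda>x::'a. cis (\<xi> \<bullet> x) * of_real (exp (- (b * norm x)\<^sup>2 / 2)))" (is ?I)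
    and "(LINT x|lborel. cis (\<xi> \<bullet> x) * of_real (exp (- (b * norm (x::'a))\<^sup>2 / 2))) =
      of_real ((sqrt (2 * pi) / b) ^ DIM('a) * exp (- (norm \<xi> / b)\<^sup>2 / 2))" (is ?E)
proof -
  let ?g = "\<lambda>c x. cis ((\<xi> \<bullet> c) * x) * of_real (exp (- (b * x)\<^sup>2 / 2))"
  define F where "F x = cis (\<xi> \<bullet> x) * complex_of_real (exp (- (b * norm x)\<^sup>2 / 2))" for x :: 'a
  define T where "T f = (\<Sum>c\<in>Basis. f c *\<^sub>R c)" for f :: "'a \<Rightarrow> real"
  define G where "G f = (\<Prod>c\<in>Basis. ?g c (f c))" for f :: "'a \<Rightarrow> real"
  interpret product_sigma_finite "\<lambda>c::'a. lborel :: real measure" ..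
  have F: "F (T f) = G f" for f
  proof -
    have "\<xi> \<bullet> T f = (\<Sum>c\<in>Basis. (\<xi> \<bullet> c) * f c)" by (simp add: T_def inner_sum_right mult.commute)
    moreover have "- (b * norm (T f))\<^sup>2 / 2 = (\<Sum>c\<in>Basis. - (b * f c)\<^sup>2 / 2)"
      by (simp add: T_def power_mult_distrib norm_sq_eq_sum_Basis inner_sum_scaleR_Basis sum_distrib_left
        sum_divide_distrib sum_negf)
    ultimately show ?thesis by (simp add: F_def G_def cis_sum exp_sum prod.distrib)
  qed
  have Fm[measurable]: "F \<in> borel_measurable borel"
    unfolding F_def[abs_def] cis_conv_exp by (intro borel_measurable_continuous_onI continuous_intros) auto
  have T[measurable]: "T \<in> (\<Pi>\<^sub>M c\<in>Basis. lborel) \<rightarrow>\<^sub>M borel" unfolding T_def[abs_def] by simp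
  have lb: "lborel = distr (\<Pi>\<^sub>M c\<in>Basis. lborel) borel T" unfolding T_def[abs_def] by (rule lborel_eq)
  have int: "integrable (\<Pi>\<^sub>M c\<in>Basis. lborel) G"
    unfolding G_def[abs_def] by (rule product_integrable_prod) (simp, rule gaussian_integral_1d(1)[OF b])
  have "integrable lborel F"
    unfolding lb integrable_distr_eq[OF T Fm] F using int by simp
  then show ?I by (simp only: F_def[abs_def])
  have "(LINT x|lborel. F x) = (LINT f|(\<Pi>\<^sub>M c\<in>(Basis::'a set). lborel). G f)"
    unfolding lb integral_distr[OF T Fm] F ..
  also have "\<dots> = (\<Prod>c\<in>Basis. LINT x|lborel. ?g c x)"
    unfolding G_def by (rule product_integral_prod) (simp, rule gaussian_integral_1d(1)[OF b])
  also have "\<dots> = (\<Prod>c\<in>(Basis::'a set). of_real (sqrt (2 * pi) / b * exp (- ((\<xi> \<bullet> c) / b)\<^sup>2 / 2)))"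
    by (simp only: gaussian_integral_1d(2)[OF b])
  also have "\<dots> = of_real ((sqrt (2 * pi) / b) ^ DIM('a) * exp (- (norm \<xi> / b)\<^sup>2 / 2))"
  proof -
    have "exp (- (norm \<xi> / b)\<^sup>2 / 2) = (\<Prod>c\<in>Basis. exp (- ((\<xi> \<bullet> c) / b)\<^sup>2 / 2))"
      by (subst exp_sum[symmetric]) (auto simp: power_divide norm_sq_eq_sum_Basis sum_divide_distrib sum_negf)
    then show ?thesis by (simp only: of_real_prod[symmetric] prod.distrib prod_constant)
  qed
  finally show ?E by (simp only: F_def)
qed

lemma integrable_pair_dominated:
  fixes f :: "'a::euclidean_space \<Rightarrow> 'b::euclidean_space \<Rightarrow> complex"
  assumes [measurable]: "(\<lambda>(x, y). f x y) \<in> borel_measurable (borel \<Otimes>\<^sub>M borel)"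
    and a: "integrable lborel a" and b: "integrable lborel b"
    and le: "\<And>x y. norm (f x y) \<le> norm (a x :: complex) * norm (b y :: complex)"
  shows "integrable (lborel \<Otimes>\<^sub>M lborel) (\<lambda>(x, y). f x y)"
proof (rule integrableI_bounded)
  have [measurable]: "a \<in> borel_measurable borel" "b \<in> borel_measurable borel" using a b by auto
  have [measurable_cong]: "sets (lborel \<Otimes>\<^sub>M lborel)
    = sets (borel \<Otimes>\<^sub>M (borel :: 'b measure) :: ('a \<times> 'b) measure)"
    by (intro sets_pair_measure_cong) auto
  show "(\<lambda>(x, y). f x y) \<in> borel_measurable (lborel \<Otimes>\<^sub>M lborel)" by measurable
  have "(\<integral>\<^sup>+ z. norm (case z of (x, y) \<Rightarrow> f x y) \<partial>(lborel \<Otimes>\<^sub>M lborel))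
      \<le> (\<integral>\<^sup>+ z. ennreal (norm (a (fst z))) * ennreal (norm (b (snd z))) \<partial>(lborel \<Otimes>\<^sub>M lborel))"
    by (intro nn_integral_mono) (use le in \<open>auto simp: ennreal_mult[symmetric] intro!: ennreal_leI\<close>)
  also have "\<dots> = (\<integral>\<^sup>+ x. (\<integral>\<^sup>+ y. ennreal (norm (a x)) * ennreal (norm (b y)) \<partial>lborel) \<partial>lborel)"
    by (subst lborel.nn_integral_fst[symmetric]) auto
  also have "\<dots> = (\<integral>\<^sup>+ x. ennreal (norm (a x)) \<partial>lborel) * (\<integral>\<^sup>+ y. ennreal (norm (b y)) \<partial>lborel)"
    by (simp add: nn_integral_cmult nn_integral_multc)
  also have "\<dots> < \<infinity>" using a b by (auto simp: integrable_iff_bounded ennreal_mult_less_top)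
  finally show "(\<integral>\<^sup>+ z. norm (case z of (x, y) \<Rightarrow> f x y) \<partial>(lborel \<Otimes>\<^sub>M lborel)) < \<infinity>" .
qed

lemma measurable_cis_inner[measurable]:
  "(\<lambda>(x, y). cis (\<sigma> * (x \<bullet> y))) \<in> borel_measurable (borel \<Otimes>\<^sub>M (borel :: 'a::euclidean_space measure))"
proof -
  have "(\<lambda>z. cis (\<sigma> * (fst z \<bullet> snd z))) \<in> borel_measurable (borel :: ('a \<times> 'a) measure)"
    unfolding cis_conv_exp by (intro borel_measurable_continuous_onI continuous_intros)
  then show ?thesis by (simp add: borel_prod split_beta)
qed

text \<open>Fubini: the kernel has modulus one and is symmetric, so a transform can be moved from
  one factor to the other.\<close>

lemma fourier_multiplication_formula:
  fixes a b :: "'a::euclidean_space \<Rightarrow> complex"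
  assumes a: "integrable lborel a" and b: "integrable lborel b"
  shows "(LINT \<xi>|lborel. a \<xi> * (LINT y|lborel. cis (\<sigma> * (\<xi> \<bullet> y)) * b y))
    = (LINT y|lborel. b y * (LINT \<xi>|lborel. cis (\<sigma> * (\<xi> \<bullet> y)) * a \<xi>))"
proof -
  have [measurable]: "a \<in> borel_measurable borel" "b \<in> borel_measurable borel" using a b by auto
  have "integrable (lborel \<Otimes>\<^sub>M lborel) (\<lambda>(\<xi>, y). a \<xi> * (cis (\<sigma> * (\<xi> \<bullet> y)) * b y))"
    by (rule integrable_pair_dominated[OF _ a b]) (auto simp: norm_mult)
  then have "(LINT y|lborel. LINT \<xi>|lborel. a \<xi> * (cis (\<sigma> * (\<xi> \<bullet> y)) * b y))
    = (LINT \<xi>|lborel. LINT y|lborel. a \<xi> * (cis (\<sigma> * (\<xi> \<bullet> y)) * b y))"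
    by (rule lborel_pair.Fubini_integral)
  moreover have "(LINT \<xi>|lborel. a \<xi> * (cis (\<sigma> * (\<xi> \<bullet> y)) * b y))
    = b y * (LINT \<xi>|lborel. cis (\<sigma> * (\<xi> \<bullet> y)) * a \<xi>)" for y
    by (subst integral_mult_right_zero[symmetric]) (simp add: mult_ac)
  ultimately show ?thesis by (simp add: integral_mult_right_zero)
qed

section \<open>Fourier integrals under a Gaussian weight\<close>

definition trig_integral :: "real \<Rightarrow> (R3 \<Rightarrow> complex) \<Rightarrow> R3 \<Rightarrow> complex" where
  "trig_integral \<sigma> g \<xi> = (LINT x|lborel. cis (\<sigma> * (\<xi> \<bullet> x)) * g x)"

lemma fourier_integral_eq: "fourier_integral \<sigma> g \<xi> = of_real ((2 * pi) powr (- 3 / 2)) * trig_integral \<sigma> g \<xi>"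
  by (simp add: fourier_integral_def trig_integral_def)

lemma measurable_cis_inner'[measurable (raw)]:
  assumes [measurable]: "f \<in> M \<rightarrow>\<^sub>M borel" "g \<in> M \<rightarrow>\<^sub>M (borel :: 'a::euclidean_space measure)"
  shows "(\<lambda>x. cis (\<sigma> * (f x \<bullet> g x))) \<in> borel_measurable M"
proof -
  have "cis \<in> borel_measurable borel"
    unfolding cis_conv_exp by (intro borel_measurable_continuous_onI continuous_intros)
  moreover have "(\<lambda>x. \<sigma> * (f x \<bullet> g x)) \<in> borel_measurable M" by measurable
  ultimately show ?thesis by (rule measurable_compose[rotated])
qed

lemma measurable_trig_integral[measurable]:
  assumes [measurable]: "g \<in> borel_measurable borel"
  shows "trig_integral \<sigma> g \<in> borel_measurable borel"
  unfolding trig_integral_def[abs_def] by (intro lborel.borel_measurable_lebesgue_integral) measurable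

lemma measurable_fourier_integral[measurable]:
  assumes [measurable]: "g \<in> borel_measurable borel"
  shows "fourier_integral \<sigma> g \<in> borel_measurable borel"
  unfolding fourier_integral_eq[abs_def] by measurable

lemma integrable_trig:
  assumes "integrable lborel g"
  shows "integrable lborel (\<lambda>x. cis (\<sigma> * (\<xi> \<bullet> x)) * g x)"
proof -
  have [measurable]: "g \<in> borel_measurable borel" using assms by auto
  show ?thesis by (rule Bochner_Integration.integrable_bound[OF assms]) (auto simp: norm_mult)
qed

lemma norm_trig_integral_le:
  assumes "integrable lborel g"
  shows "cmod (trig_integral \<sigma> g \<xi>) \<le> (LINT x|lborel. cmod (g x))"
  using integral_norm_bound[of lborel "\<lambda>x. cis (\<sigma> * (\<xi> \<bullet> x)) * g x"]
    by (simp add: trig_integral_def norm_mult)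

definition gauss_density :: "R3 \<Rightarrow> real" where
  "gauss_density z = exp (- (norm z)\<^sup>2 / 2) / (sqrt (2 * pi)) ^ 3"

lemma gauss_density_pos: "0 < gauss_density z"
  by (simp add: gauss_density_def)

lemma measurable_gauss_density[measurable]: "gauss_density \<in> borel_measurable borel"
  unfolding gauss_density_def[abs_def] by measurable

lemma nn_integral_gauss_density: "(\<integral>\<^sup>+z. ennreal (gauss_density z) \<partial>lborel) = 1"
  and integrable_gauss_density: "integrable lborel gauss_density"
proof -
  have "integrable lborel (\<lambda>z::R3. Re (cis (0 \<bullet> z) * of_real (exp (- (1 * norm z)\<^sup>2 / 2))))"
    by (intro integrable_Re gaussian_integral) simp
  then have i: "integrable lborel (\<lambda>z::R3. exp (- (norm z)\<^sup>2 / 2))" by simp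
  then show int: "integrable lborel gauss_density"
    unfolding gauss_density_def[abs_def] by simp
  have "complex_of_real (LINT z|lborel. exp (- (norm (z::R3))\<^sup>2 / 2)) = of_real (sqrt (2 * pi) ^ 3)"
    using gaussian_integral(2)[of 1 "0::R3"] by (simp flip: integral_complex_of_real)
  then have "(LINT z|lborel. exp (- (norm (z::R3))\<^sup>2 / 2)) = sqrt (2 * pi) ^ 3" by (simp only: of_real_eq_iff)
  then have "(LINT z|lborel. gauss_density z) = 1"
    unfolding gauss_density_def by simp
  then show "(\<integral>\<^sup>+z. ennreal (gauss_density z) \<partial>lborel) = 1"
    using nn_integral_eq_integral[OF int] by (simp add: gauss_density_pos less_imp_le)
qed

text \<open>Two normalising factors of the transform times one Gaussian integral leave exactly the
  normalisation of \<open>gauss_density\<close>.\<close>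

lemma power_sqrt_2pi: "((2 * pi) powr (- 3 / 2))\<^sup>2 * (sqrt (2 * pi)) ^ 3 = 1 / (sqrt (2 * pi)) ^ 3"
proof -
  have s: "sqrt (2 * pi) = (2 * pi) powr (1 / 2)" by (simp add: powr_half_sqrt)
  show ?thesis unfolding s by (simp flip: powr_power powr_add powr_minus_divide) (simp add: powr_power
    powr_minus_divide[symmetric] powr_add[symmetric])
qed

text \<open>Parseval's identity with a Gaussian weight that makes every integral absolutely
  convergent. The squared modulus is a product of a transform and a conjugate transform; moving both
  onto the weight leaves the transform of the weight, a Gaussian of width \<open>e\<close> in
  \<open>x - y\<close>. The substitution \<open>x = y + e *\<^sub>R z\<close> then shows the
  correlation of \<open>g\<close> with its mollification.\<close>

lemma gaussian_weighted_fourier: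
  fixes g :: "R3 \<Rightarrow> complex"
  assumes g: "integrable lborel g" and \<sigma>: "\<bar>\<sigma>\<bar> = 1" and e: "0 < e"
  shows "(LINT \<xi>|lborel. of_real ((cmod (fourier_integral \<sigma> g \<xi>))\<^sup>2 * exp (- (e * norm \<xi>)\<^sup>2 / 2)))
    = (LINT y|lborel. cnj (g y) * (LINT z|lborel. gauss_density z *\<^sub>R g (y + e *\<^sub>R z)))"
proof -
  define c where "c = (2 * pi) powr (- 3 / 2)"
  define E where "E \<xi> = complex_of_real (exp (- (e * norm (\<xi>::R3))\<^sup>2 / 2))" for \<xi>
  have [measurable]: "g \<in> borel_measurable borel" using g by auto
  have Em[measurable]: "E \<in> borel_measurable borel" unfolding E_def[abs_def] by measurable
  have E: "integrable lborel E"
    using gaussian_integral(1)[OF e, of "0::R3"] by (simp add: E_def[abs_def])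
  have cE: "integrable lborel (\<lambda>\<xi>. cis (\<sigma> * (\<xi> \<bullet> y)) * E \<xi>)" for \<sigma> and y :: R3
    by (rule Bochner_Integration.integrable_bound[OF E]) (auto simp: norm_mult)
  have Eg: "integrable lborel (\<lambda>\<xi>. E \<xi> * trig_integral \<sigma> g \<xi>)" for \<sigma>
  proof (rule Bochner_Integration.integrable_bound)
    show "integrable lborel (\<lambda>\<xi>. E \<xi> * of_real (LINT x|lborel. cmod (g x)))" using E by simp
    show "AE \<xi> in lborel. cmod (E \<xi> * trig_integral \<sigma> g \<xi>) \<le> cmod (E \<xi> * of_real (LINT x|lborel. cmod (g x)))"
      unfolding norm_mult by (intro AE_I2 mult_left_mono) (use norm_trig_integral_le[OF g] in auto)
  qed measurable
  have cg: "integrable lborel (\<lambda>y. cnj (g y))" using g by simp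
  have cnj_trig: "cnj (trig_integral \<sigma> g \<xi>) = (LINT y|lborel. cis ((-\<sigma>) * (\<xi> \<bullet> y)) * cnj (g y))" for \<xi>
  proof -
    have "(LINT y|lborel. cis ((-\<sigma>) * (\<xi> \<bullet> y)) * cnj (g y)) = (LINT y|lborel. cnj (cis (\<sigma> * (\<xi> \<bullet> y)) * g y))"
      by (intro Bochner_Integration.integral_cong) (auto simp: cis_cnj)
    also have "\<dots> = cnj (trig_integral \<sigma> g \<xi>)" unfolding trig_integral_def
      by (rule Bochner_Integration.integral_cnj)
    finally show ?thesis ..
  qed
  have "(LINT \<xi>|lborel. of_real ((cmod (fourier_integral \<sigma> g \<xi>))\<^sup>2 * exp (- (e * norm \<xi>)\<^sup>2 / 2)))
      = (LINT \<xi>|lborel. of_real (c\<^sup>2)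
        * ((E \<xi> * trig_integral \<sigma> g \<xi>) * (LINT y|lborel. cis ((-\<sigma>) * (\<xi> \<bullet> y)) * cnj (g y))))"
  proof (rule Bochner_Integration.integral_cong[OF refl])
    fix \<xi> :: R3
    have "complex_of_real ((cmod (trig_integral \<sigma> g \<xi>))\<^sup>2) = trig_integral \<sigma> g \<xi> * cnj (trig_integral \<sigma> g \<xi>)"
      by (rule complex_norm_square)
    then show "of_real ((cmod (fourier_integral \<sigma> g \<xi>))\<^sup>2 * exp (- (e * norm \<xi>)\<^sup>2 / 2))
      = of_real (c\<^sup>2) * ((E \<xi> * trig_integral \<sigma> g \<xi>) * (LINT y|lborel. cis ((-\<sigma>) * (\<xi> \<bullet> y)) * cnj (g y)))"
      unfolding cnj_trig[symmetric] fourier_integral_eq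
      by (simp add: norm_mult power_mult_distrib E_def c_def mult_ac)
  qed
  also have "\<dots> = of_real (c\<^sup>2)
    * (LINT y|lborel. cnj (g y) * (LINT \<xi>|lborel. cis ((-\<sigma>) * (\<xi> \<bullet> y)) * (E \<xi> * trig_integral \<sigma> g \<xi>)))"
    by (subst fourier_multiplication_formula[OF Eg cg, symmetric]) simp
  also have "\<dots> = (LINT y|lborel. cnj (g y) * (LINT z|lborel. gauss_density z *\<^sub>R g (y + e *\<^sub>R z)))"
  proof -
    have "of_real (c\<^sup>2) * (LINT \<xi>|lborel. cis ((-\<sigma>) * (\<xi> \<bullet> y)) * (E \<xi> * trig_integral \<sigma> g \<xi>))
      = (LINT z|lborel. gauss_density z *\<^sub>R g (y + e *\<^sub>R z))" for y
    proof -
      have "(LINT \<xi>|lborel. cis ((-\<sigma>) * (\<xi> \<bullet> y)) * (E \<xi> * trig_integral \<sigma> g \<xi>))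
        = (LINT \<xi>|lborel. (cis ((-\<sigma>) * (\<xi> \<bullet> y)) * E \<xi>) * (LINT x|lborel. cis (\<sigma> * (\<xi> \<bullet> x)) * g x))"
        by (simp add: trig_integral_def mult_ac)
      also have "\<dots> = (LINT x|lborel. g x * (LINT \<xi>|lborel. cis (\<sigma> * (\<xi> \<bullet> x)) * (cis ((-\<sigma>) * (\<xi> \<bullet> y)) * E \<xi>)))"
        by (rule fourier_multiplication_formula[OF cE g])
      also have "\<dots> = (LINT x|lborel. g x
        * of_real ((sqrt (2 * pi) / e) ^ 3 * exp (- (norm (x - y) / e)\<^sup>2 / 2)))"
      proof (rule Bochner_Integration.integral_cong[OF refl])
        fix x
        have "(LINT \<xi>|lborel. cis (\<sigma> * (\<xi> \<bullet> x)) * (cis ((-\<sigma>) * (\<xi> \<bullet> y)) * E \<xi>))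
          = (LINT \<xi>|lborel. cis ((\<sigma> *\<^sub>R (x - y)) \<bullet> \<xi>) * E \<xi>)"
          by (simp add: cis_mult inner_diff_left inner_diff_right inner_commute algebra_simps flip:
            mult.assoc)
        also have "\<dots> = of_real ((sqrt (2 * pi) / e) ^ 3 * exp (- (norm (x - y) / e)\<^sup>2 / 2))"
          unfolding E_def by (subst gaussian_integral(2)[OF e]) (use \<sigma> in simp)
        finally show "g x * (LINT \<xi>|lborel. cis (\<sigma> * (\<xi> \<bullet> x)) * (cis ((-\<sigma>) * (\<xi> \<bullet> y)) * E \<xi>))
          = g x * of_real ((sqrt (2 * pi) / e) ^ 3 * exp (- (norm (x - y) / e)\<^sup>2 / 2))" by simp
      qed
      also have "\<dots> = (LINT z|lborel. e ^ 3 *\<^sub>R (g (y + e *\<^sub>R z)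
        * of_real ((sqrt (2 * pi) / e) ^ 3 * exp (- (norm z)\<^sup>2 / 2))))"
      proof -
        have "(LINT x|lborel. g x * of_real ((sqrt (2 * pi) / e) ^ 3 * exp (- (norm (x - y) / e)\<^sup>2 / 2)))
          = (LINT z|lborel. \<bar>e\<bar> ^ DIM(R3) *\<^sub>R (g (y + e *\<^sub>R z)
            * of_real ((sqrt (2 * pi) / e) ^ 3 * exp (- (norm (y + e *\<^sub>R z - y) / e)\<^sup>2 / 2))))"
          by (subst lborel_affine[of e y]) (use e in \<open>simp_all add: integral_density integral_distr\<close>)
        then show ?thesis using e by (simp add: norm_minus_commute)
      qed
      finally have *: "(LINT \<xi>|lborel. cis ((-\<sigma>) * (\<xi> \<bullet> y)) * (E \<xi> * trig_integral \<sigma> g \<xi>)) = \<dots>" .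
      have k: "of_real (c\<^sup>2) * (e ^ 3 *\<^sub>R (g (y + e *\<^sub>R z)
        * of_real ((sqrt (2 * pi) / e) ^ 3 * exp (- (norm z)\<^sup>2 / 2))))
         = gauss_density z *\<^sub>R g (y + e *\<^sub>R z)" for z
      proof -
        have "c\<^sup>2 * (e ^ 3 * ((sqrt (2 * pi) / e) ^ 3 * exp (- (norm z)\<^sup>2 / 2)))
          = (c\<^sup>2 * sqrt (2 * pi) ^ 3) * exp (- (norm z)\<^sup>2 / 2)"
          using e by (simp add: power_divide)
        also have "\<dots> = gauss_density z" unfolding c_def power_sqrt_2pi by (simp add: gauss_density_def)
        finally have "complex_of_real (c\<^sup>2 * (e ^ 3 * ((sqrt (2 * pi) / e) ^ 3 * exp (- (norm z)\<^sup>2 / 2))))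
          * g (y + e *\<^sub>R z) = of_real (gauss_density z) * g (y + e *\<^sub>R z)"
          by simp
        then show ?thesis by (simp add: scaleR_conv_of_real mult_ac)
      qed
      show ?thesis unfolding * by (subst integral_mult_right_zero[symmetric]) (simp only: k)
    qed
    note key = this
    show ?thesis
      by (subst integral_mult_right_zero[symmetric]) (simp only: key[symmetric] mult.left_commute)
  qed
  finally show ?thesis .
qed

section \<open>Plancherel's theorem\<close>

lemma integrable_L2_of_nsq:
  assumes [measurable]: "g \<in> borel_measurable borel" and "nsq g < \<infinity>"
  shows "integrable lborel (\<lambda>x. (cmod (g x))\<^sup>2)" "(LINT x|lborel. (cmod (g x))\<^sup>2) = enn2real (nsq g)"
proof -
  show "integrable lborel (\<lambda>x. (cmod (g x))\<^sup>2)"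
    using assms(2) by (intro integrableI_bounded) (auto simp: nsq_def)
  show "(LINT x|lborel. (cmod (g x))\<^sup>2) = enn2real (nsq g)"
    unfolding nsq_def by (rule integral_eq_nn_integral) auto
qed

lemma Re_cnj_mult: "Re (cnj a * b) = ((cmod a)\<^sup>2 + (cmod b)\<^sup>2 - (cmod (b - a))\<^sup>2) / 2"
  unfolding cmod_power2 by (simp add: power2_eq_square algebra_simps)

lemma norm_mult_le_sum_squares: "norm a * norm b \<le> (norm a)\<^sup>2 + (norm b)\<^sup>2"
  using sum_squares_bound[of "norm a" "norm b"] mult_nonneg_nonneg[of "norm a" "norm b"] norm_ge_zero[of
    a] norm_ge_zero[of b]
  by linarith

lemma nsq_translate_diff_le:
  assumes [measurable]: "g \<in> borel_measurable borel"
  shows "nsq (\<lambda>x. g (x + h) - g x) \<le> 4 * nsq g"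
proof -
  have "nsq (\<lambda>x. g (x + h) + (- g x)) \<le> 2 * nsq (\<lambda>x. g (x + h)) + 2 * nsq (\<lambda>x. - g x)"
    by (intro nsq_add_le) auto
  also have "\<dots> = 2 * nsq g + 2 * nsq g" by (simp add: nsq_translate) (simp add: nsq_def)
  also have "\<dots> = 4 * nsq g" by (simp flip: distrib_right)
  finally show ?thesis by simp
qed

text \<open>Polarisation under the integral: both square terms integrate to \<open>nsq g\<close>, so
  the correlation falls short of \<open>nsq g\<close> only by half the Gaussian average of the
  \<open>L2\<close> modulus of continuity at scale \<open>e\<close>.\<close>

lemma gaussian_correlation:
  assumes [measurable]: "g \<in> borel_measurable borel" and fin: "nsq g < \<infinity>"
  shows "Re (LINT y|lborel. cnj (g y) * (LINT z|lborel. gauss_density z *\<^sub>R g (y + e *\<^sub>R z)))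
    = enn2real (nsq g) - (LINT z|lborel. gauss_density z * enn2real (nsq (\<lambda>y. g (y + e *\<^sub>R z) - g y))) / 2"
    and "integrable lborel (\<lambda>z. gauss_density z * enn2real (nsq (\<lambda>y. g (y + e *\<^sub>R z) - g y)))"
proof -
  let ?f = "\<lambda>y z. cnj (g y) * (gauss_density z *\<^sub>R g (y + e *\<^sub>R z))"
  let ?D = "\<lambda>z. enn2real (nsq (\<lambda>y. g (y + e *\<^sub>R z) - g y))"
  have [measurable]: "(\<lambda>p. g (fst p + e *\<^sub>R snd p)) \<in> borel_measurable (lborel \<Otimes>\<^sub>M lborel)"
    by (rule measurable_compose[OF _ assms(1)]) simp
  have "cnj \<in> borel_measurable borel" by (intro borel_measurable_continuous_onI continuous_intros)
  then have cg[measurable]: "(\<lambda>y. cnj (g y)) \<in> borel_measurable borel"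
    by (rule measurable_compose[OF assms(1)])
  have fm: "(\<lambda>(y, z). ?f y z) \<in> borel_measurable (lborel \<Otimes>\<^sub>M lborel)"
    unfolding split_beta
    by (intro borel_measurable_times borel_measurable_scaleR measurable_compose[OF measurable_fst]
        measurable_compose[OF measurable_snd]) (simp_all add: cg)
  have "(\<integral>\<^sup>+ p. norm (case p of (y, z) \<Rightarrow> ?f y z) \<partial>(lborel \<Otimes>\<^sub>M lborel))
    = (\<integral>\<^sup>+ z. (\<integral>\<^sup>+ y. norm (?f y z) \<partial>lborel) \<partial>lborel)"
    using fm by (subst lborel_pair.nn_integral_snd[symmetric]) auto
  also have "\<dots> \<le> (\<integral>\<^sup>+ z. ennreal (gauss_density z) * (2 * nsq g) \<partial>lborel)"
  proof (rule nn_integral_mono)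
    fix z
    have "(\<integral>\<^sup>+ y. norm (?f y z) \<partial>lborel)
      \<le> (\<integral>\<^sup>+ y. ennreal (gauss_density z) * (ennreal ((cmod (g y))\<^sup>2)
        + ennreal ((cmod (g (y + e *\<^sub>R z)))\<^sup>2)) \<partial>lborel)"
    proof (rule nn_integral_mono)
      fix y
      have "norm (?f y z) = gauss_density z * (cmod (g y) * cmod (g (y + e *\<^sub>R z)))"
        using gauss_density_pos[of z] by (simp add: norm_mult)
      also have "\<dots> \<le> gauss_density z * ((cmod (g y))\<^sup>2 + (cmod (g (y + e *\<^sub>R z)))\<^sup>2)"
        using gauss_density_pos[of z] by (intro mult_left_mono norm_mult_le_sum_squares) auto
      finally have "ennreal (norm (?f y z))
        \<le> ennreal (gauss_density z * ((cmod (g y))\<^sup>2 + (cmod (g (y + e *\<^sub>R z)))\<^sup>2))"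
        by (rule ennreal_leI)
      then show "ennreal (norm (?f y z))
        \<le> ennreal (gauss_density z) * (ennreal ((cmod (g y))\<^sup>2) + ennreal ((cmod (g (y + e *\<^sub>R z)))\<^sup>2))"
        using gauss_density_pos[of z] by (simp add: ennreal_mult less_imp_le)
    qed
    also have "\<dots> = ennreal (gauss_density z) * (nsq g + nsq (\<lambda>y. g (y + e *\<^sub>R z)))"
      unfolding nsq_def by (subst nn_integral_cmult) (auto simp: nn_integral_add)
    also have "\<dots> = ennreal (gauss_density z) * (2 * nsq g)" by (simp add: nsq_translate mult_2)
    finally show "(\<integral>\<^sup>+ y. norm (?f y z) \<partial>lborel) \<le> ennreal (gauss_density z) * (2 * nsq g)" .
  qed
  also have "\<dots> = 2 * nsq g" by (simp add: nn_integral_multc nn_integral_gauss_density)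
  also have "\<dots> < \<infinity>" using fin by (simp add: ennreal_mult_less_top)
  finally have int: "integrable (lborel \<Otimes>\<^sub>M lborel) (\<lambda>(y, z). ?f y z)"
    using fm by (intro integrableI_bounded) auto
  have Dm[measurable]: "?D \<in> borel_measurable borel"
    unfolding nsq_def by measurable
  have D_le: "?D z \<le> 4 * enn2real (nsq g)" for z
  proof -
    have "?D z \<le> enn2real (4 * nsq g)"
      using fin by (intro enn2real_mono nsq_translate_diff_le) (auto simp: ennreal_mult_less_top)
    then show ?thesis by (simp add: enn2real_mult)
  qed
  show Di: "integrable lborel (\<lambda>z. gauss_density z * ?D z)"
  proof (rule Bochner_Integration.integrable_bound)
    show "integrable lborel (\<lambda>z. gauss_density z * (4 * enn2real (nsq g)))" using integrable_gauss_density
      by simp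
    show "AE z in lborel. norm (gauss_density z * ?D z) \<le> norm (gauss_density z * (4 * enn2real (nsq g)))"
      using D_le by (auto simp: norm_mult less_imp_le[OF gauss_density_pos] intro!: mult_left_mono)
  qed measurable
  have "(LINT y|lborel. cnj (g y) * (LINT z|lborel. gauss_density z *\<^sub>R g (y + e *\<^sub>R z)))
    = (LINT y|lborel. LINT z|lborel. ?f y z)" by (simp only: integral_mult_right_zero)
  also have "\<dots> = (LINT z|lborel. LINT y|lborel. ?f y z)"
    by (rule lborel_pair.Fubini_integral[OF int, symmetric])
  finally have "Re (LINT y|lborel. cnj (g y) * (LINT z|lborel. gauss_density z *\<^sub>R g (y + e *\<^sub>R z)))
    = Re (LINT z|lborel. LINT y|lborel. ?f y z)" by simp
  also have "\<dots> = (LINT z|lborel. Re (LINT y|lborel. ?f y z))"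
    by (rule integral_Re[OF lborel_pair.integrable_snd[OF int], symmetric])
  also have "\<dots> = (LINT z|lborel. gauss_density z * (enn2real (nsq g) - ?D z / 2))"
  proof (rule Bochner_Integration.integral_cong[OF refl])
    fix z
    let ?G = "\<lambda>y. g (y + e *\<^sub>R z)"
    have nG: "nsq ?G = nsq g" by (rule nsq_translate) simp
    have nD: "nsq (\<lambda>y. ?G y - g y) < \<infinity>"
      using nsq_translate_diff_le[of g "e *\<^sub>R z"] fin
        by (auto simp: ennreal_mult_less_top elim!: le_less_trans)
    have iprod: "integrable lborel (\<lambda>y. cnj (g y) * ?G y)"
    proof (rule Bochner_Integration.integrable_bound)
      show "integrable lborel (\<lambda>y. (cmod (g y))\<^sup>2 + (cmod (?G y))\<^sup>2)"
        using fin nG by (intro Bochner_Integration.integrable_add integrable_L2_of_nsq) auto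
      show "AE y in lborel. norm (cnj (g y) * ?G y) \<le> norm ((cmod (g y))\<^sup>2 + (cmod (?G y))\<^sup>2)"
        using norm_mult_le_sum_squares by (intro AE_I2) (simp add: norm_mult)
    qed measurable
    have "(LINT y|lborel. ?f y z) = gauss_density z *\<^sub>R (LINT y|lborel. cnj (g y) * ?G y)"
      by (subst integral_scaleR_right[symmetric]) simp
    then have "Re (LINT y|lborel. ?f y z) = gauss_density z * (LINT y|lborel. Re (cnj (g y) * ?G y))"
      using integral_Re[OF iprod] by simp
    also have "(LINT y|lborel. Re (cnj (g y) * ?G y))
      = (LINT y|lborel. ((cmod (g y))\<^sup>2 + (cmod (?G y))\<^sup>2 - (cmod (?G y - g y))\<^sup>2) / 2)"
      by (simp only: Re_cnj_mult)
    also have "\<dots> = ((LINT y|lborel. (cmod (g y))\<^sup>2) + (LINT y|lborel. (cmod (?G y))\<^sup>2)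
        - (LINT y|lborel. (cmod (?G y - g y))\<^sup>2)) / 2"
      using fin nG nD by (simp add: integrable_L2_of_nsq(1))
    also have "\<dots> = enn2real (nsq g) - ?D z / 2"
      using fin nG nD by (simp add: integrable_L2_of_nsq(2) field_simps)
    finally show "Re (LINT y|lborel. ?f y z) = gauss_density z * (enn2real (nsq g) - ?D z / 2)" .
  qed
  also have "\<dots> = (LINT z|lborel. enn2real (nsq g) * gauss_density z - (gauss_density z * ?D z) / 2)"
    by (simp add: algebra_simps)
  also have "\<dots> = enn2real (nsq g) * (LINT z|lborel. gauss_density z)
    - (LINT z|lborel. gauss_density z * ?D z) / 2"
    using Di integrable_gauss_density by simp
  also have "(LINT z|lborel. gauss_density z) = 1"
    using nn_integral_gauss_density gauss_density_pos
    by (subst integral_eq_nn_integral) (auto simp: less_imp_le)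
  finally show "Re (LINT y|lborel. cnj (g y) * (LINT z|lborel. gauss_density z *\<^sub>R g (y + e *\<^sub>R z)))
    = enn2real (nsq g) - (LINT z|lborel. gauss_density z * ?D z) / 2" by simp
qed

text \<open>Let \<open>e\<close> tend to 0 in the weighted identity. On the Fourier side the weights
  increase to 1, so monotone convergence applies before the limit is known to be finite; on the
  other side the modulus of continuity disappears by dominated convergence.\<close>

lemma plancherel_integrable:
  assumes g: "integrable lborel g" and fin: "nsq g < \<infinity>" and \<sigma>: "\<bar>\<sigma>\<bar> = 1"
  shows "nsq (fourier_integral \<sigma> g) = nsq g"
proof -
  define e where "e n = 1 / real (Suc n)" for n
  have e: "0 < e n" for n by (simp add: e_def)
  have e_lim: "e \<longlonglongrightarrow> 0" unfolding e_def using LIMSEQ_inverse_real_of_nat by (simp add: inverse_eq_divide)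
  have e_dec: "e (Suc n) \<le> e n" for n by (simp add: e_def field_simps)
  have [measurable]: "g \<in> borel_measurable borel" using g by auto
  let ?F = "fourier_integral \<sigma> g"
  let ?w = "\<lambda>n \<xi>. (cmod (?F \<xi>))\<^sup>2 * exp (- (e n * norm \<xi>)\<^sup>2 / 2)"
  let ?D = "\<lambda>h. enn2real (nsq (\<lambda>y. g (y + h) - g y))"
  have "(\<lambda>n. LINT z|lborel. gauss_density z * ?D (e n *\<^sub>R z)) \<longlonglongrightarrow> (LINT z|(lborel :: R3 measure). 0)"
  proof (rule integral_dominated_convergence[where w="\<lambda>z. gauss_density z * (4 * enn2real (nsq g))"])
    show "integrable lborel (\<lambda>z. gauss_density z * (4 * enn2real (nsq g)))" using integrable_gauss_density
      by simp
    show "(\<lambda>z. gauss_density z * ?D (e n *\<^sub>R z)) \<in> borel_measurable lborel" for n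
      using gaussian_correlation(2)[of g "e n"] fin by auto
    show "AE z in lborel. norm (gauss_density z * ?D (e n *\<^sub>R z))
      \<le> gauss_density z * (4 * enn2real (nsq g))" for n
    proof (rule AE_I2)
      fix z
      have "?D (e n *\<^sub>R z) \<le> enn2real (4 * nsq g)"
        using fin by (intro enn2real_mono nsq_translate_diff_le) (auto simp: ennreal_mult_less_top)
      then show "norm (gauss_density z * ?D (e n *\<^sub>R z)) \<le> gauss_density z * (4 * enn2real (nsq g))"
        using gauss_density_pos[of z] by (auto simp: norm_mult enn2real_mult intro!: mult_left_mono)
    qed
    show "AE z in lborel. (\<lambda>n. gauss_density z * ?D (e n *\<^sub>R z)) \<longlonglongrightarrow> 0"
    proof (rule AE_I2)
      fix z :: R3
      have "(\<lambda>n. e n *\<^sub>R z) \<longlonglongrightarrow> 0 *\<^sub>R z" by (rule tendsto_scaleR[OF e_lim tendsto_const])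
      then have "(\<lambda>n. nsq (\<lambda>y. g (y + e n *\<^sub>R z) - g y)) \<longlonglongrightarrow> 0"
        using fin by (intro nsq_translate_diff_tendsto) auto
      then have "(\<lambda>n. ?D (e n *\<^sub>R z)) \<longlonglongrightarrow> 0" by (simp flip: ennreal_0 add: tendsto_enn2real)
      then show "(\<lambda>n. gauss_density z * ?D (e n *\<^sub>R z)) \<longlonglongrightarrow> 0"
        using tendsto_mult_left[of _ 0 sequentially "gauss_density z"] by fastforce
    qed
  qed simp
  then have lim0: "(\<lambda>n. enn2real (nsq g) - (LINT z|lborel. gauss_density z * ?D (e n *\<^sub>R z)) / 2)
    \<longlonglongrightarrow> enn2real (nsq g) - 0 / 2"
    by (intro tendsto_intros) simp_all
  have J: "(LINT \<xi>|lborel. ?w n \<xi>)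
    = enn2real (nsq g) - (LINT z|lborel. gauss_density z * ?D (e n *\<^sub>R z)) / 2" for n
    using arg_cong[OF gaussian_weighted_fourier[OF g \<sigma> e[of n]], of Re] gaussian_correlation(1)[of g "e
      n"] fin
    by (simp only: integral_complex_of_real Re_complex_of_real) simp
  have wi: "integrable lborel (?w n)" for n
  proof (rule Bochner_Integration.integrable_bound)
    let ?B = "(2 * pi) powr (- 3 / 2) * (LINT x|lborel. cmod (g x))"
    show "integrable lborel (\<lambda>\<xi>::R3. Re (?B\<^sup>2 * (cis (0 \<bullet> \<xi>) * of_real (exp (- (e n * norm \<xi>)\<^sup>2 / 2)))))"
      by (intro integrable_Re integrable_mult_right gaussian_integral e)
    show "AE \<xi> in lborel. norm (?w n \<xi>)
      \<le> norm (Re (?B\<^sup>2 * (cis (0 \<bullet> \<xi>) * of_real (exp (- (e n * norm \<xi>)\<^sup>2 / 2)))))"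
    proof (rule AE_I2)
      fix \<xi> :: R3
      have "cmod (?F \<xi>) \<le> ?B"
        unfolding fourier_integral_eq norm_mult using norm_trig_integral_le[OF g]
        by (auto intro!: mult_left_mono)
      then have "(cmod (?F \<xi>))\<^sup>2 \<le> ?B\<^sup>2" by (intro power_mono) auto
      then have "?w n \<xi> \<le> ?B\<^sup>2 * exp (- (e n * norm \<xi>)\<^sup>2 / 2)" by (intro mult_right_mono) auto
      then show "norm (?w n \<xi>) \<le> norm (Re (?B\<^sup>2 * (cis (0 \<bullet> \<xi>) * of_real (exp (- (e n * norm \<xi>)\<^sup>2 / 2)))))"
        by (simp flip: of_real_power of_real_mult)
    qed
  qed measurable
  have "(\<lambda>n. \<integral>\<^sup>+\<xi>. ennreal (?w n \<xi>) \<partial>lborel) \<longlonglongrightarrow> (\<integral>\<^sup>+\<xi>. ennreal ((cmod (?F \<xi>))\<^sup>2) \<partial>lborel)"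
  proof (rule nn_integral_LIMSEQ)
    have "?w n \<xi> \<le> ?w (Suc n) \<xi>" for n \<xi>
    proof -
      have "(e (Suc n) * norm \<xi>)\<^sup>2 \<le> (e n * norm \<xi>)\<^sup>2"
        using e_dec[of n] e[of "Suc n"] by (intro power_mono mult_right_mono) (auto simp: less_imp_le)
      then show ?thesis by (intro mult_left_mono) auto
    qed
    then show "incseq (\<lambda>n \<xi>. ennreal (?w n \<xi>))" by (auto simp: incseq_Suc_iff le_fun_def intro!: ennreal_leI)
    fix \<xi> :: R3
    have "(\<lambda>n. ?w n \<xi>) \<longlonglongrightarrow> (cmod (?F \<xi>))\<^sup>2 * exp (- (0 * norm \<xi>)\<^sup>2 / 2)"
      by (intro tendsto_intros e_lim) auto
    then show "(\<lambda>n. ennreal (?w n \<xi>)) \<longlonglongrightarrow> ennreal ((cmod (?F \<xi>))\<^sup>2)" by (intro tendsto_ennrealI) simp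
  qed measurable
  then have "(\<lambda>n. ennreal (LINT \<xi>|lborel. ?w n \<xi>)) \<longlonglongrightarrow> nsq ?F"
    unfolding nsq_def by (subst (asm) nn_integral_eq_integral[OF wi]) auto
  moreover have "(\<lambda>n. ennreal (LINT \<xi>|lborel. ?w n \<xi>)) \<longlonglongrightarrow> ennreal (enn2real (nsq g))"
    unfolding J using lim0 by (intro tendsto_ennrealI) simp
  ultimately have "nsq ?F = ennreal (enn2real (nsq g))" by (rule LIMSEQ_unique)
  then show ?thesis using fin by simp
qed

section \<open>The Fourier transform of square-integrable functions\<close>

definition trunc :: "nat \<Rightarrow> (R3 \<Rightarrow> complex) \<Rightarrow> R3 \<Rightarrow> complex" where
  "trunc n g = (\<lambda>x. if x \<in> ball 0 (real n) then g x else 0)"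

lemma is_fourier_L2_iff:
  "is_fourier_L2 \<sigma> g h \<longleftrightarrow> h \<in> L2 \<and> (\<lambda>n. nsq (\<lambda>\<xi>. h \<xi> - fourier_integral \<sigma> (trunc n g) \<xi>)) \<longlonglongrightarrow> 0"
  by (simp add: is_fourier_L2_def nsq_def trunc_def)

lemma measurable_trunc[measurable]:
  "g \<in> borel_measurable borel \<Longrightarrow> trunc n g \<in> borel_measurable borel"
  unfolding trunc_def by (rule measurable_If_set) auto

lemma nsq_trunc_le: "nsq (trunc n g) \<le> nsq g"
  unfolding nsq_def trunc_def by (intro nn_integral_mono ennreal_leI) auto

lemma integrable_trunc:
  assumes [measurable]: "g \<in> borel_measurable borel" and fin: "nsq g < \<infinity>"
  shows "integrable lborel (trunc n g)"
proof (rule Bochner_Integration.integrable_bound)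
  have "integrable lborel (indicat_real (ball (0::R3) (real n)))"
    using emeasure_lborel_ball_finite[of "0::R3" "real n"]
      by (intro integrable_real_indicator) (auto simp: less_top)
  then show "integrable lborel (\<lambda>x. indicat_real (ball 0 (real n)) x + (cmod (g x))\<^sup>2)"
    by (intro Bochner_Integration.integrable_add integrable_L2_of_nsq) (use fin in auto)
  have *: "cmod (g x) \<le> 1 + (cmod (g x))\<^sup>2" for x
    using sum_squares_bound[of 1 "cmod (g x)"] norm_ge_zero[of "g x"] unfolding power_one by linarith
  show "AE x in lborel. norm (trunc n g x) \<le> norm (indicat_real (ball 0 (real n)) x + (cmod (g x))\<^sup>2)"
    using * by (intro AE_I2) (simp add: trunc_def indicator_def)
qed measurable

lemma trunc_tendsto:
  assumes [measurable]: "g \<in> borel_measurable borel" and fin: "nsq g < \<infinity>"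
  shows "(\<lambda>n. nsq (\<lambda>x. trunc n g x - g x)) \<longlonglongrightarrow> 0"
proof -
  have "(\<lambda>n. nsq (\<lambda>x. trunc n g x - g x)) \<longlonglongrightarrow> (\<integral>\<^sup>+x. 0 \<partial>(lborel :: R3 measure))"
    unfolding nsq_def
  proof (rule nn_integral_dominated_convergence[where w="\<lambda>x. ennreal ((cmod (g x))\<^sup>2)"])
    show "(\<integral>\<^sup>+ x. ennreal ((cmod (g x))\<^sup>2) \<partial>lborel) < \<infinity>" using fin by (simp add: nsq_def)
    show "AE x in lborel. ennreal ((cmod (trunc j g x - g x))\<^sup>2) \<le> ennreal ((cmod (g x))\<^sup>2)" for j
      by (intro AE_I2 ennreal_leI) (auto simp: trunc_def)
    show "AE x in lborel. (\<lambda>i. ennreal ((cmod (trunc i g x - g x))\<^sup>2)) \<longlonglongrightarrow> 0"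
    proof (rule AE_I2)
      fix x :: R3
      obtain N where N: "norm x < real N" using reals_Archimedean2 by blast
      have "eventually (\<lambda>i. N \<le> i) sequentially" by (rule eventually_ge_at_top)
      then have "eventually (\<lambda>i. ennreal ((cmod (trunc i g x - g x))\<^sup>2) = 0) sequentially"
      proof eventually_elim
        case (elim i)
        then have "norm x < real i" using N by simp
        then show ?case by (simp add: trunc_def)
      qed
      then show "(\<lambda>i. ennreal ((cmod (trunc i g x - g x))\<^sup>2)) \<longlonglongrightarrow> 0" by (rule tendsto_eventually)
    qed
  qed measurable
  then show ?thesis by simp
qed

lemma fourier_integral_diff:
  assumes "integrable lborel f" "integrable lborel g"
  shows "fourier_integral \<sigma> (\<lambda>x. f x - g x) \<xi> = fourier_integral \<sigma> f \<xi> - fourier_integral \<sigma> g \<xi>"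
  unfolding fourier_integral_eq trig_integral_def
  using integrable_trig[OF assms(1), of \<sigma> \<xi>] integrable_trig[OF assms(2), of \<sigma> \<xi>]
  by (simp add: algebra_simps)

lemma fourier_trunc_tendsto:
  assumes [measurable]: "g \<in> borel_measurable borel" and fin: "nsq g < \<infinity>" and \<sigma>: "\<bar>\<sigma>\<bar> = 1"
  shows "(\<lambda>n. nsq (fourier_integral \<sigma> (trunc n g))) \<longlonglongrightarrow> nsq g"
proof -
  have "nsq (fourier_integral \<sigma> (trunc n g)) = nsq (trunc n g)" for n
    using le_less_trans[OF nsq_trunc_le fin] by (intro plancherel_integrable integrable_trunc fin \<sigma>) auto
  moreover have "(\<lambda>n. nsq (trunc n g)) \<longlonglongrightarrow> nsq g"
    by (intro nsq_tendsto fin trunc_tendsto) auto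
  ultimately show ?thesis by simp
qed

text \<open>Truncations are integrable as well as square-integrable, so
  \<open>plancherel_integrable\<close> makes their transforms a Cauchy sequence, and
  \<open>nsq_complete\<close> gives the limit.\<close>

lemma is_fourier_L2_exists:
  assumes g: "g \<in> L2" and \<sigma>: "\<bar>\<sigma>\<bar> = 1"
  shows "\<exists>h. is_fourier_L2 \<sigma> g h"
proof -
  have gm[measurable]: "g \<in> borel_measurable borel" and fin: "nsq g < \<infinity>" using g by (auto simp: L2_iff_nsq)
  let ?F = "\<lambda>n. fourier_integral \<sigma> (trunc n g)"
  have i: "integrable lborel (trunc n g)" for n by (rule integrable_trunc[OF gm fin])
  have cauchy: "\<exists>N. \<forall>m\<ge>N. \<forall>n\<ge>N. nsq (\<lambda>x. ?F m x - ?F n x) \<le> ennreal e" if e: "0 < e" for e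
  proof -
    have "eventually (\<lambda>n. nsq (\<lambda>x. trunc n g x - g x) < ennreal (e / 4)) sequentially"
      using order_tendstoD(2)[OF trunc_tendsto[OF gm fin], of "ennreal (e / 4)"] e by simp
    then obtain N where N: "\<And>n. N \<le> n \<Longrightarrow> nsq (\<lambda>x. trunc n g x - g x) < ennreal (e / 4)"
      by (auto simp: eventually_sequentially)
    have "nsq (\<lambda>x. ?F m x - ?F n x) \<le> ennreal e" if "N \<le> m" "N \<le> n" for m n
    proof -
      have le: "nsq (\<lambda>x. trunc m g x - trunc n g x) \<le> ennreal e"
      proof -
        have "nsq (\<lambda>x. trunc m g x - trunc n g x) \<le> 2 * nsq (\<lambda>x. trunc m g x - g x)
          + 2 * nsq (\<lambda>x. g x - trunc n g x)"
          by (intro nsq_diff_le) auto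
        also have "\<dots> \<le> 2 * ennreal (e / 4) + 2 * ennreal (e / 4)"
          using N[OF that(1)] N[OF that(2)]
            by (intro add_mono mult_left_mono) (auto simp: nsq_minus_commute[of g])
        also have "\<dots> = ennreal e"
        proof -
          have "2 * ennreal (e / 4) = ennreal (2 * (e / 4))" using ennreal_mult[of 2 "e / 4"] e by simp
          then show ?thesis using e by (simp flip: ennreal_plus)
        qed
        finally show ?thesis .
      qed
      have "nsq (\<lambda>x. ?F m x - ?F n x) = nsq (fourier_integral \<sigma> (\<lambda>x. trunc m g x - trunc n g x))"
        using fourier_integral_diff[OF i i] by (simp add: nsq_def)
      also have "\<dots> = nsq (\<lambda>x. trunc m g x - trunc n g x)"
        using i le by (intro plancherel_integrable \<sigma>) (auto elim!: le_less_trans)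
      finally show ?thesis using le by simp
    qed
    then show ?thesis by blast
  qed
  obtain H where H[measurable]: "H \<in> borel_measurable borel" and lim: "(\<lambda>n. nsq (\<lambda>x. ?F n x - H x)) \<longlonglongrightarrow> 0"
    using nsq_complete[of ?F, OF _ cauchy] by (auto)
  have "eventually (\<lambda>n. nsq (\<lambda>x. ?F n x - H x) < 1) sequentially"
    using order_tendstoD(2)[OF lim, of 1] by simp
  then obtain n where n: "nsq (\<lambda>x. ?F n x - H x) < 1" by (auto simp: eventually_sequentially)
  have "nsq H \<le> nsq (?F n) + (ennreal (1 + 1 / 1) * nsq (\<lambda>x. H x - ?F n x) + ennreal 1 * nsq (?F n))"
    by (rule nsq_perturb) auto
  also have "nsq (?F n) = nsq (trunc n g)"
    using le_less_trans[OF nsq_trunc_le fin] by (intro plancherel_integrable i \<sigma>)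
  also have "nsq (trunc n g) + (ennreal (1 + 1 / 1) * nsq (\<lambda>x. H x - ?F n x)
    + ennreal 1 * nsq (trunc n g)) < \<infinity>"
    using n le_less_trans[OF nsq_trunc_le fin, of n] nsq_minus_commute[of H "?F n"]
    by (auto simp: ennreal_mult_less_top intro: less_trans)
  finally have "H \<in> L2" by (simp add: L2_iff_nsq)
  then show ?thesis
    using lim by (auto simp: is_fourier_L2_iff nsq_minus_commute[of H])
qed

text \<open>Stated for every \<open>h\<close> that satisfies the specification, so the choice made
  by SOME in \<open>fourier_L2\<close> and \<open>inv_fourier_L2\<close> does not matter.\<close>

lemma is_fourier_L2_isometry:
  assumes h: "is_fourier_L2 \<sigma> g h" and g: "g \<in> L2" and \<sigma>: "\<bar>\<sigma>\<bar> = 1"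
  shows "nsq h = nsq g"
proof -
  have gm[measurable]: "g \<in> borel_measurable borel" and fin: "nsq g < \<infinity>" using g by (auto simp: L2_iff_nsq)
  have hm[measurable]: "h \<in> borel_measurable borel" and hfin: "nsq h < \<infinity>" using h
    by (auto simp: L2_iff_nsq is_fourier_L2_iff)
  have "(\<lambda>n. nsq (fourier_integral \<sigma> (trunc n g))) \<longlonglongrightarrow> nsq h"
    using h by (intro nsq_tendsto hfin) (auto simp: is_fourier_L2_iff nsq_minus_commute[of _ h])
  then show ?thesis using fourier_trunc_tendsto[OF gm fin \<sigma>] by (rule LIMSEQ_unique)
qed

lemma is_fourier_fourier_L2: "g \<in> L2 \<Longrightarrow> is_fourier_L2 (- 1) g (fourier_L2 g)"
  unfolding fourier_L2_def by (rule someI_ex[OF is_fourier_L2_exists]) simp_all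

lemma is_fourier_inv_fourier_L2: "g \<in> L2 \<Longrightarrow> is_fourier_L2 1 g (inv_fourier_L2 g)"
  unfolding inv_fourier_L2_def by (rule someI_ex[OF is_fourier_L2_exists]) simp_all

lemma fourier_integral_translate_diff:
  assumes "integrable lborel g"
  shows "fourier_integral (- 1) (\<lambda>x. g (x + h) - g x) \<xi> = (cis (\<xi> \<bullet> h) - 1) * fourier_integral (- 1) g \<xi>"
proof -
  have [measurable]: "g \<in> borel_measurable borel" using assms by auto
  have "(\<lambda>a::R3. cis (- 1 * (\<xi> \<bullet> a))) \<in> borel_measurable borel"
    by (rule measurable_cis_inner') auto
  then have [measurable]: "(\<lambda>a::R3. cis (- (\<xi> \<bullet> a))) \<in> borel_measurable borel" by simp
  have gh: "integrable lborel (\<lambda>x. g (x + h))" using integrable_translate[of g h] assms by simp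
  have "trig_integral (- 1) (\<lambda>x. g (x + h)) \<xi>
    = (LINT x|lborel. (\<lambda>y. cis (\<xi> \<bullet> h) * (cis (- 1 * (\<xi> \<bullet> y)) * g y)) (x + h))"
    unfolding trig_integral_def
    by (intro Bochner_Integration.integral_cong) (auto simp: inner_add_right cis_mult mult.assoc[symmetric])
  also have "\<dots> = cis (\<xi> \<bullet> h) * trig_integral (- 1) g \<xi>"
    by (subst integral_translate) (simp_all add: trig_integral_def)
  finally show ?thesis
    unfolding fourier_integral_diff[OF gh assms] fourier_integral_eq by (simp add: algebra_simps)
qed

lemma cmod_cis_diff_le: "cmod (cis a - 1) \<le> 2"
  using norm_triangle_ineq4[of "cis a" 1] by simp

text \<open>For truncations this is the plain identity that translation becomes multiplication by a
  phase. Both sides pass to the limit, since multiplying by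
  \<open>cis (\<xi> \<bullet> h) - 1\<close> and taking a difference of translates each cost at most
  a factor 4 in \<open>nsq\<close>.\<close>

lemma plancherel_translate_diff:
  assumes g: "g \<in> L2"
  shows "nsq (\<lambda>\<xi>. (cis (\<xi> \<bullet> h) - 1) * fourier_L2 g \<xi>) = nsq (\<lambda>x. g (x + h) - g x)"
proof -
  have gm[measurable]: "g \<in> borel_measurable borel" and fin: "nsq g < \<infinity>" using g by (auto simp: L2_iff_nsq)
  let ?G = "fourier_L2 g"
  have four: "is_fourier_L2 (- 1) g ?G" by (rule is_fourier_fourier_L2[OF g])
  have Gm[measurable]: "?G \<in> borel_measurable borel" and Gfin: "nsq ?G < \<infinity>"
    using four by (auto simp: L2_iff_nsq is_fourier_L2_iff)
  have "(\<lambda>\<xi>::R3. cis (1 * (\<xi> \<bullet> h))) \<in> borel_measurable borel"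
    by (rule measurable_cis_inner') auto
  then have [measurable]: "(\<lambda>\<xi>::R3. cis (\<xi> \<bullet> h)) \<in> borel_measurable borel" by simp
  have mult: "nsq (\<lambda>\<xi>. (cis (\<xi> \<bullet> h) - 1) * k \<xi>)
    \<le> 4 * nsq k" if [measurable]: "k \<in> borel_measurable borel" for k
  proof -
    have "nsq (\<lambda>\<xi>. (cis (\<xi> \<bullet> h) - 1) * k \<xi>) \<le> (\<integral>\<^sup>+\<xi>. 4 * ennreal ((cmod (k \<xi>))\<^sup>2) \<partial>lborel)"
      unfolding nsq_def
    proof (rule nn_integral_mono)
      fix \<xi>
      have "(cmod (cis (\<xi> \<bullet> h) - 1))\<^sup>2 \<le> 2\<^sup>2" by (intro power_mono cmod_cis_diff_le) auto
      then have "(cmod ((cis (\<xi> \<bullet> h) - 1) * k \<xi>))\<^sup>2 \<le> 4 * (cmod (k \<xi>))\<^sup>2"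
        by (simp add: norm_mult power_mult_distrib mult_right_mono)
      then have "ennreal ((cmod ((cis (\<xi> \<bullet> h) - 1) * k \<xi>))\<^sup>2) \<le> ennreal (4 * (cmod (k \<xi>))\<^sup>2)"
        by (rule ennreal_leI)
      then show "ennreal ((cmod ((cis (\<xi> \<bullet> h) - 1) * k \<xi>))\<^sup>2) \<le> 4 * ennreal ((cmod (k \<xi>))\<^sup>2)"
        by (simp add: ennreal_mult)
    qed
    also have "\<dots> = 4 * nsq k" by (simp add: nsq_def nn_integral_cmult)
    finally show ?thesis .
  qed
  let ?Gn = "\<lambda>n. fourier_integral (- 1) (trunc n g)"
  let ?Tn = "\<lambda>n x. trunc n g (x + h) - trunc n g x"
  let ?T = "\<lambda>x. g (x + h) - g x"
  have "(\<lambda>n. nsq (\<lambda>\<xi>. (cis (\<xi> \<bullet> h) - 1) * ?Gn n \<xi> - (cis (\<xi> \<bullet> h) - 1) * ?G \<xi>)) \<longlonglongrightarrow> 0"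
  proof (rule tendsto_sandwich[OF _ _ tendsto_const])
    have "(\<lambda>n. nsq (\<lambda>\<xi>. ?Gn n \<xi> - ?G \<xi>)) \<longlonglongrightarrow> 0"
      using four by (simp add: is_fourier_L2_iff nsq_minus_commute[of _ ?G])
    then show "(\<lambda>n. 4 * nsq (\<lambda>\<xi>. ?Gn n \<xi> - ?G \<xi>)) \<longlonglongrightarrow> 0"
      using ennreal_tendsto_cmult[of 4 _ 0 sequentially] by fastforce
    show "eventually (\<lambda>n. nsq (\<lambda>\<xi>. (cis (\<xi> \<bullet> h) - 1) * ?Gn n \<xi> - (cis (\<xi> \<bullet> h) - 1) * ?G \<xi>)
      \<le> 4 * nsq (\<lambda>\<xi>. ?Gn n \<xi> - ?G \<xi>)) sequentially"
      using mult[of "\<lambda>\<xi>. ?Gn n \<xi> - ?G \<xi>" for n]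
        by (intro always_eventually allI) (simp add: right_diff_distrib)
  qed auto
  then have 1: "(\<lambda>n. nsq (\<lambda>\<xi>. (cis (\<xi> \<bullet> h) - 1) * ?Gn n \<xi>)) \<longlonglongrightarrow> nsq (\<lambda>\<xi>. (cis (\<xi> \<bullet> h) - 1) * ?G \<xi>)"
    using mult[OF Gm] Gfin by (intro nsq_tendsto) (auto simp: ennreal_mult_less_top elim!: le_less_trans)
  have Tfin: "nsq ?T < \<infinity>"
    using nsq_translate_diff_le[OF gm, of h] fin by (auto simp: ennreal_mult_less_top elim!: le_less_trans)
  have "(\<lambda>n. nsq (\<lambda>x. ?Tn n x - ?T x)) \<longlonglongrightarrow> 0"
  proof (rule tendsto_sandwich[OF _ _ tendsto_const])
    show "(\<lambda>n. 4 * nsq (\<lambda>x. trunc n g x - g x)) \<longlonglongrightarrow> 0"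
      using ennreal_tendsto_cmult[OF _ trunc_tendsto[OF gm fin], of 4] by simp
    show "eventually (\<lambda>n. nsq (\<lambda>x. ?Tn n x - ?T x) \<le> 4 * nsq (\<lambda>x. trunc n g x - g x)) sequentially"
      using nsq_translate_diff_le[of "\<lambda>x. trunc n g x - g x" h for n]
      by (intro always_eventually allI) (simp add: algebra_simps)
  qed auto
  then have 2: "(\<lambda>n. nsq (?Tn n)) \<longlonglongrightarrow> nsq ?T"
    by (intro nsq_tendsto Tfin) auto
  have "nsq (?Tn n) = nsq (\<lambda>\<xi>. (cis (\<xi> \<bullet> h) - 1) * ?Gn n \<xi>)" for n
  proof -
    have i: "integrable lborel (trunc n g)" by (rule integrable_trunc[OF gm fin])
    then have "integrable lborel (?Tn n)"
      using integrable_translate[of "trunc n g" h] by (intro Bochner_Integration.integrable_diff) auto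
    moreover have "nsq (?Tn n) < \<infinity>"
      using nsq_translate_diff_le[of "trunc n g" h] le_less_trans[OF nsq_trunc_le fin, of n]
      by (auto simp: ennreal_mult_less_top elim!: le_less_trans)
    ultimately have "nsq (fourier_integral (- 1) (?Tn n)) = nsq (?Tn n)" by (rule plancherel_integrable) simp
    then show ?thesis by (simp add: fourier_integral_translate_diff[OF i, abs_def])
  qed
  with 1 2 show ?thesis by (simp add: LIMSEQ_unique)
qed

section \<open>The Gagliardo seminorm\<close>

lemma measurable_const_indicator_ball:
  "(\<lambda>h::R3. (c::ennreal) * indicator (ball 0 r) h) \<in> borel_measurable lborel"
  by (intro borel_measurable_times_ennreal borel_measurable_const borel_measurable_indicator) auto

lemma ennreal_le_suminf: "f k \<le> (\<Sum>k. f k :: ennreal)"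
  using sum_le_suminf[of f "{k}"] by simp

text \<open>Dyadic shells: if \<open>k\<close> is the integer part of
  \<open>- log 2 (norm h)\<close>, the integrand is at most \<open>2 powr ((k + 1) * a)\<close>.
  Replacing each shell by a ball of radius \<open>2 * 2 powr (- k)\<close> only costs a constant and
  leaves a geometric series with ratio \<open>2 powr (a - 3)\<close>.\<close>

lemma nn_integral_norm_powr_ball:
  fixes a :: real
  assumes a: "0 \<le> a" "a < 3"
  shows "(\<integral>\<^sup>+h. ennreal (norm h powr (- a)) * indicator (ball 0 1) h \<partial>(lborel :: R3 measure)) < \<infinity>"
proof -
  let ?V = "unit_ball_vol (real DIM(R3))"
  let ?r = "\<lambda>k::nat. 2 * 2 powr (- real k)"
  have "(\<integral>\<^sup>+h. ennreal (norm h powr (- a)) * indicator (ball 0 1) h \<partial>(lborel :: R3 measure))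
    \<le> (\<integral>\<^sup>+h. (\<Sum>k. ennreal (2 powr ((real k + 1) * a)) * indicator (ball 0 (?r k)) h) \<partial>(lborel :: R3 measure))"
  proof (rule nn_integral_mono)
    fix h :: R3
    show "ennreal (norm h powr (- a)) * indicator (ball 0 1) h
      \<le> (\<Sum>k. ennreal (2 powr ((real k + 1) * a)) * indicator (ball 0 (?r k)) h)"
    proof (cases "h \<noteq> 0 \<and> norm h < 1")
      case True
      define L where "L = - log 2 (norm h)"
      define k where "k = nat \<lfloor>L\<rfloor>"
      have L: "0 \<le> L" using True unfolding L_def by (simp add: less_imp_le)
      have k: "real k \<le> L" "L < real k + 1" using L unfolding k_def by linarith+
      have h: "norm h = 2 powr (- L)" using True by (simp add: L_def)
      have "norm h powr (- a) = 2 powr (L * a)" unfolding h by (simp add: powr_powr)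
      also have "\<dots> \<le> 2 powr ((real k + 1) * a)" using k a by (intro powr_mono mult_right_mono) auto
      finally have 1: "norm h powr (- a) \<le> 2 powr ((real k + 1) * a)" .
      have "norm h \<le> 2 powr (- real k)" unfolding h using k by (intro powr_mono) auto
      moreover have "0 < 2 powr (- real k)" by simp
      ultimately have "norm h < ?r k" by linarith
      then have "ennreal (norm h powr (- a)) * indicator (ball 0 1) h
        \<le> ennreal (2 powr ((real k + 1) * a)) * indicator (ball 0 (?r k)) h"
        using True 1 by (simp add: ennreal_leI)
      also have "\<dots> \<le> (\<Sum>k. ennreal (2 powr ((real k + 1) * a)) * indicator (ball 0 (?r k)) h)"
        by (rule ennreal_le_suminf[of "\<lambda>k. ennreal (2 powr ((real k + 1) * a))
          * indicator (ball 0 (?r k)) h" k])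
      finally show ?thesis .
    qed auto
  qed
  also have "\<dots> = (\<Sum>k. ennreal (2 powr ((real k + 1) * a)) * emeasure lborel (ball (0::R3) (?r k)))"
    by (subst nn_integral_suminf[OF measurable_const_indicator_ball]) (simp add: nn_integral_cmult_indicator)
  also have "\<dots> = (\<Sum>k. ennreal ((2 powr a * ?V * 8) * (2 powr (a - 3)) ^ k))"
  proof (rule suminf_cong)
    fix k
    have "(?r k) ^ 3 = 8 * 2 powr (- 3 * real k)"
      by (simp add: power_mult_distrib powr_power)
    moreover have "2 powr ((real k + 1) * a) = 2 powr a * 2 powr (real k * a)"
      by (simp add: powr_add algebra_simps)
    moreover have "(2 powr (a - 3)) ^ k = 2 powr (real k * a) * 2 powr (- 3 * real k)"
      by (simp add: powr_power powr_add[symmetric] algebra_simps)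
    ultimately show "ennreal (2 powr ((real k + 1) * a)) * emeasure lborel (ball (0::R3) (?r k))
      = ennreal ((2 powr a * ?V * 8) * (2 powr (a - 3)) ^ k)"
      by (subst emeasure_ball) (simp_all add: ennreal_mult[symmetric] mult_ac)
  qed
  also have "\<dots> = ennreal (\<Sum>k. (2 powr a * ?V * 8) * (2 powr (a - 3)) ^ k)"
  proof (rule suminf_ennreal2)
    have "2 powr (a - 3) < (2::real) powr 0" using a by (intro powr_less_mono) auto
    then show "summable (\<lambda>k. (2 powr a * ?V * 8) * (2 powr (a - 3)) ^ k)"
      by (intro summable_mult summable_geometric) simp
  qed simp
  also have "\<dots> < \<infinity>" by simp
  finally show ?thesis .
qed

text \<open>The same dyadic argument with growing shells; the ratio is now
  \<open>2 powr (3 - a)\<close>.\<close>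

lemma nn_integral_norm_powr_outside:
  fixes a :: real
  assumes a: "3 < a"
  shows "(\<integral>\<^sup>+h. ennreal (norm h powr (- a)) * indicator (- ball 0 1) h \<partial>(lborel :: R3 measure)) < \<infinity>"
proof -
  let ?V = "unit_ball_vol (real DIM(R3))"
  let ?r = "\<lambda>k::nat. 2 * 2 powr (real k)"
  have "(\<integral>\<^sup>+h. ennreal (norm h powr (- a)) * indicator (- ball 0 1) h \<partial>(lborel :: R3 measure))
    \<le> (\<integral>\<^sup>+h. (\<Sum>k. ennreal (2 powr (- real k * a)) * indicator (ball 0 (?r k)) h) \<partial>(lborel :: R3 measure))"
  proof (rule nn_integral_mono)
    fix h :: R3
    show "ennreal (norm h powr (- a)) * indicator (- ball 0 1) h
      \<le> (\<Sum>k. ennreal (2 powr (- real k * a)) * indicator (ball 0 (?r k)) h)"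
    proof (cases "1 \<le> norm h")
      case True
      define L where "L = log 2 (norm h)"
      define k where "k = nat \<lfloor>L\<rfloor>"
      have "0 < norm h" using True by linarith
      then have L: "0 \<le> L" using True unfolding L_def by simp
      have k: "real k \<le> L" "L < real k + 1" using L unfolding k_def by linarith+
      have h: "norm h = 2 powr L" using True by (subst L_def, subst powr_log_cancel) auto
      have "norm h powr (- a) = 2 powr (- L * a)" unfolding h by (simp add: powr_powr)
      also have "\<dots> \<le> 2 powr (- real k * a)" using k a by (intro powr_mono mult_right_mono) auto
      finally have 1: "norm h powr (- a) \<le> 2 powr (- real k * a)" .
      have "norm h < 2 powr (real k + 1)" unfolding h using k by (intro powr_less_mono) auto
      then have "norm h < ?r k" by (simp add: powr_add)
      then have "ennreal (norm h powr (- a)) * indicator (- ball 0 1) h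
        \<le> ennreal (2 powr (- real k * a)) * indicator (ball 0 (?r k)) h"
        using True 1 by (simp add: ennreal_leI)
      also have "\<dots> \<le> (\<Sum>k. ennreal (2 powr (- real k * a)) * indicator (ball 0 (?r k)) h)"
        by (rule ennreal_le_suminf[of "\<lambda>k. ennreal (2 powr (- real k * a)) * indicator (ball 0 (?r k)) h" k])
      finally show ?thesis .
    qed auto
  qed
  also have "\<dots> = (\<Sum>k. ennreal (2 powr (- real k * a)) * emeasure lborel (ball (0::R3) (?r k)))"
    by (subst nn_integral_suminf[OF measurable_const_indicator_ball]) (simp add: nn_integral_cmult_indicator)
  also have "\<dots> = (\<Sum>k. ennreal ((?V * 8) * (2 powr (3 - a)) ^ k))"
  proof (rule suminf_cong)
    fix k
    have "(?r k) ^ 3 = 8 * 2 powr (3 * real k)"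
      by (simp add: power_mult_distrib powr_power)
    moreover have "(2 powr (3 - a)) ^ k = 2 powr (- real k * a) * 2 powr (3 * real k)"
      by (simp add: powr_power powr_add[symmetric] algebra_simps)
    ultimately show "ennreal (2 powr (- real k * a)) * emeasure lborel (ball (0::R3) (?r k))
      = ennreal ((?V * 8) * (2 powr (3 - a)) ^ k)"
      by (subst emeasure_ball) (simp_all add: ennreal_mult[symmetric] mult_ac)
  qed
  also have "\<dots> = ennreal (\<Sum>k. (?V * 8) * (2 powr (3 - a)) ^ k)"
  proof (rule suminf_ennreal2)
    have "2 powr (3 - a) < (2::real) powr 0" using a by (intro powr_less_mono) auto
    then show "summable (\<lambda>k. (?V * 8) * (2 powr (3 - a)) ^ k)"
      by (intro summable_mult summable_geometric) simp
  qed simp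
  also have "\<dots> < \<infinity>" by simp
  finally show ?thesis .
qed

lemma nn_integral_orthogonal:
  fixes T :: "R3 \<Rightarrow> R3"
  assumes T: "orthogonal_transformation T" and [measurable]: "f \<in> borel_measurable borel"
  shows "(\<integral>\<^sup>+x. f (T x) \<partial>lborel) = (\<integral>\<^sup>+x. f x \<partial>lborel)"
proof -
  have "continuous_on UNIV T"
    using T by (intro linear_continuous_on) (simp add: orthogonal_transformation_linear
      linear_conv_bounded_linear[symmetric])
  then have Tm[measurable]: "T \<in> borel_measurable borel" by (rule borel_measurable_continuous_onI)
  have inv: "orthogonal_transformation (inv T)" by (rule orthogonal_transformation_inv[OF T])
  have bij: "bij T" by (rule orthogonal_transformation_bij[OF T])
  have "lborel = distr lborel borel T"
  proof (rule lborel_eqI)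
    fix l u :: R3 assume le: "\<And>b. b \<in> Basis \<Longrightarrow> l \<bullet> b \<le> u \<bullet> b"
    have vim: "T -` box l u = inv T ` box l u" using bij by (simp add: bij_vimage_eq_inv_image)
    have V: "T -` box l u \<in> sets borel" using measurable_sets[OF Tm, of "box l u"] by simp
    have "emeasure (distr lborel borel T) (box l u) = emeasure lborel (T -` box l u)"
      by (subst emeasure_distr) auto
    also have "\<dots> = emeasure lebesgue (inv T ` box l u)" using V vim by simp
    also have "\<dots> = ennreal (measure lebesgue (inv T ` box l u))"
      by (intro emeasure_eq_measure2 fmeasurableD2 measurable_orthogonal_image[OF inv]) auto
    also have "\<dots> = ennreal (measure lebesgue (box l u))"
      by (subst measure_orthogonal_image[OF inv]) auto
    also have "\<dots> = (\<Prod>b\<in>Basis. (u - l) \<bullet> b)"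
      using le by (simp add: measure_lborel_box)
    finally show "emeasure (distr lborel borel T) (box l u) = (\<Prod>b\<in>Basis. (u - l) \<bullet> b)" .
  qed simp
  then have "(\<integral>\<^sup>+x. f x \<partial>lborel) = (\<integral>\<^sup>+x. f x \<partial>distr lborel borel T)" by simp
  also have "\<dots> = (\<integral>\<^sup>+x. f (T x) \<partial>lborel)" by (simp add: nn_integral_distr)
  finally show ?thesis ..
qed

text \<open>The Fourier multiplier of the Gagliardo form, in Levy-Khintchine form.\<close>

definition levy_symbol :: "real \<Rightarrow> R3 \<Rightarrow> ennreal" where
  "levy_symbol s \<xi> = (\<integral>\<^sup>+h. ennreal ((cmod (cis (\<xi> \<bullet> h) - 1))\<^sup>2 / norm h powr (3 + 2 * s)) \<partial>lborel)"

lemma measurable_cis_inner2[measurable (raw)]: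
  assumes [measurable]: "f \<in> M \<rightarrow>\<^sub>M borel" "g \<in> M \<rightarrow>\<^sub>M (borel :: 'a::euclidean_space measure)"
  shows "(\<lambda>x. cis (f x \<bullet> g x)) \<in> borel_measurable M"
  using measurable_cis_inner'[OF assms, of 1] by simp

lemma cmod_cis_diff_le_abs: "cmod (cis a - 1) \<le> \<bar>a\<bar>"
  using iexp_approx1[of a 0] by (simp add: cis_conv_exp)

text \<open>Near 0 the numerator is at most \<open>(norm \<xi> * norm h)^2\<close>, leaving the
  exponent \<open>1 + 2 * s < 3\<close>; outside the unit ball it is at most 4, leaving
  \<open>3 + 2 * s > 3\<close>.\<close>

lemma levy_symbol_finite:
  assumes s: "0 < s" "s < 1"
  shows "levy_symbol s \<xi> < \<infinity>"
proof -
  let ?I = "\<lambda>h::R3. ennreal ((norm \<xi>)\<^sup>2) * (ennreal (norm h powr (- (1 + 2 * s))) * indicator (ball 0 1) h)"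
  let ?O = "\<lambda>h::R3. 4 * (ennreal (norm h powr (- (3 + 2 * s))) * indicator (- ball 0 1) h)"
  have "levy_symbol s \<xi> \<le> (\<integral>\<^sup>+h. ?I h + ?O h \<partial>lborel)"
    unfolding levy_symbol_def
  proof (rule nn_integral_mono)
    fix h :: R3
    let ?m = "(cmod (cis (\<xi> \<bullet> h) - 1))\<^sup>2"
    show "ennreal (?m / norm h powr (3 + 2 * s)) \<le> ?I h + ?O h"
    proof (cases "norm h < 1")
      case True
      show ?thesis
      proof (cases "h = 0")
        case False
        have "cmod (cis (\<xi> \<bullet> h) - 1) \<le> norm \<xi> * norm h"
          using cmod_cis_diff_le_abs[of "\<xi> \<bullet> h"] Cauchy_Schwarz_ineq2[of \<xi> h] by linarith
        then have "?m \<le> (norm \<xi> * norm h)\<^sup>2" by (intro power_mono) auto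
        then have "?m / norm h powr (3 + 2 * s) \<le> (norm \<xi> * norm h)\<^sup>2 / norm h powr (3 + 2 * s)"
          by (intro divide_right_mono) auto
        also have "\<dots> = (norm \<xi>)\<^sup>2 * norm h powr (- (1 + 2 * s))"
        proof -
          have "(norm h)\<^sup>2 = norm h powr 2" using False by simp
          then have "(norm h)\<^sup>2 / norm h powr (3 + 2 * s) = norm h powr 2 / norm h powr (3 + 2 * s)"
            by (simp only:)
          also have "\<dots> = norm h powr (2 - (3 + 2 * s))" by (rule powr_diff[symmetric])
          also have "2 - (3 + 2 * s) = - (1 + 2 * s)" by simp
          finally have "(norm h)\<^sup>2 / norm h powr (3 + 2 * s) = norm h powr (- (1 + 2 * s))" .
          then show ?thesis by (simp add: power_mult_distrib flip: times_divide_eq_right)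
        qed
        finally have "ennreal (?m / norm h powr (3 + 2 * s))
          \<le> ennreal ((norm \<xi>)\<^sup>2 * norm h powr (- (1 + 2 * s)))"
          by (rule ennreal_leI)
        then show ?thesis using True by (simp add: ennreal_mult)
      qed simp
    next
      case False
      have "?m \<le> 2\<^sup>2" by (intro power_mono cmod_cis_diff_le) auto
      then have "?m / norm h powr (3 + 2 * s) \<le> 4 * norm h powr (- (3 + 2 * s))"
        unfolding powr_minus_divide using divide_right_mono[of ?m 4 "norm h powr (3 + 2 * s)"] by simp
      then have "ennreal (?m / norm h powr (3 + 2 * s)) \<le> ennreal (4 * norm h powr (- (3 + 2 * s)))"
        by (rule ennreal_leI)
      then show ?thesis using False by (simp add: ennreal_mult)
    qed
  qed
  also have "\<dots> = ennreal ((norm \<xi>)\<^sup>2)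
    * (\<integral>\<^sup>+h. ennreal (norm h powr (- (1 + 2 * s))) * indicator (ball 0 1) h \<partial>(lborel :: R3 measure))
     + 4 * (\<integral>\<^sup>+h. ennreal (norm h powr (- (3 + 2 * s))) * indicator (- ball 0 1) h \<partial>(lborel :: R3 measure))"
  proof -
    have [measurable]: "(\<lambda>h::R3. ennreal (norm h powr a) * indicator (ball 0 1) h) \<in> borel_measurable borel"
      "(\<lambda>h::R3. ennreal (norm h powr a) * indicator (- ball 0 1) h) \<in> borel_measurable borel" for a
      by (rule borel_measurable_times_ennreal, simp, rule borel_measurable_indicator, simp)+
    show ?thesis by (subst nn_integral_add) (simp_all add: nn_integral_cmult)
  qed
  also have "\<dots> < \<infinity>"
    using nn_integral_norm_powr_ball[of "1 + 2 * s"] nn_integral_norm_powr_outside[of "3 + 2 * s"] s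
    by (simp only: ennreal_add_less_top ennreal_mult_less_top infinity_ennreal_def) auto
  finally show ?thesis .
qed

lemma levy_symbol_pos:
  assumes "\<xi> \<noteq> 0"
  shows "0 < levy_symbol s \<xi>"
proof (rule ccontr)
  assume "\<not> ?thesis"
  then have "levy_symbol s \<xi> = 0" by simp
  then have AE: "AE h in lborel. (cmod (cis (\<xi> \<bullet> h) - 1))\<^sup>2 / norm h powr (3 + 2 * s) \<le> 0"
    unfolding levy_symbol_def by (subst (asm) nn_integral_0_iff_AE) (auto simp: ennreal_eq_0_iff)
  \<comment> \<open>The centre satisfies \<open>\<xi> \<bullet> ?z = 1\<close>, and the radius
    \<open>1 / norm \<xi>\<close> keeps \<open>\<xi> \<bullet> h\<close> between 0 and 2, hence
    below pi: the sine is positive and the phase differs from 1.\<close>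
  let ?z = "(1 / (norm \<xi>)\<^sup>2) *\<^sub>R \<xi>"
  let ?B = "ball ?z (1 / norm \<xi>)"
  have "AE h in lborel. h \<notin> ?B"
    using AE
  proof eventually_elim
    case (elim h)
    show ?case
    proof
      assume "h \<in> ?B"
      then have d: "norm (h - ?z) < 1 / norm \<xi>" by (simp add: dist_norm norm_minus_commute)
      have "\<bar>\<xi> \<bullet> (h - ?z)\<bar> \<le> norm \<xi> * norm (h - ?z)" by (rule Cauchy_Schwarz_ineq2)
      also have "\<dots> < norm \<xi> * (1 / norm \<xi>)" using assms d by (intro mult_strict_left_mono) auto
      finally have "\<bar>\<xi> \<bullet> (h - ?z)\<bar> < 1" using assms by simp
      moreover have "\<xi> \<bullet> ?z = 1" using assms by (simp add: power2_norm_eq_inner)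
      ultimately have x: "0 < \<xi> \<bullet> h" "\<xi> \<bullet> h < 2" by (auto simp: inner_diff_right)
      then have "0 < sin (\<xi> \<bullet> h)" using pi_gt3 by (intro sin_gt_zero) auto
      then have "cis (\<xi> \<bullet> h) \<noteq> 1" by (auto simp: complex_eq_iff)
      moreover have "h \<noteq> 0" using x by auto
      ultimately have "0 < (cmod (cis (\<xi> \<bullet> h) - 1))\<^sup>2 / norm h powr (3 + 2 * s)" by simp
      then show False using elim by simp
    qed
  qed
  then have "emeasure lborel ?B = 0" by (subst (asm) AE_iff_measurable[of ?B]) auto
  moreover have "emeasure lborel ?B \<noteq> 0" using assms
    by (subst emeasure_ball) (auto simp: ennreal_eq_0_iff unit_ball_vol_pos not_le intro!: mult_pos_pos)
  ultimately show False by simp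
qed

definition levy_const :: "real \<Rightarrow> ennreal" where
  "levy_const s = levy_symbol s (axis 1 1)"

text \<open>A rotation reduces to positive multiples of one fixed unit vector. Dilation by
  \<open>r\<close> takes \<open>r powr (3 + 2 * s)\<close> out of the kernel, of which the Jacobian
  \<open>r^3\<close> is used up by the change of variables.\<close>

lemma levy_symbol_eq: "levy_symbol s \<xi> = ennreal (norm \<xi> powr (2 * s)) * levy_const s"
proof (cases "\<xi> = 0")
  case False
  define r where "r = norm \<xi>"
  have r: "0 < r" using False by (simp add: r_def)
  let ?e = "axis 1 1 :: R3"
  obtain T where T: "orthogonal_transformation T" "T ?e = \<xi> /\<^sub>R r"
    using orthogonal_transformation_exists[of ?e "\<xi> /\<^sub>R r"] r by (auto simp: r_def norm_axis_1)
  let ?g = "\<lambda>h. (cmod (cis (?e \<bullet> h) - 1))\<^sup>2 / norm h powr (3 + 2 * s)"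
  have "levy_symbol s \<xi> = (\<integral>\<^sup>+k. ennreal ((cmod (cis (\<xi> \<bullet> T k) - 1))\<^sup>2 / norm (T k) powr (3
    + 2 * s)) \<partial>lborel)"
    unfolding levy_symbol_def by (rule nn_integral_orthogonal[OF T(1), symmetric]) measurable
  also have "\<dots> = (\<integral>\<^sup>+k. ennreal (r powr (3 + 2 * s)) * ennreal (?g (r *\<^sub>R k)) \<partial>lborel)"
  proof (rule nn_integral_cong)
    fix k
    have "\<xi> \<bullet> T k = r * (T ?e \<bullet> T k)" using T(2) r by simp
    also have "\<dots> = ?e \<bullet> (r *\<^sub>R k)" using T(1) by (simp add: orthogonal_transformation_def)
    finally have *: "\<xi> \<bullet> T k = ?e \<bullet> (r *\<^sub>R k)" .
    have n: "norm (T k) = norm k" using T(1) by (rule orthogonal_transformation_norm)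
    have eq: "(cmod (cis (\<xi> \<bullet> T k) - 1))\<^sup>2 / norm (T k) powr (3 + 2 * s) = r powr (3 + 2 * s) * ?g (r *\<^sub>R k)"
      unfolding * n using r by (simp add: powr_mult)
    show "ennreal ((cmod (cis (\<xi> \<bullet> T k) - 1))\<^sup>2 / norm (T k) powr (3 + 2 * s))
      = ennreal (r powr (3 + 2 * s)) * ennreal (?g (r *\<^sub>R k))"
      unfolding eq by (rule ennreal_mult) simp_all
  qed
  also have "\<dots> = ennreal (r powr (3 + 2 * s)) * (\<integral>\<^sup>+k. ennreal (?g (r *\<^sub>R k)) \<partial>lborel)"
    by (rule nn_integral_cmult) measurable
  also have "ennreal (r powr (3 + 2 * s)) = ennreal (r powr (2 * s)) * ennreal (\<bar>r\<bar> ^ DIM(R3))"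
    using r by (simp add: powr_add ennreal_mult[symmetric] mult.commute)
  also have "\<dots> * (\<integral>\<^sup>+k. ennreal (?g (r *\<^sub>R k)) \<partial>lborel)
    = ennreal (r powr (2 * s)) * (ennreal (\<bar>r\<bar> ^ DIM(R3)) * (\<integral>\<^sup>+k. ennreal (?g (r *\<^sub>R k)) \<partial>lborel))"
    by (simp add: mult.assoc)
  also have "ennreal (\<bar>r\<bar> ^ DIM(R3)) * (\<integral>\<^sup>+k. ennreal (?g (r *\<^sub>R k)) \<partial>lborel) = levy_const s"
    unfolding levy_const_def levy_symbol_def
      by (rule nn_integral_scaleR[symmetric]) (use r in \<open>auto intro: measurable_compose\<close>)
  finally show ?thesis by (simp add: r_def)
qed (simp add: levy_symbol_def)

text \<open>The squared Gagliardo seminorm, parametrised by the displacement \<open>h\<close>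
  instead of a second point: for fixed \<open>h\<close> the inner integral is the squared norm of a
  difference of translates, to which Plancherel applies.\<close>

definition gagliardo :: "real \<Rightarrow> (R3 \<Rightarrow> real) \<Rightarrow> ennreal" where
  "gagliardo s u =
     (\<integral>\<^sup>+h. (\<integral>\<^sup>+x. ennreal ((u (x + h) - u x)\<^sup>2 / norm h powr (3 + 2 * s)) \<partial>lborel) \<partial>lborel)"

lemma L2_of_real:
  assumes "u \<in> borel_measurable lborel" "integrable lborel (\<lambda>x. (u x)\<^sup>2)"
  shows "(\<lambda>x. complex_of_real (u x)) \<in> L2"
  using assms by (simp add: L2_def)

text \<open>Plancherel for each \<open>h\<close>, then Tonelli; the remaining integral over
  \<open>h\<close> is \<open>levy_symbol\<close>.\<close>

lemma gagliardo_fourier: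
  assumes um: "u \<in> borel_measurable lborel" and u2: "integrable lborel (\<lambda>x. (u x)\<^sup>2)"
  shows "gagliardo s u = levy_const s *
    (\<integral>\<^sup>+\<xi>. ennreal (norm \<xi> powr (2 * s) * (cmod (fourier_L2 (\<lambda>x. of_real (u x)) \<xi>))\<^sup>2) \<partial>lborel)"
proof -
  have [measurable]: "u \<in> borel_measurable borel" using um by simp
  let ?g = "\<lambda>x. complex_of_real (u x)"
  let ?G = "fourier_L2 ?g"
  have g: "?g \<in> L2" by (rule L2_of_real[OF um u2])
  have [measurable]: "?G \<in> borel_measurable borel"
    using is_fourier_fourier_L2[OF g] by (simp add: is_fourier_L2_iff L2_iff_nsq)
  let ?k = "\<lambda>h::R3. inverse (norm h powr (3 + 2 * s))"
  have "gagliardo s u = (\<integral>\<^sup>+h. (\<integral>\<^sup>+x. ennreal (?k h)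
    * ennreal ((cmod (?g (x + h) - ?g x))\<^sup>2) \<partial>lborel) \<partial>lborel)"
    unfolding gagliardo_def
    by (intro nn_integral_cong)
       (simp add: ennreal_mult[symmetric] divide_inverse mult.commute flip: of_real_diff)
  also have "\<dots> = (\<integral>\<^sup>+h. ennreal (?k h) * nsq (\<lambda>x. ?g (x + h) - ?g x) \<partial>lborel)"
    unfolding nsq_def by (intro nn_integral_cong nn_integral_cmult) measurable
  also have "\<dots> = (\<integral>\<^sup>+h. ennreal (?k h) * nsq (\<lambda>\<xi>. (cis (\<xi> \<bullet> h) - 1) * ?G \<xi>) \<partial>lborel)"
    by (simp add: plancherel_translate_diff[OF g])
  also have "\<dots> = (\<integral>\<^sup>+h. (\<integral>\<^sup>+\<xi>. ennreal (?k h)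
    * ennreal ((cmod ((cis (\<xi> \<bullet> h) - 1) * ?G \<xi>))\<^sup>2) \<partial>lborel) \<partial>lborel)"
    unfolding nsq_def by (intro nn_integral_cong nn_integral_cmult[symmetric]) measurable
  also have "\<dots> = (\<integral>\<^sup>+\<xi>. (\<integral>\<^sup>+h. ennreal (?k h)
    * ennreal ((cmod ((cis (\<xi> \<bullet> h) - 1) * ?G \<xi>))\<^sup>2) \<partial>lborel) \<partial>lborel)"
    by (rule lborel_pair.Fubini') measurable
  also have "\<dots> = (\<integral>\<^sup>+\<xi>. ennreal ((cmod (?G \<xi>))\<^sup>2) * levy_symbol s \<xi> \<partial>lborel)"
  proof (rule nn_integral_cong)
    fix \<xi>
    have "(\<integral>\<^sup>+h. ennreal (?k h) * ennreal ((cmod ((cis (\<xi> \<bullet> h) - 1) * ?G \<xi>))\<^sup>2) \<partial>lborel)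
      = (\<integral>\<^sup>+h. ennreal ((cmod (?G \<xi>))\<^sup>2)
        * ennreal ((cmod (cis (\<xi> \<bullet> h) - 1))\<^sup>2 / norm h powr (3 + 2 * s)) \<partial>lborel)"
      by (intro nn_integral_cong) (simp add: ennreal_mult[symmetric] norm_mult power_mult_distrib
        divide_inverse mult_ac)
    also have "\<dots> = ennreal ((cmod (?G \<xi>))\<^sup>2) * levy_symbol s \<xi>"
      unfolding levy_symbol_def by (rule nn_integral_cmult) measurable
    finally show "(\<integral>\<^sup>+h. ennreal (?k h) * ennreal ((cmod ((cis (\<xi> \<bullet> h) - 1) * ?G \<xi>))\<^sup>2) \<partial>lborel)
      = ennreal ((cmod (?G \<xi>))\<^sup>2) * levy_symbol s \<xi>" .
  qed
  also have "\<dots> = (\<integral>\<^sup>+\<xi>. levy_const s * ennreal (norm \<xi> powr (2 * s) * (cmod (?G \<xi>))\<^sup>2) \<partial>lborel)"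
    unfolding levy_symbol_eq by (intro nn_integral_cong) (simp add: ennreal_mult mult_ac)
  also have "\<dots> = levy_const s * (\<integral>\<^sup>+\<xi>. ennreal (norm \<xi> powr (2 * s) * (cmod (?G \<xi>))\<^sup>2) \<partial>lborel)"
    by (rule nn_integral_cmult) measurable
  finally show ?thesis .
qed

lemma levy_const_bounds: "0 < s \<Longrightarrow> s < 1 \<Longrightarrow> levy_const s < \<infinity>" "0 < levy_const s"
  unfolding levy_const_def by (rule levy_symbol_finite, assumption+) (rule levy_symbol_pos, simp add:
    axis_eq_0_iff)

text \<open>\<open>levy_const\<close> is positive and finite, so both finiteness conditions agree.
  This and \<open>kinetic_gagliardo\<close> are the passage from the Fourier definitions to
  differences of translates.\<close>

lemma Hs_iff:
  assumes s: "0 < s" "s < 1"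
  shows "u \<in> Hs s \<longleftrightarrow> u \<in> borel_measurable lborel \<and> integrable lborel (\<lambda>x. (u x)\<^sup>2) \<and> gagliardo s u < \<infinity>"
proof -
  have "integrable lborel (\<lambda>\<xi>. norm \<xi> powr (2 * s) * (cmod (fourier_L2 (\<lambda>x. of_real (u x)) \<xi>))\<^sup>2)
    \<longleftrightarrow> gagliardo s u < \<infinity>" if um: "u \<in> borel_measurable lborel" and u2: "integrable lborel (\<lambda>x. (u x)\<^sup>2)"
  proof -
    let ?G = "fourier_L2 (\<lambda>x. complex_of_real (u x))"
    have [measurable]: "?G \<in> borel_measurable borel"
      using is_fourier_fourier_L2[OF L2_of_real[OF um u2]] by (simp add: is_fourier_L2_iff L2_iff_nsq)
    have "integrable lborel (\<lambda>\<xi>. norm \<xi> powr (2 * s) * (cmod (?G \<xi>))\<^sup>2)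
      \<longleftrightarrow> (\<integral>\<^sup>+\<xi>. ennreal (norm \<xi> powr (2 * s) * (cmod (?G \<xi>))\<^sup>2) \<partial>lborel) < \<infinity>"
      unfolding integrable_iff_bounded by (simp add: norm_mult)
    then show ?thesis
      using levy_const_bounds[of s] s unfolding gagliardo_fourier[OF um u2]
      by (auto simp: ennreal_mult_less_top)
  qed
  then show ?thesis unfolding Hs_def by auto
qed

definition kinetic :: "real \<Rightarrow> (R3 \<Rightarrow> real) \<Rightarrow> real" where
  "kinetic s u = (LINT x|lborel. (cmod (frac_laplacian (s / 2) u x))\<^sup>2)"

text \<open>Membership in \<open>Hs\<close> says exactly that the multiplied transform
  \<open>?M\<close> is square-integrable, and the inverse transform preserves its norm.\<close>

lemma kinetic_gagliardo:
  assumes s: "0 < s" "s < 1" and u: "u \<in> Hs s"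
  shows "integrable lborel (\<lambda>x. (cmod (frac_laplacian (s / 2) u x))\<^sup>2)"
    and "kinetic s u = enn2real (gagliardo s u) / enn2real (levy_const s)"
proof -
  let ?g = "\<lambda>x. complex_of_real (u x)"
  let ?G = "fourier_L2 ?g"
  let ?M = "\<lambda>\<xi>. complex_of_real (norm \<xi> powr (2 * (s / 2))) * ?G \<xi>"
  have um: "u \<in> borel_measurable lborel" and u2: "integrable lborel (\<lambda>x. (u x)\<^sup>2)"
    and fin: "integrable lborel (\<lambda>\<xi>. norm \<xi> powr (2 * s) * (cmod (?G \<xi>))\<^sup>2)"
    using u by (auto simp: Hs_def)
  have [measurable]: "?G \<in> borel_measurable borel"
    using is_fourier_fourier_L2[OF L2_of_real[OF um u2]] by (simp add: is_fourier_L2_iff L2_iff_nsq)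
  have M2: "(cmod (?M \<xi>))\<^sup>2 = norm \<xi> powr (2 * s) * (cmod (?G \<xi>))\<^sup>2" for \<xi>
  proof -
    have "(norm \<xi> powr s)\<^sup>2 = norm \<xi> powr (2 * s)" by (simp add: power2_eq_square powr_add[symmetric])
    then show ?thesis by (simp add: norm_mult power_mult_distrib)
  qed
  have M: "?M \<in> L2" unfolding L2_def mem_Collect_eq M2 using fin by simp
  have four: "is_fourier_L2 1 ?M (frac_laplacian (s / 2) u)"
    unfolding frac_laplacian_def by (rule is_fourier_inv_fourier_L2[OF M])
  then have [measurable]: "frac_laplacian (s / 2) u \<in> borel_measurable borel"
    and L2: "frac_laplacian (s / 2) u \<in> L2" by (auto simp: is_fourier_L2_iff L2_iff_nsq)
  then show "integrable lborel (\<lambda>x. (cmod (frac_laplacian (s / 2) u x))\<^sup>2)" by (simp add: L2_def)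
  have "nsq (frac_laplacian (s / 2) u) = nsq ?M"
    by (rule is_fourier_L2_isometry[OF four M]) simp
  then have "kinetic s u = enn2real (nsq ?M)"
    unfolding kinetic_def using L2 by (subst integrable_L2_of_nsq(2)) (auto simp: L2_iff_nsq)
  also have "nsq ?M = (\<integral>\<^sup>+\<xi>. ennreal (norm \<xi> powr (2 * s) * (cmod (?G \<xi>))\<^sup>2) \<partial>lborel)"
    by (simp only: nsq_def M2)
  finally show "kinetic s u = enn2real (gagliardo s u) / enn2real (levy_const s)"
    using levy_const_bounds[of s] s unfolding gagliardo_fourier[OF um u2]
    by (simp add: enn2real_mult enn2real_eq_0_iff)
qed

section \<open>The seminorm under scaling, absolute values, translations and disjoint sums\<close>

lemma gagliardo_scale: 
  assumes [measurable]: "u \<in> borel_measurable lborel"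
  shows "gagliardo s (\<lambda>x. \<tau> * u x) = ennreal (\<tau>\<^sup>2) * gagliardo s u"
proof -
  have "gagliardo s (\<lambda>x. \<tau> * u x)
    = (\<integral>\<^sup>+h. (\<integral>\<^sup>+x. ennreal (\<tau>\<^sup>2) * ennreal ((u (x + h) - u x)\<^sup>2 / norm h powr (3 + 2 * s)) \<partial>lborel) \<partial>lborel)"
    unfolding gagliardo_def
    by (intro nn_integral_cong) (simp add: ennreal_mult[symmetric] power_mult_distrib flip:
      right_diff_distrib)
  then show ?thesis by (simp add: nn_integral_cmult gagliardo_def)
qed

lemma gagliardo_abs_le: "gagliardo s (\<lambda>x. \<bar>u x\<bar>) \<le> gagliardo s u"
proof -
  have "(\<bar>a\<bar> - \<bar>b\<bar>)\<^sup>2 \<le> (a - b)\<^sup>2" for a b :: real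
    by (metis abs_triangle_ineq3 abs_le_square_iff)
  then show ?thesis unfolding gagliardo_def
    by (intro nn_integral_mono ennreal_leI divide_right_mono) auto
qed

lemma gagliardo_translate:
  assumes [measurable]: "u \<in> borel_measurable lborel"
  shows "gagliardo s (\<lambda>x. u (x + a)) = gagliardo s u"
proof -
  have "(\<integral>\<^sup>+x. ennreal ((u (x + h + a) - u (x + a))\<^sup>2 / norm h powr (3 + 2 * s)) \<partial>lborel)
    = (\<integral>\<^sup>+x. ennreal ((u (x + h) - u x)\<^sup>2 / norm h powr (3 + 2 * s)) \<partial>lborel)" for h
    using nn_integral_translate[of "\<lambda>x. ennreal ((u (x + h) - u x)\<^sup>2 / norm h powr (3 + 2 * s))" a]
    by (simp add: add.commute add.left_commute)
  then show ?thesis unfolding gagliardo_def by simp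
qed

text \<open>For displacements below 1 the Lipschitz bound gains \<open>norm h\<close> squared on a
  ball of fixed volume; for the others the square of the difference is bounded through the integral
  of \<open>u^2\<close> alone.\<close>

lemma gagliardo_lipschitz_finite:
  assumes s: "0 < s" "s < 1" and [measurable]: "u \<in> borel_measurable lborel"
    and lip: "\<And>x y. \<bar>u x - u y\<bar> \<le> norm (x - y)" and supp: "\<And>x. R \<le> norm x \<Longrightarrow> u x = 0"
    and u2: "integrable lborel (\<lambda>x. (u x)\<^sup>2)"
  shows "gagliardo s u < \<infinity>"
proof -
  let ?V = "emeasure lborel (ball (0::R3) (R + 1))"
  let ?U = "\<integral>\<^sup>+x. ennreal ((u x)\<^sup>2) \<partial>lborel"
  let ?i = "\<lambda>h::R3. ennreal (norm h powr (- (1 + 2 * s))) * indicator (ball 0 1) h"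
  let ?o = "\<lambda>h::R3. ennreal (norm h powr (- (3 + 2 * s))) * indicator (- ball 0 1) h"
  have Ufin: "?U < \<infinity>" using u2 by (simp add: integrable_iff_bounded)
  have "gagliardo s u \<le> (\<integral>\<^sup>+h. ?V * ?i h + 4 * ?U * ?o h \<partial>lborel)"
    unfolding gagliardo_def
  proof (rule nn_integral_mono)
    fix h :: R3
    show "(\<integral>\<^sup>+x. ennreal ((u (x + h) - u x)\<^sup>2 / norm h powr (3 + 2 * s)) \<partial>lborel) \<le> ?V * ?i h + 4 * ?U * ?o h"
    proof (cases "norm h < 1")
      case True
      show ?thesis
      proof (cases "h = 0")
        case False
        have "(\<integral>\<^sup>+x. ennreal ((u (x + h) - u x)\<^sup>2 / norm h powr (3 + 2 * s)) \<partial>lborel)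
          \<le> (\<integral>\<^sup>+x. ennreal (norm h powr (- (1 + 2 * s)))
            * indicator (ball 0 (R + 1)) x \<partial>(lborel :: R3 measure))"
        proof (rule nn_integral_mono)
          fix x
          show "ennreal ((u (x + h) - u x)\<^sup>2 / norm h powr (3 + 2 * s))
            \<le> ennreal (norm h powr (- (1 + 2 * s))) * indicator (ball 0 (R + 1)) x"
          proof (cases "norm x < R + 1")
            case True
            have "(u (x + h) - u x)\<^sup>2 \<le> (norm h)\<^sup>2"
              using power_mono[OF lip[of "x + h" x], of 2] by simp
            then have "(u (x + h) - u x)\<^sup>2 / norm h powr (3 + 2 * s) \<le> (norm h)\<^sup>2 / norm h powr (3 + 2 * s)"
              by (rule divide_right_mono) simp
            also have "(norm h)\<^sup>2 = norm h powr 2" using False by simp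
            also have "norm h powr 2 / norm h powr (3 + 2 * s) = norm h powr (2 - (3 + 2 * s))"
              by (rule powr_diff[symmetric])
            also have "2 - (3 + 2 * s) = - (1 + 2 * s)" by simp
            finally show ?thesis using True by (simp add: ennreal_leI)
          next
            case f: False
            have "R \<le> norm (x + h)" using f \<open>norm h < 1\<close> norm_triangle_ineq4[of "x + h" h] by simp
            then have "u (x + h) = 0" "u x = 0" using supp[of "x + h"] supp[of x] f by auto
            then show ?thesis by simp
          qed
        qed
        also have "\<dots> = ennreal (norm h powr (- (1 + 2 * s))) * ?V"
          by (rule nn_integral_cmult_indicator) simp
        finally show ?thesis using True by (simp add: mult.commute)
      qed simp
    next
      case False
      have "(\<integral>\<^sup>+x. ennreal ((u (x + h) - u x)\<^sup>2 / norm h powr (3 + 2 * s)) \<partial>lborel)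
        \<le> (\<integral>\<^sup>+x. ennreal (norm h powr (- (3 + 2 * s))) * (2 * ennreal ((u (x + h))\<^sup>2)
          + 2 * ennreal ((u x)\<^sup>2)) \<partial>lborel)"
      proof (rule nn_integral_mono)
        fix x
        have "(u (x + h) - u x)\<^sup>2 \<le> 2 * (u (x + h))\<^sup>2 + 2 * (u x)\<^sup>2"
          using norm_add_sq_le[of "u (x + h)" "- u x"] by simp
        then have "(u (x + h) - u x)\<^sup>2 / norm h powr (3 + 2 * s)
          \<le> norm h powr (- (3 + 2 * s)) * (2 * (u (x + h))\<^sup>2 + 2 * (u x)\<^sup>2)"
          unfolding powr_minus_divide using divide_right_mono[of _ _ "norm h powr (3 + 2 * s)"] by simp
        then have "ennreal ((u (x + h) - u x)\<^sup>2 / norm h powr (3 + 2 * s))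
          \<le> ennreal (norm h powr (- (3 + 2 * s)) * (2 * (u (x + h))\<^sup>2 + 2 * (u x)\<^sup>2))"
          by (rule ennreal_leI)
        also have "\<dots> = ennreal (norm h powr (- (3 + 2 * s))) * ennreal (2 * (u (x + h))\<^sup>2 + 2 * (u x)\<^sup>2)"
          by (rule ennreal_mult) simp_all
        also have "ennreal (2 * (u (x + h))\<^sup>2 + 2 * (u x)\<^sup>2) = 2 * ennreal ((u (x + h))\<^sup>2)
          + 2 * ennreal ((u x)\<^sup>2)"
          by (simp add: ennreal_mult)
        finally show "ennreal ((u (x + h) - u x)\<^sup>2 / norm h powr (3 + 2 * s))
          \<le> ennreal (norm h powr (- (3 + 2 * s))) * (2 * ennreal ((u (x + h))\<^sup>2) + 2 * ennreal ((u x)\<^sup>2))" .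
      qed
      also have "\<dots> = ennreal (norm h powr (- (3 + 2 * s))) * (2 * ?U + 2 * ?U)"
        using nn_integral_translate[of "\<lambda>x. ennreal ((u x)\<^sup>2)" h]
        by (subst nn_integral_cmult) (simp_all add: nn_integral_add nn_integral_cmult)
      also have "2 * ?U + 2 * ?U = 4 * ?U" by (simp flip: distrib_right)
      finally show ?thesis using False by (simp add: mult.commute)
    qed
  qed
  also have "\<dots> = ?V * (\<integral>\<^sup>+h. ?i h \<partial>lborel) + 4 * ?U * (\<integral>\<^sup>+h. ?o h \<partial>lborel)"
  proof -
    have [measurable]: "(\<lambda>h::R3. ennreal (norm h powr a) * indicator (ball 0 1) h) \<in> borel_measurable borel"
      "(\<lambda>h::R3. ennreal (norm h powr a) * indicator (- ball 0 1) h) \<in> borel_measurable borel" for a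
      by (rule borel_measurable_times_ennreal, simp, rule borel_measurable_indicator, simp)+
    show ?thesis by (subst nn_integral_add) (simp_all add: nn_integral_cmult)
  qed
  also have "\<dots> < \<infinity>"
    using nn_integral_norm_powr_ball[of "1 + 2 * s"] nn_integral_norm_powr_outside[of "3 + 2 * s"] s Ufin
      emeasure_lborel_ball_finite[of "0::R3" "R + 1"]
    by (simp only: ennreal_add_less_top ennreal_mult_less_top infinity_ennreal_def) auto
  finally show ?thesis .
qed

lemma Hs_measurable: "u \<in> Hs s \<Longrightarrow> u \<in> borel_measurable borel"
  and Hs_square_integrable: "u \<in> Hs s \<Longrightarrow> integrable lborel (\<lambda>x. (u x)\<^sup>2)"
  by (auto simp: Hs_def)

lemma Hs_scale:
  assumes s: "0 < s" "s < 1" and u: "u \<in> Hs s"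
  shows "(\<lambda>x. \<tau> * u x) \<in> Hs s" "kinetic s (\<lambda>x. \<tau> * u x) = \<tau>\<^sup>2 * kinetic s u"
proof -
  have [measurable]: "u \<in> borel_measurable borel" by (rule Hs_measurable[OF u])
  have *: "gagliardo s (\<lambda>x. \<tau> * u x) = ennreal (\<tau>\<^sup>2) * gagliardo s u"
    by (rule gagliardo_scale) simp
  show 1: "(\<lambda>x. \<tau> * u x) \<in> Hs s"
    using u unfolding Hs_iff[OF s] * by (auto simp: power_mult_distrib ennreal_mult_less_top)
  show "kinetic s (\<lambda>x. \<tau> * u x) = \<tau>\<^sup>2 * kinetic s u"
    unfolding kinetic_gagliardo(2)[OF s u] kinetic_gagliardo(2)[OF s 1] * by (simp add: enn2real_mult)
qed

lemma Hs_abs: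
  assumes s: "0 < s" "s < 1" and u: "u \<in> Hs s"
  shows "(\<lambda>x. \<bar>u x\<bar>) \<in> Hs s" "kinetic s (\<lambda>x. \<bar>u x\<bar>) \<le> kinetic s u"
proof -
  have fin: "gagliardo s u < \<infinity>" using u unfolding Hs_iff[OF s] by simp
  show 1: "(\<lambda>x. \<bar>u x\<bar>) \<in> Hs s"
    using u gagliardo_abs_le[of s u] unfolding Hs_iff[OF s] by auto
  show "kinetic s (\<lambda>x. \<bar>u x\<bar>) \<le> kinetic s u"
    unfolding kinetic_gagliardo(2)[OF s u] kinetic_gagliardo(2)[OF s 1]
    using fin by (intro divide_right_mono enn2real_mono gagliardo_abs_le) auto
qed

lemma Hs_translate:
  assumes s: "0 < s" "s < 1" and u: "u \<in> Hs s"
  shows "(\<lambda>x. u (x + a)) \<in> Hs s" "kinetic s (\<lambda>x. u (x + a)) = kinetic s u"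
proof -
  have [measurable]: "u \<in> borel_measurable borel" by (rule Hs_measurable[OF u])
  have *: "gagliardo s (\<lambda>x. u (x + a)) = gagliardo s u"
    by (rule gagliardo_translate) simp
  have "integrable lborel (\<lambda>x. (u (x + a))\<^sup>2)"
    using integrable_translate[of "\<lambda>x. (u x)\<^sup>2" a] Hs_square_integrable[OF u] by simp
  then show 1: "(\<lambda>x. u (x + a)) \<in> Hs s"
    using u unfolding Hs_iff[OF s] * by auto
  show "kinetic s (\<lambda>x. u (x + a)) = kinetic s u"
    unfolding kinetic_gagliardo(2)[OF s u] kinetic_gagliardo(2)[OF s 1] * ..
qed

lemma kinetic_nonneg: "0 \<le> kinetic s u"
  unfolding kinetic_def by (rule integral_nonneg_AE) simp

text \<open>In \<open>(w (x + h) - w x) * (\<phi> (x + h) - \<phi> x)\<close> the products at equal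
  points vanish almost everywhere. What is left is minus the sum of the mixed products, and these
  are seen by a kernel that is positive at every distance. The constant \<open>C\<close> is
  \<open>2 * X\<close> divided by \<open>levy_const s\<close>.\<close>

lemma kinetic_add_disjoint:
  assumes s: "0 < s" "s < 1" and w: "w \<in> Hs s" and \<phi>: "\<phi> \<in> Hs s"
    and w0: "\<And>x. 0 \<le> w x" and \<phi>0: "\<And>x. 0 \<le> \<phi> x"
    and disj: "AE x in lborel. w x * \<phi> x = 0"
    and wnz: "\<not> (AE x in lborel. w x = 0)" and \<rho>: "0 < \<rho>" and \<phi>_pos: "\<And>x. x \<in> ball z \<rho> \<Longrightarrow> 0 < \<phi> x"
  obtains C where "0 < C" "\<And>\<delta>. 0 \<le> \<delta> \<Longrightarrow> (\<lambda>x. w x + \<delta> * \<phi> x) \<in> Hs s"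
    "\<And>\<delta>. 0 \<le> \<delta> \<Longrightarrow> kinetic s (\<lambda>x. w x + \<delta> * \<phi> x) = kinetic s w - C * \<delta> + \<delta>\<^sup>2 * kinetic s \<phi>"
proof -
  have [measurable]: "w \<in> borel_measurable borel" "\<phi> \<in> borel_measurable borel"
    using Hs_measurable w \<phi> by auto
  let ?k = "\<lambda>h::R3. norm h powr (3 + 2 * s)"
  define X where "X = (\<integral>\<^sup>+h. (\<integral>\<^sup>+x. ennreal ((w (x + h) * \<phi> x + w x * \<phi> (x + h)) / ?k h) \<partial>lborel) \<partial>lborel)"
  \<comment> \<open>The cross term stands on the left, so that no subtraction in
    \<open>ennreal\<close> occurs before \<open>X\<close> is known to be finite.\<close>
  have main: "gagliardo s (\<lambda>x. w x + \<delta> * \<phi> x) + ennreal (2 * \<delta>) * X = gagliardo s w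
    + ennreal (\<delta>\<^sup>2) * gagliardo s \<phi>"
    if \<delta>: "0 \<le> \<delta>" for \<delta>
  proof -
    let ?v = "\<lambda>x. w x + \<delta> * \<phi> x"
    have "(\<integral>\<^sup>+x. ennreal ((?v (x + h) - ?v x)\<^sup>2 / ?k h) \<partial>lborel)
        + ennreal (2 * \<delta>) * (\<integral>\<^sup>+x. ennreal ((w (x + h) * \<phi> x + w x * \<phi> (x + h)) / ?k h) \<partial>lborel)
      = (\<integral>\<^sup>+x. ennreal ((w (x + h) - w x)\<^sup>2 / ?k h) \<partial>lborel)
        + ennreal (\<delta>\<^sup>2) * (\<integral>\<^sup>+x. ennreal ((\<phi> (x + h) - \<phi> x)\<^sup>2 / ?k h) \<partial>lborel)" (is "?l = ?r") for h
    proof -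
      have "?l = (\<integral>\<^sup>+x. ennreal ((?v (x + h) - ?v x)\<^sup>2 / ?k h)
          + ennreal (2 * \<delta>) * ennreal ((w (x + h) * \<phi> x + w x * \<phi> (x + h)) / ?k h) \<partial>lborel)"
        by (subst nn_integral_add) (simp_all add: nn_integral_cmult)
      also have "\<dots> = (\<integral>\<^sup>+x. ennreal ((w (x + h) - w x)\<^sup>2 / ?k h)
          + ennreal (\<delta>\<^sup>2) * ennreal ((\<phi> (x + h) - \<phi> x)\<^sup>2 / ?k h) \<partial>lborel)"
      proof (rule nn_integral_cong_AE, use disj AE_translate[OF disj, of h] in eventually_elim)
        case (elim x)
        have "(?v (x + h) - ?v x)\<^sup>2 + 2 * \<delta> * (w (x + h) * \<phi> x + w x * \<phi> (x + h))
          = (w (x + h) - w x)\<^sup>2 + \<delta>\<^sup>2 * (\<phi> (x + h) - \<phi> x)\<^sup>2 + 2 * \<delta> * (w x * \<phi> x + w (x + h) * \<phi> (x + h))"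
          by (simp add: power2_eq_square algebra_simps)
        also have "\<dots> = (w (x + h) - w x)\<^sup>2 + \<delta>\<^sup>2 * (\<phi> (x + h) - \<phi> x)\<^sup>2" using elim by auto
        finally have eq0: "(?v (x + h) - ?v x)\<^sup>2 + 2 * \<delta> * (w (x + h) * \<phi> x + w x * \<phi> (x + h))
          = (w (x + h) - w x)\<^sup>2 + \<delta>\<^sup>2 * (\<phi> (x + h) - \<phi> x)\<^sup>2" .
        have "a / k + m * (b / k) = c / k + n * (d / k)" if "a + m * b = c + n * d" for a b c d m n k :: real
          using that by (metis add_divide_distrib times_divide_eq_right)
        from this[OF eq0] have eq: "(?v (x + h) - ?v x)\<^sup>2 / ?k h
          + 2 * \<delta> * ((w (x + h) * \<phi> x + w x * \<phi> (x + h)) / ?k h)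
          = (w (x + h) - w x)\<^sup>2 / ?k h + \<delta>\<^sup>2 * ((\<phi> (x + h) - \<phi> x)\<^sup>2 / ?k h)" .
        have nn: "0 \<le> (w (x + h) * \<phi> x + w x * \<phi> (x + h)) / ?k h"
          using w0 \<phi>0 by (intro divide_nonneg_nonneg add_nonneg_nonneg mult_nonneg_nonneg) auto
        show ?case
          using arg_cong[OF eq, of ennreal] \<delta> nn
            by (simp add: ennreal_plus ennreal_mult del: times_divide_eq_right)
      qed
      also have "\<dots> = ?r" by (subst nn_integral_add) (simp_all add: nn_integral_cmult)
      finally show ?thesis .
    qed
    note inner = this
    have "gagliardo s ?v + ennreal (2 * \<delta>) * X
      = (\<integral>\<^sup>+h. (\<integral>\<^sup>+x. ennreal ((?v (x + h) - ?v x)\<^sup>2 / ?k h) \<partial>lborel)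
        + ennreal (2 * \<delta>) * (\<integral>\<^sup>+x. ennreal ((w (x + h) * \<phi> x + w x * \<phi> (x + h)) / ?k h) \<partial>lborel) \<partial>lborel)"
      unfolding gagliardo_def X_def by (subst nn_integral_add) (simp_all add: nn_integral_cmult)
    also have "\<dots> = (\<integral>\<^sup>+h. (\<integral>\<^sup>+x. ennreal ((w (x + h) - w x)\<^sup>2 / ?k h) \<partial>lborel)
        + ennreal (\<delta>\<^sup>2) * (\<integral>\<^sup>+x. ennreal ((\<phi> (x + h) - \<phi> x)\<^sup>2 / ?k h) \<partial>lborel) \<partial>lborel)"
      by (simp only: inner)
    also have "\<dots> = gagliardo s w + ennreal (\<delta>\<^sup>2) * gagliardo s \<phi>"
      unfolding gagliardo_def by (subst nn_integral_add) (simp_all add: nn_integral_cmult)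
    finally show ?thesis .
  qed
  have wfin: "gagliardo s w < \<infinity>" and \<phi>fin: "gagliardo s \<phi> < \<infinity>" using w \<phi> unfolding Hs_iff[OF s] by auto
  \<comment> \<open>The identity at \<open>\<delta> = 1\<close> bounds \<open>2 * X\<close> by two
    finite seminorms.\<close>
  have Xfin: "X < \<infinity>"
  proof -
    have "ennreal (2 * 1) * X \<le> gagliardo s (\<lambda>x. w x + 1 * \<phi> x) + ennreal (2 * 1) * X" by simp
    also have "\<dots> = gagliardo s w + ennreal (1\<^sup>2) * gagliardo s \<phi>" by (rule main) simp
    also have "\<dots> < \<infinity>" using wfin \<phi>fin by simp
    finally show ?thesis by (auto simp: ennreal_mult_less_top)
  qed
  \<comment> \<open>\<open>?J x\<close> integrates \<open>\<phi>\<close> against a positive kernel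
    centred at \<open>x\<close>; it is positive for every \<open>x\<close>, however far from the
    support of \<open>\<phi>\<close>. If \<open>X\<close> were 0, \<open>w\<close> would therefore
    vanish almost everywhere.\<close>
  have Xpos: "0 < X"
  proof (rule ccontr)
    assume "\<not> 0 < X"
    then have X0: "X = 0" by simp
    let ?J = "\<lambda>x. \<integral>\<^sup>+h. ennreal (\<phi> (x + h) / ?k h) \<partial>lborel"
    have "(\<integral>\<^sup>+x. ennreal (w x) * ?J x \<partial>lborel)
      = (\<integral>\<^sup>+x. (\<integral>\<^sup>+h. ennreal (w x * \<phi> (x + h) / ?k h) \<partial>lborel) \<partial>lborel)"
    proof (rule nn_integral_cong)
      fix x
      have "ennreal (w x) * ?J x = (\<integral>\<^sup>+h. ennreal (w x) * ennreal (\<phi> (x + h) / ?k h) \<partial>lborel)"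
        by (rule nn_integral_cmult[symmetric]) measurable
      then show "ennreal (w x) * ?J x = (\<integral>\<^sup>+h. ennreal (w x * \<phi> (x + h) / ?k h) \<partial>lborel)"
        using w0[of x] \<phi>0 by (simp add: ennreal_mult[symmetric])
    qed
    also have "\<dots> = (\<integral>\<^sup>+h. (\<integral>\<^sup>+x. ennreal (w x * \<phi> (x + h) / ?k h) \<partial>lborel) \<partial>lborel)"
      by (rule lborel_pair.Fubini') measurable
    also have "\<dots> \<le> X" unfolding X_def
      using w0 \<phi>0 by (intro nn_integral_mono ennreal_leI divide_right_mono) auto
    finally have "(\<integral>\<^sup>+x. ennreal (w x) * ?J x \<partial>lborel) = 0" using X0 by simp
    then have "AE x in lborel. ennreal (w x) * ?J x = 0"
      by (subst (asm) nn_integral_0_iff_AE) auto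
    then have "AE x in lborel. w x = 0"
    proof eventually_elim
      case (elim x)
      have "?J x \<noteq> 0"
      proof
        assume "?J x = 0"
        then have ae: "AE h in lborel. ennreal (\<phi> (x + h) / ?k h) = 0"
          by (subst (asm) nn_integral_0_iff_AE) auto
        have "AE h in lborel. h \<noteq> (0::R3)" by (rule AE_lborel_singleton)
        with ae have "AE h in lborel. h \<notin> ball (z - x) \<rho>"
        proof eventually_elim
          case (elim h)
          show ?case
          proof
            assume "h \<in> ball (z - x) \<rho>"
            then have "x + h \<in> ball z \<rho>" by (simp add: dist_norm algebra_simps)
            then have "0 < \<phi> (x + h) / ?k h" using \<phi>_pos elim(2) by simp
            then show False using elim(1) by (simp add: ennreal_eq_0_iff)
          qed
        qed
        then have "emeasure lborel (ball (z - x) \<rho>) = 0"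
          by (subst (asm) AE_iff_measurable[of "ball (z - x) \<rho>"]) auto
        moreover have "emeasure lborel (ball (z - x) \<rho>) \<noteq> 0"
          using \<rho> by (subst emeasure_ball) (auto simp: ennreal_eq_0_iff unit_ball_vol_pos not_le intro!:
            mult_pos_pos)
        ultimately show False by simp
      qed
      then show ?case using elim w0[of x] by (simp add: ennreal_eq_0_iff)
    qed
    then show False using wnz by simp
  qed
  define c where "c = enn2real (levy_const s)"
  have c: "0 < c" using levy_const_bounds[of s] s by (auto simp: c_def enn2real_positive_iff)
  have Hs: "(\<lambda>x. w x + \<delta> * \<phi> x) \<in> Hs s" if \<delta>: "0 \<le> \<delta>" for \<delta>
    unfolding Hs_iff[OF s]
  proof (intro conjI)
    show "integrable lborel (\<lambda>x. (w x + \<delta> * \<phi> x)\<^sup>2)"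
    proof (rule Bochner_Integration.integrable_bound)
      show "integrable lborel (\<lambda>x. 2 * (w x)\<^sup>2 + 2 * \<delta>\<^sup>2 * (\<phi> x)\<^sup>2)"
        using Hs_square_integrable[OF w] Hs_square_integrable[OF \<phi>] by simp
      show "AE x in lborel. norm ((w x + \<delta> * \<phi> x)\<^sup>2) \<le> norm (2 * (w x)\<^sup>2 + 2 * \<delta>\<^sup>2 * (\<phi> x)\<^sup>2)"
        using norm_add_sq_le[of "w x" "\<delta> * \<phi> x" for x]
          by (intro AE_I2) (simp add: power_mult_distrib mult.assoc)
    qed measurable
    have "gagliardo s (\<lambda>x. w x + \<delta> * \<phi> x) \<le> gagliardo s (\<lambda>x. w x + \<delta> * \<phi> x) + ennreal (2 * \<delta>) * X" by simp
    also have "\<dots> < \<infinity>" unfolding main[OF \<delta>] using wfin \<phi>fin by (simp add: ennreal_mult_less_top)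
    finally show "gagliardo s (\<lambda>x. w x + \<delta> * \<phi> x) < \<infinity>" .
  qed simp
  show ?thesis
  proof (rule that[OF _ Hs])
    show "0 < 2 * enn2real X / c" using Xpos Xfin c by (simp add: enn2real_positive_iff)
    fix \<delta> :: real assume \<delta>: "0 \<le> \<delta>"
    have "gagliardo s (\<lambda>x. w x + \<delta> * \<phi> x) < \<infinity>" using Hs[OF \<delta>] unfolding Hs_iff[OF s] by simp
    then have "enn2real (gagliardo s (\<lambda>x. w x + \<delta> * \<phi> x)) + 2 * \<delta> * enn2real X = enn2real (gagliardo s w)
      + \<delta>\<^sup>2 * enn2real (gagliardo s \<phi>)"
      using arg_cong[OF main[OF \<delta>], of enn2real] Xfin wfin \<phi>fin \<delta>
      by (simp add: enn2real_plus enn2real_mult ennreal_mult_less_top)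
    then show "kinetic s (\<lambda>x. w x + \<delta> * \<phi> x) = kinetic s w - 2 * enn2real X / c * \<delta> + \<delta>\<^sup>2 * kinetic s \<phi>"
      unfolding kinetic_gagliardo(2)[OF s w] kinetic_gagliardo(2)[OF s \<phi>] kinetic_gagliardo(2)[OF s Hs[OF
        \<delta>]] c_def[symmetric]
      using c by (simp add: field_simps)
  qed
qed

section \<open>The fractional Sobolev embedding\<close>

text \<open>The second identity is the scaling relation that singles out the critical exponent; it
  closes the estimate in \<open>sobolev_pointwise\<close>.\<close>

lemma crit_exp_bounds:
  assumes "0 < s" "s < 1"
  shows "2 < crit_exp s" "2 + 2 * s * crit_exp s / 3 = crit_exp s"
  using assms by (auto simp: crit_exp_def field_simps)

text \<open>Averaging \<open>v x \<le> v (x + h) + \<bar>v (x + h) - v x\<bar>\<close> over a ball in \<open>h\<close>, with the radius chosen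
  such that the first contribution is \<open>v x / 4\<close>.\<close>

lemma sobolev_pointwise:
  fixes v :: "R3 \<Rightarrow> real"
  assumes s: "0 < s" "s < 1" and [measurable]: "v \<in> borel_measurable borel" and v0: "\<And>x. 0 \<le> v x"
    and n: "(\<integral>\<^sup>+x. ennreal (v x powr crit_exp s) \<partial>lborel) = ennreal n" "0 < n"
    and W_def: "W = unit_ball_vol (real DIM(R3))"
  shows "ennreal (v x powr crit_exp s)
    \<le> ennreal (4 / W * (4 powr crit_exp s * n / W) powr (2 * s / 3))
       * (\<integral>\<^sup>+h. ennreal ((v (x + h) - v x)\<^sup>2 / norm h powr (3 + 2 * s)) \<partial>lborel)" (is "_ \<le> ?C * ?g")
proof (cases "v x = 0 \<or> ?g = \<infinity>")
  case True
  have W: "0 < W" unfolding W_def by (rule unit_ball_vol_pos) simp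
  then have "0 < 4 / W * (4 powr crit_exp s * n / W) powr (2 * s / 3)" using n by simp
  then show ?thesis using True by (auto simp: ennreal_mult_top)
next
  case False
  define t where "t = v x"
  define r where "r = crit_exp s"
  have W: "0 < W" unfolding W_def by (rule unit_ball_vol_pos) simp
  have t: "0 < t" using False v0[of x] by (simp add: t_def order_less_le)
  have r: "2 < r" "2 + 2 * s * r / 3 = r" using crit_exp_bounds[OF s] by (auto simp: r_def)
  obtain \<gamma> where \<gamma>: "?g = ennreal \<gamma>" "0 \<le> \<gamma>" using False by (cases ?g) auto
  define P where "P = 4 powr r * t powr (- r) * n / W"
  have P: "0 < P" using t n W by (simp add: P_def)
  define \<rho> where "\<rho> = P powr (1 / 3)"
  have \<rho>: "0 < \<rho>" using P by (simp add: \<rho>_def)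
  have \<rho>3: "\<rho> ^ 3 = P" using P by (simp add: \<rho>_def powr_power)
  define a where "a = (t / 4) powr (1 - r)"
  define b where "b = \<rho> powr (3 + 2 * s) / t"
  have ab: "0 \<le> a" "0 \<le> b" using t by (auto simp: a_def b_def)
  have pw: "t / 2 \<le> a * v (x + h) powr r
    + b * ((v (x + h) - v x)\<^sup>2 / norm h powr (3 + 2 * s))" if h: "norm h < \<rho>" for h
  proof -
    let ?y = "v (x + h)" and ?d = "\<bar>v (x + h) - v x\<bar>"
    \<comment> \<open>Values up to \<open>t / 4\<close> are absorbed. Above,
      \<open>?y powr (1 - r)\<close> is at most \<open>(t / 4) powr (1 - r)\<close>, because the
      exponent is negative.\<close>
    have 1: "?y \<le> t / 4 + a * ?y powr r"
    proof (cases "?y \<le> t / 4")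
      case False
      then have y: "t / 4 < ?y" "0 < ?y" using t by auto
      have "?y = ?y powr (1 - r) * ?y powr r" using y by (simp add: powr_add[symmetric])
      also have "\<dots> \<le> a * ?y powr r" unfolding a_def
        using y t r by (intro mult_right_mono powr_mono2') auto
      finally show ?thesis using t by simp
    qed (use ab in \<open>simp add: add_increasing2\<close>)
    \<comment> \<open>Young's inequality splits off a second \<open>t / 4\<close>, so that half of
      \<open>t\<close> survives; the bound \<open>norm h < \<rho>\<close> allows the singular kernel
      to be inserted.\<close>
    have 2: "?d \<le> t / 4 + b * (?d\<^sup>2 / norm h powr (3 + 2 * s))"
    proof (cases "h = 0")
      case False
      have "t * ?d \<le> t\<^sup>2 / 4 + ?d\<^sup>2"
        using zero_le_power2[of "t / 2 - ?d"] by (simp add: power2_diff power_divide)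
      then have "?d \<le> (t\<^sup>2 / 4 + ?d\<^sup>2) / t" using t by (simp add: pos_le_divide_eq mult.commute)
      also have "\<dots> = t / 4 + ?d\<^sup>2 / t" using t by (simp add: power2_eq_square field_simps)
      also have "?d\<^sup>2 / t \<le> b * (?d\<^sup>2 / norm h powr (3 + 2 * s))"
      proof -
        have "norm h powr (3 + 2 * s) \<le> \<rho> powr (3 + 2 * s)" using h s by (intro powr_mono2) auto
        then have "1 \<le> \<rho> powr (3 + 2 * s) / norm h powr (3 + 2 * s)" using False by simp
        then have "?d\<^sup>2 / t * 1 \<le> ?d\<^sup>2 / t * (\<rho> powr (3 + 2 * s) / norm h powr (3 + 2 * s))"
          using t by (intro mult_left_mono) auto
        then show ?thesis by (simp add: b_def mult.commute)
      qed
      finally show ?thesis by simp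
    qed (use t in simp)
    have "t \<le> ?y + ?d" unfolding t_def by simp
    then show ?thesis using 1 2 by simp
  qed
  have vol: "emeasure lborel (ball (0::R3) \<rho>) = ennreal (W * \<rho> ^ 3)"
    using emeasure_ball[of \<rho> "0::R3"] \<rho> by (simp add: W_def)
  have "ennreal (t / 2 * (W * \<rho> ^ 3)) = ennreal (t / 2) * emeasure lborel (ball (0::R3) \<rho>)"
    unfolding vol by (rule ennreal_mult) (use t W \<rho> in auto)
  also have "\<dots> = (\<integral>\<^sup>+h. ennreal (t / 2) * indicator (ball (0::R3) \<rho>) h \<partial>lborel)"
    by (subst nn_integral_cmult_indicator) auto
  also have "\<dots> \<le> (\<integral>\<^sup>+h. ennreal a * ennreal (v (x + h) powr r)
    + ennreal b * ennreal ((v (x + h) - v x)\<^sup>2 / norm h powr (3 + 2 * s)) \<partial>lborel)"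
  proof (rule nn_integral_mono)
    fix h
    show "ennreal (t / 2) * indicator (ball (0::R3) \<rho>) h \<le> ennreal a * ennreal (v (x + h) powr r)
      + ennreal b * ennreal ((v (x + h) - v x)\<^sup>2 / norm h powr (3 + 2 * s))"
    proof (cases "norm h < \<rho>")
      case True
      have "ennreal (t / 2) \<le> ennreal (a * v (x + h) powr r
        + b * ((v (x + h) - v x)\<^sup>2 / norm h powr (3 + 2 * s)))"
        by (rule ennreal_leI[OF pw[OF True]])
      also have "\<dots> = ennreal a * ennreal (v (x + h) powr r)
        + ennreal b * ennreal ((v (x + h) - v x)\<^sup>2 / norm h powr (3 + 2 * s))"
        using ab by (simp only: ennreal_plus ennreal_mult mult_nonneg_nonneg powr_ge_zero
          divide_nonneg_nonneg zero_le_power2)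
      finally show ?thesis using True by simp
    qed simp
  qed
  also have "\<dots> = ennreal a * (\<integral>\<^sup>+h. ennreal (v (x + h) powr r) \<partial>lborel) + ennreal b * ?g"
    by (subst nn_integral_add) (simp_all add: nn_integral_cmult)
  also have "(\<integral>\<^sup>+h. ennreal (v (x + h) powr r) \<partial>lborel) = ennreal n"
    using nn_integral_translate[of "\<lambda>h. ennreal (v h powr r)" x] n(1) by (simp add: add.commute r_def)
  also have "ennreal a * ennreal n + ennreal b * ?g = ennreal (a * n + b * \<gamma>)"
    using ab n \<gamma> by (simp add: ennreal_mult ennreal_plus)
  finally have "t / 2 * (W * \<rho> ^ 3) \<le> a * n + b * \<gamma>"
    by (subst (asm) ennreal_le_iff) (use ab n \<gamma> in auto)
  moreover have "a * n = t / 4 * (W * \<rho> ^ 3)"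
  proof -
    have "a = (t / 4) / (t / 4) powr r" using t by (simp add: a_def powr_diff)
    also have "(t / 4) powr r = t powr r / 4 powr r" using t by (simp add: powr_divide)
    finally show ?thesis using t W unfolding \<rho>3 P_def by (simp add: powr_minus_divide)
  qed
  ultimately have "t / 4 * (W * \<rho> ^ 3) \<le> b * \<gamma>" by linarith
  also have "b = \<rho> ^ 3 * \<rho> powr (2 * s) / t" using \<rho> by (simp add: b_def powr_add)
  finally have "\<rho> ^ 3 * (t * W / 4) \<le> \<rho> ^ 3 * (\<rho> powr (2 * s) / t * \<gamma>)" by (simp add: mult_ac)
  then have "t * W / 4 \<le> \<rho> powr (2 * s) / t * \<gamma>" using \<rho> by (subst (asm) mult_le_cancel_left_pos) auto
  \<comment> \<open>\<open>\<rho> powr (2 * s)\<close> contains the factor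
    \<open>t powr (- (2 * s * r / 3))\<close>. Moved to the left, it raises the exponent from 2 to
    \<open>2 + 2 * s * r / 3\<close>, which is \<open>r\<close>.\<close>
  then have "t\<^sup>2 \<le> 4 / W * \<rho> powr (2 * s) * \<gamma>" using t W by (simp add: field_simps power2_eq_square)
  also have "\<rho> powr (2 * s) = (4 powr r * n / W) powr (2 * s / 3) * t powr (- (2 * s * r / 3))"
  proof -
    have "\<rho> powr (2 * s) = ((4 powr r * n / W) * t powr (- r)) powr (2 * s / 3)"
      by (simp add: \<rho>_def powr_powr P_def mult_ac)
    also have "\<dots> = (4 powr r * n / W) powr (2 * s / 3) * (t powr (- r)) powr (2 * s / 3)"
      using n W by (subst powr_mult) auto
    finally show ?thesis by (simp add: powr_powr mult_ac)
  qed
  finally have "t\<^sup>2 * t powr (2 * s * r / 3)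
    \<le> (4 / W * ((4 powr r * n / W) powr (2 * s / 3) * t powr (- (2 * s * r / 3))) * \<gamma>)
      * t powr (2 * s * r / 3)"
    by (rule mult_right_mono) simp
  also have "\<dots> = (4 / W * (4 powr r * n / W) powr (2 * s / 3)) * \<gamma>
    * (t powr (- (2 * s * r / 3)) * t powr (2 * s * r / 3))"
    by (simp add: mult_ac)
  also have "t powr (- (2 * s * r / 3)) * t powr (2 * s * r / 3) = 1" using t
    by (simp add: powr_add[symmetric])
  also have "t\<^sup>2 * t powr (2 * s * r / 3) = t powr r"
  proof -
    have "t\<^sup>2 = t powr 2" using t by simp
    then have "t\<^sup>2 * t powr (2 * s * r / 3) = t powr (2 + 2 * s * r / 3)" by (simp only: powr_add)
    then show ?thesis using r by simp
  qed
  finally have "t powr r \<le> (4 / W * (4 powr r * n / W) powr (2 * s / 3)) * \<gamma>" by simp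
  then have "ennreal (t powr r) \<le> ennreal ((4 / W * (4 powr r * n / W) powr (2 * s / 3)) * \<gamma>)"
    by (rule ennreal_leI)
  also have "\<dots> = ennreal (4 / W * (4 powr r * n / W) powr (2 * s / 3)) * ennreal \<gamma>"
    using W \<gamma> by (intro ennreal_mult) auto
  finally show ?thesis unfolding \<gamma>(1) t_def r_def .
qed

lemma gagliardo_min_le: "gagliardo s (\<lambda>x. min \<bar>u x\<bar> M) \<le> gagliardo s u"
proof -
  have "(min \<bar>a\<bar> M - min \<bar>b\<bar> M)\<^sup>2 \<le> (a - b)\<^sup>2" for a b :: real
  proof -
    have "\<bar>min \<bar>a\<bar> M - min \<bar>b\<bar> M\<bar> \<le> \<bar>a - b\<bar>" by linarith
    then show ?thesis by (simp add: abs_le_square_iff)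
  qed
  then show ?thesis unfolding gagliardo_def
    by (intro nn_integral_mono ennreal_leI divide_right_mono) auto
qed

text \<open>Integrating \<open>sobolev_pointwise\<close> for a truncation gives
  \<open>n \<le> D * G * n powr (2 * s / 3)\<close>. Since \<open>2 * s / 3 < 1\<close> this bounds
  \<open>n\<close> independently of the truncation level \<open>M\<close>, and monotone convergence
  removes the truncation.\<close>

lemma sobolev:
  assumes s: "0 < s" "s < 1" and u: "u \<in> Hs s"
  shows "integrable lborel (\<lambda>x. \<bar>u x\<bar> powr crit_exp s)"
proof -
  have [measurable]: "u \<in> borel_measurable borel" by (rule Hs_measurable[OF u])
  define r where "r = crit_exp s"
  have r: "2 < r" using crit_exp_bounds[OF s] by (auto simp: r_def)
  define W where "W = unit_ball_vol (real DIM(R3))"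
  have W: "0 < W" unfolding W_def by (rule unit_ball_vol_pos) simp
  define G where "G = enn2real (gagliardo s u)"
  have G: "gagliardo s u = ennreal G" "0 \<le> G" using u unfolding Hs_iff[OF s] by (auto simp: G_def)
  define D where "D = 4 / W * (4 powr r / W) powr (2 * s / 3)"
  have D: "0 < D" using W by (simp add: D_def)
  let ?v = "\<lambda>M x. min \<bar>u x\<bar> (real M)"
  define B where "B = (D * G) powr (1 / (1 - 2 * s / 3))"
  have bound: "(\<integral>\<^sup>+x. ennreal (?v M x powr r) \<partial>lborel) \<le> ennreal B" for M
  proof -
    let ?N = "\<integral>\<^sup>+x. ennreal (?v M x powr r) \<partial>lborel"
    \<comment> \<open>Without this a priori finiteness, \<open>n\<close> could not be divided out of
      the self-referential inequality below.\<close>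
    have "?N \<le> (\<integral>\<^sup>+x. ennreal (real M powr (r - 2)) * ennreal ((u x)\<^sup>2) \<partial>lborel)"
    proof (rule nn_integral_mono)
      fix x
      have "?v M x powr r \<le> real M powr (r - 2) * (u x)\<^sup>2"
      proof (cases "?v M x = 0")
        case False
        then have pos: "0 < ?v M x" by (auto simp: min_def split: if_splits)
        have "?v M x powr r = ?v M x powr ((r - 2) + 2)" by simp
        also have "\<dots> = ?v M x powr (r - 2) * ?v M x powr 2" by (rule powr_add)
        also have "\<dots> \<le> real M powr (r - 2) * \<bar>u x\<bar> powr 2"
          using pos r by (intro mult_mono powr_mono2) auto
        also have "\<bar>u x\<bar> powr 2 = (u x)\<^sup>2" using pos by (subst powr_numeral) auto
        finally show ?thesis .
      qed simp
      then have "ennreal (?v M x powr r) \<le> ennreal (real M powr (r - 2) * (u x)\<^sup>2)" by (rule ennreal_leI)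
      then show "ennreal (?v M x powr r) \<le> ennreal (real M powr (r - 2)) * ennreal ((u x)\<^sup>2)"
        by (simp add: ennreal_mult)
    qed
    also have "\<dots> < \<infinity>"
      using Hs_square_integrable[OF u]
        by (simp add: nn_integral_cmult ennreal_mult_less_top integrable_iff_bounded)
    finally obtain n where n: "?N = ennreal n" "0 \<le> n" by (cases ?N) auto
    show ?thesis
    proof (cases "n = 0")
      case False
      then have n0: "0 < n" using n by simp
      let ?C = "4 / W * (4 powr r * n / W) powr (2 * s / 3)"
      have C: "?C = D * n powr (2 * s / 3)"
      proof -
        have "4 powr r * n / W = (4 powr r / W) * n" by simp
        then have "(4 powr r * n / W) powr (2 * s / 3) = (4 powr r / W) powr (2 * s / 3) * n powr (2 * s / 3)"
          using W n0 by (simp only: powr_mult)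
        then show ?thesis by (simp add: D_def)
      qed
      have "?N \<le> (\<integral>\<^sup>+x. ennreal ?C
        * (\<integral>\<^sup>+h. ennreal ((?v M (x + h) - ?v M x)\<^sup>2 / norm h powr (3 + 2 * s)) \<partial>lborel) \<partial>lborel)"
      proof (rule nn_integral_mono)
        fix x
        show "ennreal (?v M x powr r)
          \<le> ennreal ?C * (\<integral>\<^sup>+h. ennreal ((?v M (x + h) - ?v M x)\<^sup>2 / norm h powr (3 + 2 * s)) \<partial>lborel)"
          unfolding r_def using n n0
          by (intro sobolev_pointwise[where v = "?v M"] s W_def) (auto simp: r_def)
      qed
      also have "\<dots> = ennreal ?C
        * (\<integral>\<^sup>+x. (\<integral>\<^sup>+h. ennreal ((?v M (x + h) - ?v M x)\<^sup>2 / norm h powr (3 + 2 * s)) \<partial>lborel) \<partial>lborel)"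
        by (rule nn_integral_cmult) measurable
      also have "(\<integral>\<^sup>+x. (\<integral>\<^sup>+h. ennreal ((?v M (x + h) - ?v M x)\<^sup>2 / norm h powr (3
        + 2 * s)) \<partial>lborel) \<partial>lborel) = gagliardo s (?v M)"
        unfolding gagliardo_def by (rule lborel_pair.Fubini') measurable
      also have "ennreal ?C * gagliardo s (?v M) \<le> ennreal ?C * ennreal G"
        unfolding G(1)[symmetric] by (intro mult_left_mono gagliardo_min_le) simp
      also have "\<dots> = ennreal (?C * G)" using W G by (intro ennreal_mult[symmetric]) auto
      finally have "n \<le> ?C * G" unfolding n(1) using W G by (subst (asm) ennreal_le_iff) auto
      then have "n \<le> D * n powr (2 * s / 3) * G" unfolding C .
      then have "n * n powr (- (2 * s / 3)) \<le> D * n powr (2 * s / 3) * G * n powr (- (2 * s / 3))"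
        by (rule mult_right_mono) simp
      also have "\<dots> = D * G * (n powr (2 * s / 3) * n powr (- (2 * s / 3)))" by (simp add: mult_ac)
      also have "n powr (2 * s / 3) * n powr (- (2 * s / 3)) = 1" using n0 by (simp add: powr_add[symmetric])
      also have "n * n powr (- (2 * s / 3)) = n powr (1 - 2 * s / 3)"
        using n0 by (simp add: powr_diff powr_minus_divide)
      finally have "n powr (1 - 2 * s / 3) \<le> D * G" by simp
      then have "(n powr (1 - 2 * s / 3)) powr (1 / (1 - 2 * s / 3)) \<le> B"
        unfolding B_def using s by (intro powr_mono2) auto
      moreover have "(n powr (1 - 2 * s / 3)) powr (1 / (1 - 2 * s / 3)) = n"
        using n0 s by (subst powr_powr) simp
      ultimately show ?thesis unfolding n(1) by (intro ennreal_leI) simp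
    qed (use n in simp)
  qed
  have "(\<lambda>M. \<integral>\<^sup>+x. ennreal (?v M x powr r) \<partial>lborel) \<longlonglongrightarrow> (\<integral>\<^sup>+x. ennreal (\<bar>u x\<bar> powr r) \<partial>lborel)"
  proof (rule nn_integral_LIMSEQ)
    show "incseq (\<lambda>M x. ennreal (?v M x powr r))"
      using r by (auto simp: incseq_def le_fun_def intro!: ennreal_leI powr_mono2)
    fix x
    obtain N where N: "\<bar>u x\<bar> \<le> real N" using real_arch_simple by blast
    have "eventually (\<lambda>M. N \<le> M) sequentially" by (rule eventually_ge_at_top)
    then have "eventually (\<lambda>M. ennreal (?v M x powr r) = ennreal (\<bar>u x\<bar> powr r)) sequentially"
    proof eventually_elim
      case (elim M)
      then have "\<bar>u x\<bar> \<le> real M" using N by simp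
      then show ?case by (simp add: min_def)
    qed
    then show "(\<lambda>M. ennreal (?v M x powr r)) \<longlonglongrightarrow> ennreal (\<bar>u x\<bar> powr r)" by (rule tendsto_eventually)
  qed measurable
  then have "(\<integral>\<^sup>+x. ennreal (\<bar>u x\<bar> powr r) \<partial>lborel) \<le> ennreal B"
    using bound by (intro LIMSEQ_le_const2) auto
  also have "\<dots> < \<infinity>" by simp
  finally show ?thesis unfolding r_def[symmetric] by (intro integrableI_bounded) auto
qed

section \<open>The Coulomb energy\<close>

lemma powr_le_add_powr:
  fixes a :: real
  assumes "0 \<le> a" "2 \<le> p" "p \<le> r"
  shows "a powr p \<le> a\<^sup>2 + a powr r"
proof (cases "a \<le> 1")
  case True
  show ?thesis
  proof (cases "a = 0")
    case False
    then have "a powr p \<le> a powr 2" using assms True by (intro powr_mono') auto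
    also have "a powr 2 = a\<^sup>2" using False assms by simp
    finally show ?thesis by (simp add: add_increasing2)
  qed simp
next
  case False
  then have "a powr p \<le> a powr r" using assms by (intro powr_mono) auto
  then show ?thesis by (simp add: add_increasing)
qed

lemma Hs_powr_integrable:
  assumes s: "0 < s" "s < 1" and u: "u \<in> Hs s" and p: "2 \<le> p" "p \<le> crit_exp s"
  shows "integrable lborel (\<lambda>x. \<bar>u x\<bar> powr p)"
proof (rule Bochner_Integration.integrable_bound)
  have [measurable]: "u \<in> borel_measurable borel" by (rule Hs_measurable[OF u])
  show "integrable lborel (\<lambda>x. (u x)\<^sup>2 + \<bar>u x\<bar> powr crit_exp s)"
    using Hs_square_integrable[OF u] sobolev[OF s u] by simp
  show "AE x in lborel. norm (\<bar>u x\<bar> powr p) \<le> norm ((u x)\<^sup>2 + \<bar>u x\<bar> powr crit_exp s)"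
    using powr_le_add_powr[of "\<bar>u x\<bar>" p "crit_exp s" for x] p by (intro AE_I2) simp
  show "(\<lambda>x. \<bar>u x\<bar> powr p) \<in> borel_measurable lborel" by measurable
qed

text \<open>A quadratic form in the density \<open>a\<close>, which is \<open>u^2\<close> in the
  application. As a form in the density it allows the convexity estimate
  \<open>riesz_energy_convex\<close>.\<close>

definition riesz_energy :: "real \<Rightarrow> (R3 \<Rightarrow> real) \<Rightarrow> real" where
  "riesz_energy t a = riesz_const t * (LINT x|lborel. (LINT y|lborel. a y / norm (x - y) powr (3 - 2 * t))
    * a x)"

lemma poisson_energy: "(LINT x|lborel. poisson_potential t u x * (u x)\<^sup>2) = riesz_energy t (\<lambda>x. (u x)\<^sup>2)"
  unfolding riesz_energy_def poisson_potential_def mult.assoc by (rule integral_mult_right_zero)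

lemma riesz_const_pos: "0 < t \<Longrightarrow> t < 1 \<Longrightarrow> 0 < riesz_const t"
  unfolding riesz_const_def by (auto intro!: mult_pos_pos divide_pos_pos Gamma_real_pos)

lemma riesz_energy_scale: "riesz_energy t (\<lambda>x. c * a x) = c\<^sup>2 * riesz_energy t a"
proof -
  have "(LINT y|lborel. c * a y / norm (x - y) powr (3 - 2 * t))
    = c * (LINT y|lborel. a y / norm (x - y) powr (3 - 2 * t))" for x
    unfolding times_divide_eq_right[symmetric] by (rule integral_mult_right_zero)
  then have "riesz_energy t (\<lambda>x. c * a x)
    = riesz_const t * (LINT x|lborel. c\<^sup>2 * ((LINT y|lborel. a y / norm (x - y) powr (3 - 2 * t)) * a x))"
    unfolding riesz_energy_def by (simp add: power2_eq_square mult_ac)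
  also have "\<dots> = riesz_const t
    * (c\<^sup>2 * (LINT x|lborel. (LINT y|lborel. a y / norm (x - y) powr (3 - 2 * t)) * a x))"
    by (simp only: integral_mult_right_zero)
  finally show ?thesis unfolding riesz_energy_def by (simp add: mult_ac)
qed

lemma riesz_energy_translate:
  assumes [measurable]: "a \<in> borel_measurable borel"
  shows "riesz_energy t (\<lambda>x. a (x + z)) = riesz_energy t a"
proof -
  define I where "I x = (LINT y|lborel. a y / norm (x - y) powr (3 - 2 * t))" for x
  have [measurable]: "I \<in> borel_measurable borel"
    unfolding I_def[abs_def] by (intro lborel.borel_measurable_lebesgue_integral) measurable
  have "(LINT y|lborel. a (y + z) / norm (x - y) powr (3 - 2 * t)) = I (x + z)" for x
    using integral_translate[of "\<lambda>y. a y / norm (x + z - y) powr (3 - 2 * t)" z]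
    by (simp add: I_def algebra_simps)
  then have "riesz_energy t (\<lambda>x. a (x + z)) = riesz_const t * (LINT x|lborel. I (x + z) * a (x + z))"
    by (simp add: riesz_energy_def)
  also have "\<dots> = riesz_const t * (LINT x|lborel. I x * a x)"
    by (subst integral_translate[of "\<lambda>x. I x * a x"]) simp_all
  finally show ?thesis by (simp add: riesz_energy_def I_def)
qed

lemma riesz_energy_nonneg:
  assumes "0 < t" "t < 1" "\<And>x. 0 \<le> a x"
  shows "0 \<le> riesz_energy t a"
  unfolding riesz_energy_def using riesz_const_pos[OF assms(1,2)] assms(3)
  by (intro mult_nonneg_nonneg integral_nonneg_AE AE_I2 Bochner_Integration.integral_nonneg) auto

lemma riesz_energy_cong_AE:
  assumes [measurable]: "a \<in> borel_measurable borel" "b \<in> borel_measurable borel"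
    and eq: "AE x in lborel. a x = b x"
  shows "riesz_energy t a = riesz_energy t b"
proof -
  have 1: "(LINT y|lborel. a y / norm (x - y) powr (3 - 2 * t))
    = (LINT y|lborel. b y / norm (x - y) powr (3 - 2 * t))" for x
    by (rule integral_cong_AE) (use eq in auto)
  have [measurable]: "(\<lambda>x. LINT y|lborel. b y / norm (x - y) powr (3 - 2 * t)) \<in> borel_measurable borel"
    by (intro lborel.borel_measurable_lebesgue_integral) measurable
  have "(LINT x|lborel. (LINT y|lborel. b y / norm (x - y) powr (3 - 2 * t)) * a x)
    = (LINT x|lborel. (LINT y|lborel. b y / norm (x - y) powr (3 - 2 * t)) * b x)"
    by (rule integral_cong_AE) (use eq in auto)
  then show ?thesis by (simp add: riesz_energy_def 1)
qed

text \<open>The kernel is split at distance 1: far away it is at most 1 and integrability of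
  \<open>a\<close> suffices; nearby it is integrable, as \<open>3 - 2 * t < 3\<close>, and the
  product is at most the sum of squares. For \<open>a = u^2\<close> with \<open>u\<close> in
  \<open>Hs\<close> this asks for \<open>u^4\<close> to be integrable, which the Sobolev embedding
  gives since \<open>4 < r\<close>.\<close>

lemma riesz_integrable:
  fixes a :: "R3 \<Rightarrow> real"
  assumes t: "0 < t" "t < 1" and [measurable]: "a \<in> borel_measurable borel" and a0: "\<And>x. 0 \<le> a x"
    and i1: "integrable lborel a" and i2: "integrable lborel (\<lambda>x. (a x)\<^sup>2)"
  shows "integrable (lborel \<Otimes>\<^sub>M lborel) (\<lambda>(x, y). a y / norm (x - y) powr (3 - 2 * t) * a x)"
proof (rule integrableI_bounded)
  let ?p = "3 - 2 * t"
  define k where "k z = ennreal (norm z powr (- ?p)) * indicator (ball 0 1) z" for z :: R3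
  let ?A = "\<integral>\<^sup>+x. ennreal (a x) \<partial>lborel" and ?A2 = "\<integral>\<^sup>+x. ennreal ((a x)\<^sup>2) \<partial>lborel"
  have km[measurable]: "k \<in> borel_measurable borel"
    unfolding k_def[abs_def] by (rule borel_measurable_times_ennreal, simp, rule
      borel_measurable_indicator, simp)
  have kfin: "(\<integral>\<^sup>+z. k z \<partial>lborel) < \<infinity>" unfolding k_def using nn_integral_norm_powr_ball[of ?p] t by auto
  have k_sym: "k (- z) = k z" for z by (simp add: k_def indicator_def)
  have ky: "(\<integral>\<^sup>+x. k (x - y) \<partial>lborel) = (\<integral>\<^sup>+z. k z \<partial>lborel)" for y
    using nn_integral_translate[of k "- y"] by simp
  have kx: "(\<integral>\<^sup>+y. k (x - y) \<partial>lborel) = (\<integral>\<^sup>+z. k z \<partial>lborel)" for x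
  proof -
    have "k (x - y) = k (y - x)" for y using k_sym[of "y - x"] by simp
    then show ?thesis using ky[of x] by simp
  qed
  show fm: "(\<lambda>(x, y). a y / norm (x - y) powr ?p * a x) \<in> borel_measurable (lborel \<Otimes>\<^sub>M lborel)" by measurable
  have "(\<integral>\<^sup>+ p. ennreal (norm (case p of (x, y) \<Rightarrow> a y / norm (x - y) powr ?p * a x)) \<partial>(lborel \<Otimes>\<^sub>M lborel))
    = (\<integral>\<^sup>+ x. (\<integral>\<^sup>+ y. ennreal (norm (a y / norm (x - y) powr ?p * a x)) \<partial>lborel) \<partial>lborel)"
    by (subst lborel.nn_integral_fst[symmetric]) (use fm in simp_all)
  also have "\<dots> \<le> (\<integral>\<^sup>+ x. (\<integral>\<^sup>+ y. ennreal (a x) * ennreal (a y)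
    + (ennreal ((a x)\<^sup>2) * k (x - y) + ennreal ((a y)\<^sup>2) * k (x - y)) \<partial>lborel) \<partial>lborel)"
  proof (intro nn_integral_mono)
    fix x y
    show "ennreal (norm (a y / norm (x - y) powr ?p * a x))
      \<le> ennreal (a x) * ennreal (a y) + (ennreal ((a x)\<^sup>2) * k (x - y) + ennreal ((a y)\<^sup>2) * k (x - y))"
    proof (cases "norm (x - y) < 1")
      case True
      have "a y * a x \<le> (a x)\<^sup>2 + (a y)\<^sup>2"
        using norm_mult_le_sum_squares[of "a x" "a y"] a0[of x] a0[of y] by (simp add: mult.commute)
      then have "norm (x - y) powr (- ?p) * (a y * a x) \<le> norm (x - y) powr (- ?p) * ((a x)\<^sup>2 + (a y)\<^sup>2)"
        by (rule mult_left_mono) simp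
      moreover have "norm (a y / norm (x - y) powr ?p * a x) = norm (x - y) powr (- ?p) * (a y * a x)"
        unfolding powr_minus_divide using a0 by simp
      ultimately have "ennreal (norm (a y / norm (x - y) powr ?p * a x))
        \<le> ennreal (norm (x - y) powr (- ?p) * ((a x)\<^sup>2 + (a y)\<^sup>2))"
        by (simp only: ennreal_leI)
      also have "\<dots> = ennreal ((a x)\<^sup>2) * k (x - y) + ennreal ((a y)\<^sup>2) * k (x - y)"
      proof -
        have "k (x - y) = ennreal (norm (x - y) powr (- ?p))" using True by (simp add: k_def)
        moreover have "ennreal (norm (x - y) powr (- ?p) * ((a x)\<^sup>2 + (a y)\<^sup>2))
          = ennreal (norm (x - y) powr (- ?p)) * (ennreal ((a x)\<^sup>2) + ennreal ((a y)\<^sup>2))"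
          by (subst ennreal_mult) auto
        ultimately show ?thesis by (simp only: distrib_left distrib_right mult.commute)
      qed
      finally show ?thesis by (simp add: add_increasing)
    next
      case False
      have "1 \<le> norm (x - y) powr ?p" using False t by (intro ge_one_powr_ge_zero) auto
      then have "a y * a x / norm (x - y) powr ?p \<le> a y * a x / 1" using a0 by (intro divide_left_mono) auto
      then have "norm (a y / norm (x - y) powr ?p * a x) \<le> a x * a y" using a0 by (simp add: mult.commute)
      then have "ennreal (norm (a y / norm (x - y) powr ?p * a x)) \<le> ennreal (a x * a y)"
        by (rule ennreal_leI)
      also have "\<dots> = ennreal (a x) * ennreal (a y)" using a0 by (intro ennreal_mult) auto
      finally show ?thesis by (simp add: add_increasing2)
    qed
  qed
  also have "\<dots> = (\<integral>\<^sup>+ x. ennreal (a x) * ?A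
    + (ennreal ((a x)\<^sup>2) * (\<integral>\<^sup>+z. k z \<partial>lborel) + (\<integral>\<^sup>+ y. ennreal ((a y)\<^sup>2) * k (x - y) \<partial>lborel)) \<partial>lborel)"
  proof (rule nn_integral_cong)
    fix x
    have [measurable]: "(\<lambda>y. k (x - y)) \<in> borel_measurable borel"
      by (rule measurable_compose[OF _ km]) measurable
    show "(\<integral>\<^sup>+ y. ennreal (a x) * ennreal (a y)
      + (ennreal ((a x)\<^sup>2) * k (x - y) + ennreal ((a y)\<^sup>2) * k (x - y)) \<partial>lborel)
      = ennreal (a x) * ?A + (ennreal ((a x)\<^sup>2) * (\<integral>\<^sup>+z. k z \<partial>lborel)
        + (\<integral>\<^sup>+ y. ennreal ((a y)\<^sup>2) * k (x - y) \<partial>lborel))"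
      unfolding kx[of x, symmetric] by (simp add: nn_integral_add nn_integral_cmult)
  qed
  also have "\<dots> = ?A * ?A + (?A2 * (\<integral>\<^sup>+z. k z \<partial>lborel)
    + (\<integral>\<^sup>+ x. (\<integral>\<^sup>+ y. ennreal ((a y)\<^sup>2) * k (x - y) \<partial>lborel) \<partial>lborel))"
  proof -
    have [measurable]: "(\<lambda>p. k (fst p - snd p)) \<in> borel_measurable (borel \<Otimes>\<^sub>M borel)"
      by (rule measurable_compose[OF _ km]) measurable
    have [measurable]: "(\<lambda>x. \<integral>\<^sup>+ y. ennreal ((a y)\<^sup>2) * k (x - y) \<partial>lborel) \<in> borel_measurable borel"
      by (intro lborel.borel_measurable_nn_integral) (simp add: split_beta)
    show ?thesis by (simp add: nn_integral_add nn_integral_multc)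
  qed
  also have "(\<integral>\<^sup>+ x. (\<integral>\<^sup>+ y. ennreal ((a y)\<^sup>2) * k (x - y) \<partial>lborel) \<partial>lborel)
    = (\<integral>\<^sup>+ y. (\<integral>\<^sup>+ x. ennreal ((a y)\<^sup>2) * k (x - y) \<partial>lborel) \<partial>lborel)"
  proof (rule lborel_pair.Fubini')
    have [measurable]: "(\<lambda>p. k (fst p - snd p)) \<in> borel_measurable (borel \<Otimes>\<^sub>M borel)"
      by (rule measurable_compose[OF _ km]) measurable
    have [measurable]: "(\<lambda>p. k (snd p - fst p)) \<in> borel_measurable (borel \<Otimes>\<^sub>M borel)"
      by (rule measurable_compose[OF _ km]) measurable
    show "(\<lambda>(y, x). ennreal ((a y)\<^sup>2) * k (x - y)) \<in> borel_measurable (lborel \<Otimes>\<^sub>M lborel)"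
      by (simp add: split_beta)
  qed
  also have "\<dots> = ?A2 * (\<integral>\<^sup>+z. k z \<partial>lborel)"
  proof -
    have "(\<integral>\<^sup>+ x. ennreal ((a y)\<^sup>2) * k (x - y) \<partial>lborel) = ennreal ((a y)\<^sup>2) * (\<integral>\<^sup>+z. k z \<partial>lborel)" for y
    proof -
      have [measurable]: "(\<lambda>x. k (x - y)) \<in> borel_measurable borel"
        by (rule measurable_compose[OF _ km]) measurable
      show ?thesis unfolding ky[of y, symmetric] by (rule nn_integral_cmult) simp
    qed
    then show ?thesis by (simp add: nn_integral_multc)
  qed
  also have "?A * ?A + (?A2 * (\<integral>\<^sup>+z. k z \<partial>lborel) + ?A2 * (\<integral>\<^sup>+z. k z \<partial>lborel)) < \<infinity>"
  proof -
    have "?A < \<infinity>" "?A2 < \<infinity>" using i1 i2 a0 by (auto simp: integrable_iff_bounded)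
    then show ?thesis using kfin
      by (simp only: ennreal_add_less_top ennreal_mult_less_top infinity_ennreal_def) auto
  qed
  finally show "(\<integral>\<^sup>+ p. ennreal (norm (case p of (x, y) \<Rightarrow> a y / norm (x - y) powr ?p
    * a x)) \<partial>(lborel \<Otimes>\<^sub>M lborel)) < \<infinity>" .
qed

lemma riesz_energy_eq:
  assumes t: "0 < t" "t < 1" and am: "a \<in> borel_measurable borel" and a0: "\<And>x. 0 \<le> a x"
    and i1: "integrable lborel a" and i2: "integrable lborel (\<lambda>x. (a x)\<^sup>2)"
  shows "riesz_energy t a = riesz_const t
    * (LINT p|(lborel \<Otimes>\<^sub>M lborel). (case p of (x, y) \<Rightarrow> a y / norm (x - y) powr (3 - 2 * t) * a x))"
  using lborel_pair.integral_fst[OF riesz_integrable[OF assms]]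
  unfolding riesz_energy_def by (simp only: integral_mult_left_zero)

text \<open>Already true for the integrands: the defect is
  \<open>\<theta> * (1 - \<theta>) * b x * b y\<close> times the kernel. Applied with
  \<open>\<theta> = \<delta>^2\<close>, it bounds the growth of the Coulomb energy by a fixed
  multiple of \<open>\<delta>^2\<close>.\<close>

lemma riesz_energy_convex:
  assumes t: "0 < t" "t < 1"
    and am: "a \<in> borel_measurable borel" and a0: "\<And>x. 0 \<le> a x"
    and ai: "integrable lborel a" "integrable lborel (\<lambda>x. (a x)\<^sup>2)"
    and bm: "b \<in> borel_measurable borel" and b0: "\<And>x. 0 \<le> b x"
    and bi: "integrable lborel b" "integrable lborel (\<lambda>x. (b x)\<^sup>2)"
    and \<theta>: "0 \<le> \<theta>" "\<theta> \<le> 1"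
  shows "riesz_energy t (\<lambda>x. a x + \<theta> * b x) \<le> riesz_energy t a
    + \<theta> * (riesz_energy t (\<lambda>x. a x + b x) - riesz_energy t a)"
proof -
  have [measurable]: "a \<in> borel_measurable borel" "b \<in> borel_measurable borel" by fact+
  let ?K = "\<lambda>a (x, y). a y / norm (x - y) powr (3 - 2 * t) * a x"
  have sq: "integrable lborel (\<lambda>x. (a x + c * b x)\<^sup>2)" for c
  proof (rule Bochner_Integration.integrable_bound)
    show "integrable lborel (\<lambda>x. 2 * (a x)\<^sup>2 + 2 * c\<^sup>2 * (b x)\<^sup>2)" using ai bi by simp
    show "AE x in lborel. norm ((a x + c * b x)\<^sup>2) \<le> norm (2 * (a x)\<^sup>2 + 2 * c\<^sup>2 * (b x)\<^sup>2)"
      using norm_add_sq_le[of "a x" "c * b x" for x]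
        by (intro AE_I2) (simp add: power_mult_distrib mult.assoc)
  qed measurable
  have C: "0 < riesz_const t" by (rule riesz_const_pos[OF t])
  have int: "integrable (lborel \<Otimes>\<^sub>M lborel) (?K (\<lambda>x. a x + c * b x))" if "0 \<le> c" for c
    using that a0 b0 ai bi sq by (intro riesz_integrable t) auto
  have E: "riesz_energy t (\<lambda>x. a x + c * b x)
    = riesz_const t * (LINT p|(lborel \<Otimes>\<^sub>M lborel). ?K (\<lambda>x. a x + c * b x) p)" if "0 \<le> c" for c
    using that a0 b0 ai bi sq by (intro riesz_energy_eq t) auto
  have "(LINT p|(lborel \<Otimes>\<^sub>M lborel). ?K (\<lambda>x. a x + \<theta> * b x) p)
    \<le> (LINT p|(lborel \<Otimes>\<^sub>M lborel). (1 - \<theta>) * ?K (\<lambda>x. a x + 0 * b x) p + \<theta> * ?K (\<lambda>x. a x + 1 * b x) p)"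
  proof (rule integral_mono)
    show "integrable (lborel \<Otimes>\<^sub>M lborel) (?K (\<lambda>x. a x + \<theta> * b x))" by (rule int[OF \<theta>(1)])
    show "integrable (lborel \<Otimes>\<^sub>M lborel) (\<lambda>p. (1 - \<theta>) * ?K (\<lambda>x. a x + 0 * b x) p
      + \<theta> * ?K (\<lambda>x. a x + 1 * b x) p)"
      by (intro Bochner_Integration.integrable_add integrable_mult_right int) simp_all
    fix p :: "R3 \<times> R3"
    obtain x y where p: "p = (x, y)" by (cases p)
    let ?k = "norm (x - y) powr (3 - 2 * t)"
    have "0 \<le> \<theta> * (1 - \<theta>) * (b y * b x)" using \<theta> b0 by (intro mult_nonneg_nonneg) auto
    then have "(a y + \<theta> * b y) * (a x + \<theta> * b x) \<le> (1 - \<theta>) * (a y * a x) + \<theta> * ((a y + b y) * (a x + b x))"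
      by (simp add: algebra_simps)
    then have "(a y + \<theta> * b y) * (a x + \<theta> * b x) / ?k
      \<le> ((1 - \<theta>) * (a y * a x) + \<theta> * ((a y + b y) * (a x + b x))) / ?k"
      by (rule divide_right_mono) simp
    then show "?K (\<lambda>x. a x + \<theta> * b x) p \<le> (1 - \<theta>) * ?K (\<lambda>x. a x + 0 * b x) p + \<theta> * ?K (\<lambda>x. a x + 1 * b x) p"
      unfolding p prod.case
      by (simp only: times_divide_eq_left times_divide_eq_right add_divide_distrib[symmetric]
        mult_zero_left add_0_right mult_1_left)
  qed
  also have "\<dots> = (1 - \<theta>) * (LINT p|(lborel \<Otimes>\<^sub>M lborel). ?K (\<lambda>x. a x + 0 * b x) p)
    + \<theta> * (LINT p|(lborel \<Otimes>\<^sub>M lborel). ?K (\<lambda>x. a x + 1 * b x) p)"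
    using int[of 0] int[of 1] by (subst Bochner_Integration.integral_add) (simp_all only:
      integrable_mult_right integral_mult_right_zero zero_le_one order_refl)
  finally have "riesz_energy t (\<lambda>x. a x + \<theta> * b x)
    \<le> riesz_const t * ((1 - \<theta>) * (LINT p|(lborel \<Otimes>\<^sub>M lborel). ?K (\<lambda>x. a x + 0 * b x) p)
      + \<theta> * (LINT p|(lborel \<Otimes>\<^sub>M lborel). ?K (\<lambda>x. a x + 1 * b x) p))"
    unfolding E[OF \<theta>(1)] using C by (intro mult_left_mono) auto
  also have "\<dots> = (1 - \<theta>) * riesz_energy t (\<lambda>x. a x + 0 * b x) + \<theta> * riesz_energy t (\<lambda>x. a x + 1 * b x)"
    unfolding E[OF order_refl] E[OF zero_le_one] by (simp only: distrib_left mult.left_commute)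
  also have "\<dots> = riesz_energy t a + \<theta> * (riesz_energy t (\<lambda>x. a x + b x) - riesz_energy t a)"
    by (simp add: algebra_simps)
  finally show ?thesis .
qed

section \<open>Fibering maps\<close>

text \<open>By the mean value theorem each difference quotient is a value of \<open>g'\<close> at an
  intermediate point, so \<open>B\<close> dominates it.\<close>

lemma DERIV_lebesgue_integral:
  fixes g g' :: "'a \<Rightarrow> real \<Rightarrow> real"
  assumes int: "\<And>\<tau>. integrable M (\<lambda>x. g x \<tau>)"
    and der: "\<And>x \<tau>. ((g x) has_real_derivative g' x \<tau>) (at \<tau>)"
    and meas: "(\<lambda>x. g' x \<tau>0) \<in> borel_measurable M"
    and d: "0 < d" and bound: "\<And>x \<tau>. \<bar>\<tau> - \<tau>0\<bar> < d \<Longrightarrow> \<bar>g' x \<tau>\<bar> \<le> B x" and B: "integrable M B"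
  shows "((\<lambda>\<tau>. LINT x|M. g x \<tau>) has_real_derivative (LINT x|M. g' x \<tau>0)) (at \<tau>0)"
  unfolding has_field_derivative_iff tendsto_at_iff_sequentially
proof (intro allI impI)
  fix X :: "nat \<Rightarrow> real" assume X: "\<forall>i. X i \<in> UNIV - {\<tau>0}" and lim: "X \<longlonglongrightarrow> \<tau>0"
  have "eventually (\<lambda>i. dist (X i) \<tau>0 < d) sequentially" using lim d by (simp add: tendsto_iff)
  then obtain N where N: "\<And>i. N \<le> i \<Longrightarrow> \<bar>X i - \<tau>0\<bar> < d" by (auto simp: eventually_sequentially dist_real_def)
  let ?Y = "\<lambda>i. X (i + N)"
  let ?q = "\<lambda>i x. (g x (?Y i) - g x \<tau>0) / (?Y i - \<tau>0)"
  have ne: "X i \<noteq> \<tau>0" for i using X by auto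
  have qi: "integrable M (?q i)" for i using int by simp
  have lim_q: "(\<lambda>i. LINT x|M. ?q i x) \<longlonglongrightarrow> (LINT x|M. g' x \<tau>0)"
  proof (rule integral_dominated_convergence[OF meas _ B])
    show "?q i \<in> borel_measurable M" for i using qi by auto
    show "AE x in M. (\<lambda>i. ?q i x) \<longlonglongrightarrow> g' x \<tau>0"
    proof (rule AE_I2)
      fix x
      have "((\<lambda>y. (g x y - g x \<tau>0) / (y - \<tau>0)) \<longlongrightarrow> g' x \<tau>0) (at \<tau>0)"
        using der[of x \<tau>0] by (simp add: has_field_derivative_iff)
      then have "((\<lambda>y. (g x y - g x \<tau>0) / (y - \<tau>0)) \<circ> X) \<longlonglongrightarrow> g' x \<tau>0"
        using X lim unfolding tendsto_at_iff_sequentially by blast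
      then show "(\<lambda>i. ?q i x) \<longlonglongrightarrow> g' x \<tau>0" unfolding o_def by (rule LIMSEQ_ignore_initial_segment)
    qed
    show "AE x in M. norm (?q i x) \<le> B x" for i
    proof (rule AE_I2)
      fix x
      have close: "\<bar>?Y i - \<tau>0\<bar> < d" by (rule N) simp
      obtain z where z: "\<bar>z - \<tau>0\<bar> < d" "?q i x = g' x z"
      proof (cases "\<tau>0 < ?Y i")
        case True
        then obtain z where z: "\<tau>0 < z" "z < ?Y i" "g x (?Y i) - g x \<tau>0 = (?Y i - \<tau>0) * g' x z"
          using MVT2[of \<tau>0 "?Y i" "g x" "g' x"] der by blast
        show ?thesis by (rule that[of z]) (use z close ne[of "i + N"] in auto)
      next
        case False
        then have "?Y i < \<tau>0" using ne[of "i + N"] by simp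
        then obtain z where z: "?Y i < z" "z < \<tau>0" "g x \<tau>0 - g x (?Y i) = (\<tau>0 - ?Y i) * g' x z"
          using MVT2[of "?Y i" \<tau>0 "g x" "g' x"] der by blast
        then have "g x (?Y i) - g x \<tau>0 = (?Y i - \<tau>0) * g' x z" by (simp add: algebra_simps)
        then show ?thesis by (intro that[of z]) (use z close ne[of "i + N"] in auto)
      qed
      then show "norm (?q i x) \<le> B x" using bound[OF z(1), of x] by simp
    qed
  qed
  have "(LINT x|M. ?q i x) = ((LINT x|M. g x (?Y i)) - (LINT x|M. g x \<tau>0)) / (?Y i - \<tau>0)" for i
    using int by simp
  with lim_q have "(\<lambda>i. ((LINT x|M. g x (?Y i)) - (LINT x|M. g x \<tau>0)) / (?Y i - \<tau>0)) \<longlonglongrightarrow> (LINT x|M. g' x \<tau>0)"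
    by (simp only:)
  then show "((\<lambda>y. ((LINT x|M. g x y) - (LINT x|M. g x \<tau>0)) / (y - \<tau>0)) \<circ> X) \<longlonglongrightarrow> (LINT x|M. g' x \<tau>0)"
    unfolding o_def by (rule LIMSEQ_offset[where k = N])
qed

text \<open>\<open>T\<close> depends on the coefficients alone. Bounding the coefficients of a whole
  family of rays from the right sides thus yields one \<open>T\<close> for all of them.\<close>

lemma ray_eventually_nonpos:
  fixes a b d r :: real
  assumes a: "0 \<le> a" and b: "0 \<le> b" and d: "0 < d" and r: "4 < r"
  obtains T where "1 \<le> T" "\<And>\<tau>. T \<le> \<tau> \<Longrightarrow> \<tau>\<^sup>2 / 2 * a + \<tau> ^ 4 / 4 * b - \<tau> powr r / r * d \<le> 0"
proof -
  \<comment> \<open>The threshold for \<open>\<tau> powr (r - 4)\<close> beyond which the last term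
    beats \<open>\<tau>^4 * (a / 2 + b / 4)\<close>; for \<open>\<tau> \<ge> 1\<close> the latter
    also covers the quadratic term.\<close>
  define M where "M = (a / 2 + b / 4) * r / d"
  have M: "0 \<le> M" using assms by (simp add: M_def)
  define T where "T = max 1 (M powr (1 / (r - 4)))"
  show ?thesis
  proof (rule that[of T])
    show "1 \<le> T" by (simp add: T_def)
    fix \<tau> assume \<tau>: "T \<le> \<tau>"
    then have \<tau>1: "1 \<le> \<tau>" and \<tau>M: "M powr (1 / (r - 4)) \<le> \<tau>" by (auto simp: T_def)
    have "M = (M powr (1 / (r - 4))) powr (r - 4)" using M r by (simp add: powr_powr)
    also have "\<dots> \<le> \<tau> powr (r - 4)" using \<tau>M r by (intro powr_mono2) auto
    finally have "a / 2 + b / 4 \<le> \<tau> powr (r - 4) / r * d"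
      using d r by (simp add: M_def field_simps)
    then have "\<tau> ^ 4 * (a / 2 + b / 4) \<le> \<tau> ^ 4 * (\<tau> powr (r - 4) / r * d)"
      by (rule mult_left_mono) simp
    also have "\<tau> ^ 4 * (\<tau> powr (r - 4) / r * d) = (\<tau> powr 4 * \<tau> powr (r - 4)) / r * d"
      using \<tau>1 by simp
    also have "\<tau> powr 4 * \<tau> powr (r - 4) = \<tau> powr r" by (simp add: powr_add[symmetric])
    finally have 1: "\<tau> ^ 4 * (a / 2 + b / 4) \<le> \<tau> powr r / r * d" .
    have "\<tau>\<^sup>2 \<le> \<tau> ^ 4" using \<tau>1 by (intro power_increasing) auto
    then have "\<tau>\<^sup>2 * a \<le> \<tau> ^ 4 * a" using a by (rule mult_right_mono)
    then show "\<tau>\<^sup>2 / 2 * a + \<tau> ^ 4 / 4 * b - \<tau> powr r / r * d \<le> 0"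
      using 1 by (simp add: algebra_simps)
  qed
qed

text \<open>The energy along one ray, reduced to its coefficients: \<open>a\<close> for the
  quadratic part, \<open>b\<close> for the Coulomb energy, \<open>d\<close> for the critical term,
  and \<open>P\<close> for the integral of the primitive of \<open>f\<close>. The monotone quotient
  is what \<open>(f_1)\<close> becomes after integration.\<close>

locale fibering =
  fixes a b d r :: real and P P' :: "real \<Rightarrow> real"
  assumes a: "0 < a" and b: "0 \<le> b" and d: "0 < d" and r: "4 < r"
    and P_deriv: "\<And>\<tau>. (P has_real_derivative P' \<tau>) (at \<tau>)"
    and P0: "P 0 = 0" and P'0: "P' 0 = 0"
    and P_nonneg: "\<And>\<tau>. 0 \<le> \<tau> \<Longrightarrow> 0 \<le> P \<tau>"
    and P'1: "0 \<le> P' 1"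
    and P'_mono: "\<And>\<tau> \<sigma>. 0 < \<tau> \<Longrightarrow> \<tau> \<le> \<sigma> \<Longrightarrow> P' \<tau> / \<tau> ^ 3 \<le> P' \<sigma> / \<sigma> ^ 3"
begin

definition h :: "real \<Rightarrow> real" where
  "h \<tau> = \<tau>\<^sup>2 / 2 * a + \<tau> ^ 4 / 4 * b - P \<tau> - \<tau> powr r / r * d"

text \<open>The derivative of \<open>h\<close> divided by \<open>\<tau>^3\<close>. This division
  makes the Coulomb term constant and all other terms nonincreasing.\<close>

definition slope :: "real \<Rightarrow> real" where
  "slope \<tau> = a / \<tau>\<^sup>2 + b - P' \<tau> / \<tau> ^ 3 - \<tau> powr (r - 4) * d"

lemma h_deriv:
  assumes \<tau>: "0 < \<tau>"
  shows "(h has_real_derivative \<tau> ^ 3 * slope \<tau>) (at \<tau>)"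
proof -
  have "(h has_real_derivative (\<tau> * a + \<tau> ^ 3 * b - P' \<tau> - \<tau> powr (r - 1) * d)) (at \<tau>)"
    unfolding h_def[abs_def] using \<tau> r
    by (auto intro!: derivative_eq_intros P_deriv has_real_derivative_powr)
  moreover have "\<tau> powr (r - 1) = \<tau> ^ 3 * \<tau> powr (r - 4)"
  proof -
    have "\<tau> ^ 3 * \<tau> powr (r - 4) = \<tau> powr 3 * \<tau> powr (r - 4)" using \<tau> by simp
    then show ?thesis by (simp add: powr_add[symmetric])
  qed
  then have "\<tau> * a + \<tau> ^ 3 * b - P' \<tau> - \<tau> powr (r - 1) * d = \<tau> ^ 3 * slope \<tau>"
    using \<tau> by (simp add: slope_def right_diff_distrib distrib_left power3_eq_cube power2_eq_square)
  ultimately show ?thesis by simp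
qed

lemma slope_antimono:
  assumes "0 < \<tau>" "\<tau> \<le> \<sigma>"
  shows "slope \<sigma> \<le> slope \<tau>"
proof -
  have "\<tau>\<^sup>2 \<le> \<sigma>\<^sup>2" using assms by (intro power_mono) auto
  then have "a / \<sigma>\<^sup>2 \<le> a / \<tau>\<^sup>2" using assms a by (intro divide_left_mono) auto
  moreover have "\<tau> powr (r - 4) * d \<le> \<sigma> powr (r - 4) * d"
    using assms r d by (intro mult_right_mono powr_mono2) auto
  ultimately show ?thesis unfolding slope_def using P'_mono[OF assms] by linarith
qed

text \<open>A nonincreasing \<open>slope\<close> that vanishes at \<open>\<sigma>\<close> is
  nonnegative before and nonpositive after it.\<close>

lemma critical_imp_max:
  assumes \<sigma>: "0 < \<sigma>" and crit: "(h has_real_derivative 0) (at \<sigma>)" and \<tau>: "0 < \<tau>"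
  shows "h \<tau> \<le> h \<sigma>"
proof -
  have "\<sigma> ^ 3 * slope \<sigma> = 0" by (rule DERIV_unique[OF h_deriv[OF \<sigma>] crit])
  then have s0: "slope \<sigma> = 0" using \<sigma> by simp
  show ?thesis
  proof (cases "\<tau> \<le> \<sigma>")
    case True
    show ?thesis
    proof (rule DERIV_nonneg_imp_nondecreasing[OF True])
      fix x assume x: "\<tau> \<le> x" "x \<le> \<sigma>"
      have "0 \<le> x ^ 3 * slope x" using slope_antimono[of x \<sigma>] x \<tau> s0 by (intro mult_nonneg_nonneg) auto
      then show "\<exists>y. (h has_real_derivative y) (at x) \<and> 0 \<le> y" using h_deriv[of x] x \<tau> by auto
    qed
  next
    case False
    then have le: "\<sigma> \<le> \<tau>" by simp
    show ?thesis
    proof (rule DERIV_nonpos_imp_nonincreasing[OF le])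
      fix x assume x: "\<sigma> \<le> x" "x \<le> \<tau>"
      have "x ^ 3 * slope x \<le> 0" using slope_antimono[of \<sigma> x] x \<sigma> s0 by (intro mult_nonneg_nonpos) auto
      then show "\<exists>y. (h has_real_derivative y) (at x) \<and> y \<le> 0" using h_deriv[of x] x \<sigma> by auto
    qed
  qed
qed

text \<open>Integrates \<open>P' x \<le> P' 1 * x^3\<close>, the monotonicity of the quotient
  compared with its value at 1.\<close>

lemma P_le: 
  assumes "0 \<le> \<tau>" "\<tau> \<le> 1"
  shows "P \<tau> \<le> P' 1 * \<tau> ^ 4 / 4"
proof -
  let ?G = "\<lambda>\<tau>. P' 1 * \<tau> ^ 4 / 4 - P \<tau>"
  have "?G 0 \<le> ?G \<tau>"
  proof (rule DERIV_nonneg_imp_nondecreasing[OF assms(1)])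
    fix x assume x: "0 \<le> x" "x \<le> \<tau>"
    have "(?G has_real_derivative (P' 1 * x ^ 3 - P' x)) (at x)"
      by (auto intro!: derivative_eq_intros P_deriv)
    moreover have "0 \<le> P' 1 * x ^ 3 - P' x"
    proof (cases "x = 0")
      case False
      then have "P' x / x ^ 3 \<le> P' 1 / 1 ^ 3" using x assms by (intro P'_mono) auto
      then show ?thesis using False x by (simp add: pos_divide_le_eq)
    qed (simp add: P'0)
    ultimately show "\<exists>y. (?G has_real_derivative y) (at x) \<and> 0 \<le> y" by blast
  qed
  then show ?thesis by (simp add: P0)
qed

lemma h_pos_somewhere: obtains \<tau> where "0 < \<tau>" "\<tau> \<le> 1" "0 < h \<tau>"
proof -
  \<comment> \<open>Collects the negative terms as a multiple of \<open>\<tau>^4\<close>, using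
    \<open>\<tau> powr r \<le> \<tau>^4\<close> on the unit interval. The choice of
    \<open>\<tau>\<close> then makes them at most half of the quadratic term.\<close>
  define K where "K = P' 1 / 4 + d / r"
  have K: "0 < K" using P'1 d r by (simp add: K_def add_nonneg_pos)
  define \<tau> where "\<tau> = min 1 (sqrt (a / (4 * K)))"
  have \<tau>: "0 < \<tau>" "\<tau> \<le> 1" using a K by (auto simp: \<tau>_def)
  have "\<tau>\<^sup>2 \<le> (sqrt (a / (4 * K)))\<^sup>2" using \<tau> by (intro power_mono) (auto simp: \<tau>_def)
  then have \<tau>K: "\<tau>\<^sup>2 * K \<le> a / 4" using a K by (simp add: pos_le_divide_eq field_simps)
  have "\<tau> powr r \<le> \<tau> powr 4" using \<tau> r by (intro powr_mono') auto
  then have "\<tau> powr r / r * d \<le> \<tau> ^ 4 / r * d" using \<tau> r d by (intro mult_right_mono divide_right_mono) auto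
  moreover have "0 \<le> \<tau> ^ 4 / 4 * b" using b by simp
  ultimately have "\<tau>\<^sup>2 / 2 * a - \<tau> ^ 4 * K \<le> h \<tau>"
    using P_le[of \<tau>] \<tau> unfolding h_def K_def by (simp add: algebra_simps)
  moreover have "\<tau> ^ 4 * K \<le> \<tau>\<^sup>2 * (a / 4)"
    using mult_left_mono[OF \<tau>K, of "\<tau>\<^sup>2"] by (simp add: power4_eq_xxxx power2_eq_square mult.assoc)
  moreover have "0 < \<tau>\<^sup>2 * (a / 4)" using \<tau> a by simp
  ultimately have "0 < h \<tau>" by (simp add: algebra_simps)
  with \<tau> show ?thesis by (rule that)
qed

text \<open>The derivative formula is available for positive parameters only, so the maximum is
  taken over a compact interval \<open>{\<alpha>..T}\<close> whose two endpoints have values below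
  \<open>h \<tau>1\<close>; a maximiser is then interior.\<close>

lemma max_exists:
  obtains \<sigma> where "0 < \<sigma>" "(h has_real_derivative 0) (at \<sigma>)" "0 < h \<sigma>"
proof -
  obtain \<tau>1 where \<tau>1: "0 < \<tau>1" "\<tau>1 \<le> 1" "0 < h \<tau>1" by (rule h_pos_somewhere)
  obtain T where T: "1 \<le> T" "\<And>\<tau>. T \<le> \<tau> \<Longrightarrow> \<tau>\<^sup>2 / 2 * a + \<tau> ^ 4 / 4 * b - \<tau> powr r / r * d \<le> 0"
    using ray_eventually_nonpos[of a b d r] a b d r by auto
  have hT: "h T \<le> 0" using T P_nonneg[of T] by (fastforce simp: h_def)
  define A where "A = a / 2 + b / 4"
  have A: "0 < A" using a b by (simp add: A_def)
  \<comment> \<open>Near 0 the energy is at most \<open>\<alpha>\<^sup>2 * A\<close>, which this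
    choice keeps below half of \<open>h \<tau>1\<close>.\<close>
  define \<alpha> where "\<alpha> = min \<tau>1 (sqrt (h \<tau>1 / (2 * A)))"
  have \<alpha>: "0 < \<alpha>" "\<alpha> \<le> \<tau>1" using \<tau>1 A by (auto simp: \<alpha>_def)
  have h\<alpha>: "h \<alpha> < h \<tau>1"
  proof -
    have "\<alpha>\<^sup>2 \<le> (sqrt (h \<tau>1 / (2 * A)))\<^sup>2" using \<alpha> by (intro power_mono) (auto simp: \<alpha>_def)
    then have 1: "\<alpha>\<^sup>2 * A \<le> h \<tau>1 / 2" using A \<tau>1 by (simp add: field_simps)
    have "\<alpha> ^ 4 \<le> \<alpha>\<^sup>2" using \<alpha> \<tau>1 by (intro power_decreasing) auto
    then have "\<alpha> ^ 4 * b \<le> \<alpha>\<^sup>2 * b" using b by (rule mult_right_mono)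
    moreover have "0 \<le> \<alpha> powr r / r * d" using r d by simp
    moreover have "h \<alpha> = \<alpha>\<^sup>2 * a / 2 + \<alpha> ^ 4 * b / 4 - P \<alpha> - \<alpha> powr r / r * d" by (simp add: h_def)
    moreover have "\<alpha>\<^sup>2 * A = \<alpha>\<^sup>2 * a / 2 + \<alpha>\<^sup>2 * b / 4" by (simp add: A_def distrib_left)
    ultimately have "h \<alpha> \<le> \<alpha>\<^sup>2 * A" using P_nonneg[of \<alpha>] \<alpha> by linarith
    then show ?thesis using 1 \<tau>1 by simp
  qed
  have "\<tau>1 \<le> T" using \<tau>1 T by simp
  then have \<alpha>T: "\<alpha> \<le> T" using \<alpha> by simp
  have "continuous_on {\<alpha>..T} h"
    using \<alpha> by (intro continuous_at_imp_continuous_on ballI DERIV_isCont[OF h_deriv]) auto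
  then obtain \<sigma> where \<sigma>: "\<sigma> \<in> {\<alpha>..T}" "\<And>y. y \<in> {\<alpha>..T} \<Longrightarrow> h y \<le> h \<sigma>"
    using continuous_attains_sup[of "{\<alpha>..T}" h] \<alpha>T by (auto simp: atLeastatMost_empty_iff)
  have h\<sigma>: "h \<tau>1 \<le> h \<sigma>" using \<sigma>(2)[of \<tau>1] \<alpha> \<open>\<tau>1 \<le> T\<close> by simp
  have int: "\<alpha> < \<sigma>" "\<sigma> < T"
    using \<sigma>(1) h\<sigma> h\<alpha> hT \<tau>1(3) by (auto simp: order_less_le)
  have \<sigma>0: "0 < \<sigma>" using int \<alpha> by simp
  have "\<sigma> ^ 3 * slope \<sigma> = 0"
  proof (rule DERIV_local_max[OF h_deriv[OF \<sigma>0]])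
    show "0 < min (\<sigma> - \<alpha>) (T - \<sigma>)" using int by simp
    show "\<forall>y. \<bar>\<sigma> - y\<bar> < min (\<sigma> - \<alpha>) (T - \<sigma>) \<longrightarrow> h y \<le> h \<sigma>"
    proof (intro allI impI)
      fix y assume "\<bar>\<sigma> - y\<bar> < min (\<sigma> - \<alpha>) (T - \<sigma>)"
      then have "\<bar>\<sigma> - y\<bar> < \<sigma> - \<alpha>" "\<bar>\<sigma> - y\<bar> < T - \<sigma>" by auto
      then have "\<alpha> \<le> y" "y \<le> T" by linarith+
      then show "h y \<le> h \<sigma>" by (intro \<sigma>(2)) simp
    qed
  qed
  then have "(h has_real_derivative 0) (at \<sigma>)" using h_deriv[OF \<sigma>0] by (simp only:)
  then show ?thesis using \<sigma>0 h\<sigma> \<tau>1(3) by (intro that[of \<sigma>]) auto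
qed

end

section \<open>The energy along rays\<close>

lemma integrable_bounded_mult:
  fixes V g :: "'a \<Rightarrow> real"
  assumes [measurable]: "V \<in> borel_measurable M" and g: "integrable M g" and V: "\<And>x. \<bar>V x\<bar> \<le> B"
  shows "integrable M (\<lambda>x. V x * g x)"
proof (rule Bochner_Integration.integrable_bound)
  have [measurable]: "g \<in> borel_measurable M" using g by auto
  show "integrable M (\<lambda>x. B * g x)" using g by simp
  show "(\<lambda>x. V x * g x) \<in> borel_measurable M" by measurable
  show "AE x in M. norm (V x * g x) \<le> norm (B * g x)"
    using order_trans[OF V abs_ge_self] by (intro AE_I2) (auto simp: abs_mult intro!: mult_right_mono)
qed

text \<open>The properties shared by the rescaled coefficients, their translates and their constant
  limits, so that the facts on rays apply to all of them.\<close>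

definition admissible :: "(R3 \<Rightarrow> real) \<Rightarrow> bool" where
  "admissible V \<longleftrightarrow> V \<in> borel_measurable borel \<and> (\<exists>m B. 0 < m \<and> (\<forall>x. m \<le> V x \<and> V x \<le> B))"

lemma admissible_integrable:
  assumes V: "admissible V" and g: "integrable lborel g"
  shows "integrable lborel (\<lambda>x. V x * g x)"
proof -
  obtain m B where "V \<in> borel_measurable borel" "0 < m" "\<And>x. m \<le> V x" "\<And>x. V x \<le> B"
    using V by (auto simp: admissible_def)
  moreover from this have "\<bar>V x\<bar> \<le> B" for x by (smt (verit))
  ultimately show ?thesis by (intro integrable_bounded_mult g) auto
qed

lemma admissible_pos: "admissible V \<Longrightarrow> 0 < V x"
  unfolding admissible_def by (meson less_le_trans)

lemma admissible_integral_pos: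
  assumes V: "admissible V" and g: "integrable lborel g" and g0: "\<And>x. 0 \<le> g x"
    and nz: "\<not> (AE x in lborel. g x = 0)"
  shows "0 < (LINT x|lborel. V x * g x)"
proof -
  have i: "integrable lborel (\<lambda>x. V x * g x)" by (rule admissible_integrable[OF V g])
  have nn: "AE x in lborel. 0 \<le> V x * g x" using admissible_pos[OF V] g0 by (auto simp: less_imp_le)
  have "(LINT x|lborel. V x * g x) \<noteq> 0"
  proof
    assume "(LINT x|lborel. V x * g x) = 0"
    then have "AE x in lborel. V x * g x = 0" using integral_nonneg_eq_0_iff_AE[OF i nn] by simp
    then have "AE x in lborel. g x = 0"
      by eventually_elim (use admissible_pos[OF V] in \<open>simp add: less_imp_neq[symmetric]\<close>)
    then show False using nz by simp
  qed
  moreover have "0 \<le> (LINT x|lborel. V x * g x)" by (rule integral_nonneg_AE[OF nn])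
  ultimately show ?thesis by simp
qed

locale schroedinger_poisson =
  fixes s t p c1 :: real and f :: "real \<Rightarrow> real"
  assumes s: "3 / 4 < s" "s < 1" and t: "0 < t" "t < 1"
    and f_diff: "\<And>\<tau>. f differentiable (at \<tau>)"
    and f_pos: "\<And>\<tau>. \<tau> > 0 \<Longrightarrow> f \<tau> * \<tau> > 0"
    and f_neg: "\<And>\<tau>. \<tau> \<le> 0 \<Longrightarrow> f \<tau> = 0"
    and f_mono: "strict_mono_on {0<..} (\<lambda>\<tau>. f \<tau> / \<tau> ^ 3)"
    and p: "2 < p" "p < crit_exp s"
    and c1: "0 < c1" and f_growth: "\<And>\<tau>. \<bar>deriv f \<tau>\<bar> \<le> c1 * (1 + \<bar>\<tau>\<bar> powr (p - 2))"
begin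

section \<open>Growth and monotonicity of \<open>f\<close> and its primitive\<close>

abbreviation r :: real where "r \<equiv> crit_exp s"
abbreviation F :: "real \<Rightarrow> real" where "F \<equiv> primitive f"

lemma s': "0 < s" "s < 1" using s by auto

text \<open>The lower bound \<open>3 / 4\<close> on \<open>s\<close> enters here.\<close>

lemma r: "4 < r" using s by (simp add: crit_exp_def field_simps)

lemma f_deriv: "(f has_real_derivative deriv f \<tau>) (at \<tau>)"
  using f_diff[of \<tau>] by (simp add: DERIV_deriv_iff_real_differentiable)

lemma f_cont: "continuous_on A f"
  by (intro continuous_at_imp_continuous_on ballI DERIV_isCont[OF f_deriv])

lemma f_measurable[measurable]: "f \<in> borel_measurable borel"
  by (rule borel_measurable_continuous_onI[OF f_cont])

lemma f_nonneg: "0 \<le> f \<tau>"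
  using f_pos[of \<tau>] f_neg[of \<tau>] by (cases "0 < \<tau>") (auto simp: zero_less_mult_iff)

lemma F_deriv: "(F has_real_derivative f \<tau>) (at \<tau>)"
proof -
  let ?a = "- (\<bar>\<tau>\<bar> + 1)" and ?b = "\<bar>\<tau>\<bar> + 1"
  have "((\<lambda>u. LBINT y=ereal 0..ereal u. f y) has_vector_derivative f \<tau>) (at \<tau> within {?a..?b})"
    by (rule interval_integral_FTC2) (auto intro: f_cont)
  moreover have "at \<tau> within {?a..?b} = at \<tau>" by (rule at_within_Icc_at) auto
  ultimately show ?thesis
    unfolding primitive_def[abs_def] has_real_derivative_iff_has_vector_derivative by simp
qed

lemma F_cont: "continuous_on A F"
  by (intro continuous_at_imp_continuous_on ballI DERIV_isCont[OF F_deriv])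

lemma F_measurable[measurable]: "F \<in> borel_measurable borel"
  by (rule borel_measurable_continuous_onI[OF F_cont])

lemma F_0: "F 0 = 0"
  by (simp add: primitive_def)

lemma F_mono: "\<tau> \<le> \<sigma> \<Longrightarrow> F \<tau> \<le> F \<sigma>"
  using F_deriv f_nonneg by (auto intro!: DERIV_nonneg_imp_nondecreasing[of \<tau> \<sigma> F])

lemma F_nonpos_arg:
  assumes "\<tau> \<le> 0" shows "F \<tau> = 0"
proof (cases "\<tau> = 0")
  case False
  then have "\<tau> < 0" using assms by simp
  then obtain z where z: "\<tau> < z" "z < 0" "F 0 - F \<tau> = (0 - \<tau>) * f z"
    using MVT2[of \<tau> 0 F f] F_deriv by blast
  then show ?thesis using f_neg[of z] F_0 by simp
qed (simp add: F_0)

lemma F_nonneg: "0 \<le> F \<tau>"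
  using F_mono[of 0 \<tau>] F_nonpos_arg[of \<tau>] F_0 by (cases "0 \<le> \<tau>") auto

lemma F_pos:
  assumes "0 < \<tau>" shows "0 < F \<tau>"
proof -
  obtain z where z: "0 < z" "z < \<tau>" "F \<tau> - F 0 = (\<tau> - 0) * f z"
    using MVT2[of 0 \<tau> F f] assms F_deriv by blast
  then show ?thesis using f_pos[of z] assms F_0 by (simp add: zero_less_mult_iff)
qed

lemma f_bound: "f \<tau> \<le> c1 * (\<bar>\<tau>\<bar> + \<bar>\<tau>\<bar> powr (p - 1))"
proof (cases "0 < \<tau>")
  case True
  obtain z where z: "0 < z" "z < \<tau>" "f \<tau> - f 0 = (\<tau> - 0) * deriv f z"
    using MVT2[of 0 \<tau> f "deriv f"] True f_deriv by blast
  then have "f \<tau> = \<tau> * deriv f z" using f_neg[of 0] by simp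
  also have "\<dots> \<le> \<tau> * (c1 * (1 + \<tau> powr (p - 2)))"
  proof (rule mult_left_mono)
    have "z powr (p - 2) \<le> \<tau> powr (p - 2)" using z p by (intro powr_mono2) auto
    then have "c1 * (1 + \<bar>z\<bar> powr (p - 2)) \<le> c1 * (1 + \<tau> powr (p - 2))" using c1 z by simp
    then show "deriv f z \<le> c1 * (1 + \<tau> powr (p - 2))" using f_growth[of z] by linarith
  qed (use True in simp)
  also have "\<dots> = c1 * (\<tau> + \<tau> powr 1 * \<tau> powr (p - 2))" using True by (simp add: algebra_simps)
  also have "\<tau> powr 1 * \<tau> powr (p - 2) = \<tau> powr (p - 1)" by (simp only: powr_add[symmetric]) simp
  finally show ?thesis using True by simp
next
  case False
  have "0 \<le> c1 * (\<bar>\<tau>\<bar> + \<bar>\<tau>\<bar> powr (p - 1))"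
    using c1 by (intro mult_nonneg_nonneg add_nonneg_nonneg) auto
  then show ?thesis using f_neg[of \<tau>] False by simp
qed

text \<open>Uniform in \<open>\<bar>\<tau>\<bar> \<le> T\<close>: with \<open>u x\<close> for
  \<open>u\<close>, the right-hand side is the integrable majorant for differentiating
  \<open>nonlin\<close> in \<open>\<tau>\<close>.\<close>

lemma f_mult_bound:
  assumes "\<bar>\<tau>\<bar> \<le> T"
  shows "\<bar>f (\<tau> * u) * u\<bar> \<le> c1 * (T * u\<^sup>2 + T powr (p - 1) * \<bar>u\<bar> powr p)"
proof -
  have "f (\<tau> * u) \<le> c1 * (\<bar>\<tau> * u\<bar> + \<bar>\<tau> * u\<bar> powr (p - 1))" by (rule f_bound)
  also have "\<dots> \<le> c1 * (T * \<bar>u\<bar> + (T * \<bar>u\<bar>) powr (p - 1))"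
  proof (intro mult_left_mono add_mono)
    show 1: "\<bar>\<tau> * u\<bar> \<le> T * \<bar>u\<bar>" using assms by (auto simp: abs_mult intro: mult_right_mono)
    show "\<bar>\<tau> * u\<bar> powr (p - 1) \<le> (T * \<bar>u\<bar>) powr (p - 1)" using 1 p by (intro powr_mono2) auto
  qed (use c1 in simp)
  also have "(T * \<bar>u\<bar>) powr (p - 1) = T powr (p - 1) * \<bar>u\<bar> powr (p - 1)"
    using assms by (intro powr_mult)
  finally have "\<bar>f (\<tau> * u) * u\<bar> \<le> c1 * (T * \<bar>u\<bar> + T powr (p - 1) * \<bar>u\<bar> powr (p - 1)) * \<bar>u\<bar>"
    using f_nonneg[of "\<tau> * u"] by (simp add: abs_mult mult_right_mono)
  also have "\<dots> = c1 * (T * u\<^sup>2 + T powr (p - 1) * (\<bar>u\<bar> powr (p - 1) * \<bar>u\<bar> powr 1))"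
  proof -
    have u2: "u\<^sup>2 = \<bar>u\<bar> * \<bar>u\<bar>" by (simp add: power2_eq_square)
    show ?thesis unfolding u2 by (simp add: distrib_left distrib_right mult_ac)
  qed
  also have "\<bar>u\<bar> powr (p - 1) * \<bar>u\<bar> powr 1 = \<bar>u\<bar> powr p" by (simp only: powr_add[symmetric]) simp
  finally show ?thesis .
qed

lemma F_bound: "F \<tau> \<le> c1 * (\<tau>\<^sup>2 + \<bar>\<tau>\<bar> powr p)"
proof (cases "0 < \<tau>")
  case True
  obtain z where z: "0 < z" "z < \<tau>" "F \<tau> - F 0 = (\<tau> - 0) * f z"
    using MVT2[of 0 \<tau> F f] True F_deriv by blast
  then have "F \<tau> = f ((z / \<tau>) * \<tau>) * \<tau>" using F_0 True by simp
  also have "\<dots> \<le> c1 * (1 * \<tau>\<^sup>2 + 1 powr (p - 1) * \<bar>\<tau>\<bar> powr p)"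
    using f_mult_bound[of "z / \<tau>" 1 \<tau>] z True by simp
  finally show ?thesis by simp
next
  case False
  then show ?thesis using F_nonpos_arg[of \<tau>] c1 by (simp add: add_nonneg_nonneg)
qed

text \<open>For positive \<open>u\<close> the quotient is \<open>u^4\<close> times
  \<open>f y / y^3\<close> at \<open>y = \<tau> * u\<close>, so \<open>f_mono\<close> applies;
  otherwise both sides are 0.\<close>

lemma f_ratio_mono:
  assumes "0 < \<tau>" "\<tau> \<le> \<sigma>"
  shows "f (\<tau> * u) * u / \<tau> ^ 3 \<le> f (\<sigma> * u) * u / \<sigma> ^ 3"
proof (cases "0 < u")
  case True
  have "f (\<tau> * u) / (\<tau> * u) ^ 3 \<le> f (\<sigma> * u) / (\<sigma> * u) ^ 3"
  proof (cases "\<tau> = \<sigma>")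
    case False
    then have "\<tau> * u < \<sigma> * u" using assms True by simp
    then show ?thesis using strict_mono_onD[OF f_mono, of "\<tau> * u" "\<sigma> * u"] assms True by simp
  qed simp
  then have "u ^ 4 * (f (\<tau> * u) / (\<tau> * u) ^ 3) \<le> u ^ 4 * (f (\<sigma> * u) / (\<sigma> * u) ^ 3)"
    by (rule mult_left_mono) simp
  moreover have "u ^ 4 * (f x / (k * u) ^ 3) = f x * u / k ^ 3" for x k
    using True by (simp add: power_mult_distrib power4_eq_xxxx power3_eq_cube mult_ac)
  ultimately show ?thesis by simp
next
  case False
  then have "\<tau> * u \<le> 0" "\<sigma> * u \<le> 0" using assms by (auto simp: mult_le_0_iff)
  then show ?thesis using f_neg by simp
qed

definition nonlin :: "(R3 \<Rightarrow> real) \<Rightarrow> (R3 \<Rightarrow> real) \<Rightarrow> real \<Rightarrow> real" where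
  "nonlin K u \<tau> = (LINT x|lborel. K x * F (\<tau> * u x))"

definition nonlin' :: "(R3 \<Rightarrow> real) \<Rightarrow> (R3 \<Rightarrow> real) \<Rightarrow> real \<Rightarrow> real" where
  "nonlin' K u \<tau> = (LINT x|lborel. K x * (f (\<tau> * u x) * u x))"

text \<open>For positive \<open>\<tau>\<close> the energy of \<open>\<tau> * u\<close>, see
  \<open>energy_ray\<close>. The coefficients are arbitrary functions and carry no
  \<open>\<epsilon>\<close>, so that translated and constant ones can be inserted.\<close>

definition ray where
  "ray V K Q u \<tau> = \<tau>\<^sup>2 / 2 * (kinetic s u + (LINT x|lborel. V x * (u x)\<^sup>2))
     + \<tau> ^ 4 / 4 * riesz_energy t (\<lambda>x. (u x)\<^sup>2) - nonlin K u \<tau>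
     - \<tau> powr r / r * (LINT x|lborel. Q x * \<bar>u x\<bar> powr r)"

context
  fixes u assumes u: "u \<in> Hs s"
begin

lemma u_measurable[measurable]: "u \<in> borel_measurable borel"
  by (rule Hs_measurable[OF u])

lemma integrable_F: "integrable lborel (\<lambda>x. F (\<tau> * u x))"
proof (rule Bochner_Integration.integrable_bound)
  have "integrable lborel (\<lambda>x. \<bar>\<tau> * u x\<bar> powr p)"
    using Hs_powr_integrable[OF s' Hs_scale(1)[OF s' u]] p by simp
  moreover have "integrable lborel (\<lambda>x. (\<tau> * u x)\<^sup>2)" by (rule Hs_square_integrable[OF Hs_scale(1)[OF s' u]])
  ultimately show "integrable lborel (\<lambda>x. c1 * ((\<tau> * u x)\<^sup>2 + \<bar>\<tau> * u x\<bar> powr p))"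
    by (intro integrable_mult_right Bochner_Integration.integrable_add)
  have "F (\<tau> * u x) \<le> \<bar>c1 * ((\<tau> * u x)\<^sup>2 + \<bar>\<tau> * u x\<bar> powr p)\<bar>" for x
    using F_bound[of "\<tau> * u x"] by linarith
  then show "AE x in lborel. norm (F (\<tau> * u x)) \<le> norm (c1 * ((\<tau> * u x)\<^sup>2 + \<bar>\<tau> * u x\<bar> powr p))"
    using F_nonneg by (intro AE_I2) (simp only: real_norm_def abs_of_nonneg)
qed measurable

lemma integrable_u_powr: "integrable lborel (\<lambda>x. \<bar>u x\<bar> powr r)"
  by (rule sobolev[OF s' u])

lemma integrable_majorant: "integrable lborel (\<lambda>x. c1 * (T * (u x)\<^sup>2 + T powr (p - 1) * \<bar>u x\<bar> powr p))"
  using Hs_powr_integrable[OF s' u, of p] p Hs_square_integrable[OF u] by simp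

lemma nonlin_deriv:
  assumes K: "admissible K"
  shows "(nonlin K u has_real_derivative nonlin' K u \<tau>) (at \<tau>)"
proof -
  have [measurable]: "K \<in> borel_measurable borel" using K by (simp add: admissible_def)
  let ?T = "\<bar>\<tau>\<bar> + 1"
  show ?thesis
    unfolding nonlin_def[abs_def] nonlin'_def
  proof (rule DERIV_lebesgue_integral[where d = 1 and g' = "\<lambda>x \<tau>. K x * (f (\<tau> * u x) * u x)"])
    show "integrable lborel (\<lambda>x. K x * F (\<tau> * u x))" for \<tau>
      by (rule admissible_integrable[OF K integrable_F])
    show "((\<lambda>\<tau>. K x * F (\<tau> * u x)) has_real_derivative K x * (f (\<tau> * u x) * u x)) (at \<tau>)" for x \<tau>
      by (auto intro!: derivative_eq_intros DERIV_chain2[OF F_deriv])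
    show "integrable lborel (\<lambda>x. K x * (c1 * (?T * (u x)\<^sup>2 + ?T powr (p - 1) * \<bar>u x\<bar> powr p)))"
      by (rule admissible_integrable[OF K integrable_majorant])
    fix x \<tau>' assume "\<bar>\<tau>' - \<tau>\<bar> < 1"
    then have "\<bar>\<tau>'\<bar> \<le> ?T" by linarith
    then have "K x * \<bar>f (\<tau>' * u x) * u x\<bar> \<le> K x * (c1 * (?T * (u x)\<^sup>2 + ?T powr (p - 1) * \<bar>u x\<bar> powr p))"
      using admissible_pos[OF K, of x] by (intro mult_left_mono f_mult_bound) auto
    then show "\<bar>K x * (f (\<tau>' * u x) * u x)\<bar> \<le> K x * (c1 * (?T * (u x)\<^sup>2 + ?T powr (p - 1) * \<bar>u x\<bar> powr p))"
      using admissible_pos[OF K, of x] by (simp only: abs_mult[of "K x"] abs_of_pos)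
  qed measurable
qed

lemma integrable_f:
  assumes K: "admissible K"
  shows "integrable lborel (\<lambda>x. K x * (f (\<tau> * u x) * u x))"
proof -
  have "integrable lborel (\<lambda>x. f (\<tau> * u x) * u x)"
  proof (rule Bochner_Integration.integrable_bound[OF integrable_majorant[of "\<bar>\<tau>\<bar>"]])
    show "AE x in lborel. norm (f (\<tau> * u x) * u x)
      \<le> norm (c1 * (\<bar>\<tau>\<bar> * (u x)\<^sup>2 + \<bar>\<tau>\<bar> powr (p - 1) * \<bar>u x\<bar> powr p))"
      using order_trans[OF f_mult_bound[OF order_refl, of \<tau>] abs_ge_self] by (intro AE_I2) simp
  qed measurable
  then show ?thesis by (rule admissible_integrable[OF K])
qed

text \<open>Reduces the functional to calculus in one variable; the monotonicity demanded by
  \<open>fibering\<close> is \<open>f_ratio_mono\<close> integrated against the positive weight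
  \<open>K\<close>.\<close>

lemma fibering_ray:
  assumes nz: "\<not> (AE x in lborel. u x = 0)" and adm: "admissible V" "admissible K" "admissible Q"
  shows "fibering (kinetic s u + (LINT x|lborel. V x * (u x)\<^sup>2)) (riesz_energy t (\<lambda>x. (u x)\<^sup>2))
      (LINT x|lborel. Q x * \<bar>u x\<bar> powr r) r (nonlin K u) (nonlin' K u)"
proof
  have nz2: "\<not> (AE x in lborel. (u x)\<^sup>2 = 0)" "\<not> (AE x in lborel. \<bar>u x\<bar> powr r = 0)"
    using nz by auto
  show "0 < kinetic s u + (LINT x|lborel. V x * (u x)\<^sup>2)"
    using kinetic_nonneg[of s u] admissible_integral_pos[OF adm(1) Hs_square_integrable[OF u] _ nz2(1)]
      by simp
  show "0 < (LINT x|lborel. Q x * \<bar>u x\<bar> powr r)"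
    using admissible_integral_pos[OF adm(3) integrable_u_powr _ nz2(2)] by simp
  show "0 \<le> riesz_energy t (\<lambda>x. (u x)\<^sup>2)" by (rule riesz_energy_nonneg[OF t]) simp
  show "4 < r" by (rule r)
  show "(nonlin K u has_real_derivative nonlin' K u \<tau>) (at \<tau>)" for \<tau> by (rule nonlin_deriv[OF adm(2)])
  show "nonlin K u 0 = 0" "nonlin' K u 0 = 0" using F_0 f_neg[of 0] by (simp_all add: nonlin_def nonlin'_def)
  show "0 \<le> nonlin K u \<tau>" if "0 \<le> \<tau>" for \<tau>
    unfolding nonlin_def using F_nonneg admissible_pos[OF adm(2)]
    by (intro integral_nonneg_AE AE_I2 mult_nonneg_nonneg) (auto simp: less_imp_le)
  show "0 \<le> nonlin' K u 1"
    unfolding nonlin'_def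
  proof (intro integral_nonneg_AE AE_I2, rule mult_nonneg_nonneg)
    fix x
    show "0 \<le> K x" using admissible_pos[OF adm(2), of x] by simp
    have "0 \<le> f (u x) * u x" using f_pos[of "u x"] f_neg[of "u x"] by (cases "0 < u x") auto
    then show "0 \<le> f (1 * u x) * u x" by simp
  qed
  show "nonlin' K u \<tau> / \<tau> ^ 3 \<le> nonlin' K u \<sigma> / \<sigma> ^ 3" if "0 < \<tau>" "\<tau> \<le> \<sigma>" for \<tau> \<sigma>
  proof -
    have "(LINT x|lborel. K x * (f (\<tau> * u x) * u x) / \<tau> ^ 3)
      \<le> (LINT x|lborel. K x * (f (\<sigma> * u x) * u x) / \<sigma> ^ 3)"
    proof (rule integral_mono)
      fix x
      have "K x * (f (\<tau> * u x) * u x / \<tau> ^ 3) \<le> K x * (f (\<sigma> * u x) * u x / \<sigma> ^ 3)"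
        using admissible_pos[OF adm(2), of x] by (intro mult_left_mono f_ratio_mono that) auto
      then show "K x * (f (\<tau> * u x) * u x) / \<tau> ^ 3 \<le> K x * (f (\<sigma> * u x) * u x) / \<sigma> ^ 3" by simp
    qed (auto intro!: integrable_f[OF adm(2)] integrable_divide)
    then show ?thesis unfolding nonlin'_def by simp
  qed
qed

lemma energy_ray:
  assumes adm: "admissible (\<lambda>x. V (\<epsilon> *\<^sub>R x))" and \<tau>: "0 < \<tau>"
  shows "energy s t f V K Q \<epsilon> (\<lambda>x. \<tau> * u x) = ray (\<lambda>x. V (\<epsilon> *\<^sub>R x)) (\<lambda>x. K (\<epsilon> *\<^sub>R x)) (\<lambda>x. Q (\<epsilon> *\<^sub>R x)) u \<tau>"
proof -
  let ?v = "\<lambda>x. \<tau> * u x"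
  have v: "?v \<in> Hs s" by (rule Hs_scale(1)[OF s' u])
  have "(LINT x|lborel. (cmod (frac_laplacian (s / 2) ?v x))\<^sup>2 + V (\<epsilon> *\<^sub>R x) * (?v x)\<^sup>2)
    = kinetic s ?v + (LINT x|lborel. V (\<epsilon> *\<^sub>R x) * (?v x)\<^sup>2)"
    unfolding kinetic_def
    by (rule Bochner_Integration.integral_add[OF kinetic_gagliardo(1)[OF s' v] admissible_integrable[OF
      adm Hs_square_integrable[OF v]]])
  also have "kinetic s ?v = \<tau>\<^sup>2 * kinetic s u" by (rule Hs_scale(2)[OF s' u])
  also have "(LINT x|lborel. V (\<epsilon> *\<^sub>R x) * (?v x)\<^sup>2) = \<tau>\<^sup>2 * (LINT x|lborel. V (\<epsilon> *\<^sub>R x) * (u x)\<^sup>2)"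
    by (subst integral_mult_right_zero[symmetric]) (simp add: power_mult_distrib mult_ac)
  finally have 1: "(LINT x|lborel. (cmod (frac_laplacian (s / 2) ?v x))\<^sup>2 + V (\<epsilon> *\<^sub>R x) * (?v x)\<^sup>2)
    = \<tau>\<^sup>2 * (kinetic s u + (LINT x|lborel. V (\<epsilon> *\<^sub>R x) * (u x)\<^sup>2))" by (simp add: distrib_left)
  have 2: "(LINT x|lborel. poisson_potential t ?v x * (?v x)\<^sup>2) = \<tau> ^ 4 * riesz_energy t (\<lambda>x. (u x)\<^sup>2)"
    unfolding poisson_energy by (simp only: power_mult_distrib riesz_energy_scale) simp
  have 3: "(LINT x|lborel. Q (\<epsilon> *\<^sub>R x) * \<bar>?v x\<bar> powr r)
    = \<tau> powr r * (LINT x|lborel. Q (\<epsilon> *\<^sub>R x) * \<bar>u x\<bar> powr r)"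
    using \<tau> by (subst integral_mult_right_zero[symmetric]) (simp add: abs_mult powr_mult mult_ac)
  show ?thesis unfolding energy_def ray_def nonlin_def 1 2 3 by simp
qed

end

lemma ray_scale:
  assumes u: "u \<in> Hs s" and \<sigma>: "0 < \<sigma>" and \<tau>: "0 < \<tau>"
  shows "ray V K Q (\<lambda>x. \<sigma> * u x) \<tau> = ray V K Q u (\<sigma> * \<tau>)"
proof -
  have 1: "(LINT x|lborel. V x * (\<sigma> * u x)\<^sup>2) = \<sigma>\<^sup>2 * (LINT x|lborel. V x * (u x)\<^sup>2)"
    by (subst integral_mult_right_zero[symmetric]) (simp add: power_mult_distrib mult_ac)
  have 2: "riesz_energy t (\<lambda>x. (\<sigma> * u x)\<^sup>2) = \<sigma> ^ 4 * riesz_energy t (\<lambda>x. (u x)\<^sup>2)"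
    unfolding power_mult_distrib riesz_energy_scale by simp
  have 3: "(LINT x|lborel. Q x * \<bar>\<sigma> * u x\<bar> powr r) = \<sigma> powr r * (LINT x|lborel. Q x * \<bar>u x\<bar> powr r)"
    using \<sigma> by (subst integral_mult_right_zero[symmetric]) (simp add: abs_mult powr_mult mult_ac)
  have 4: "nonlin K (\<lambda>x. \<sigma> * u x) \<tau> = nonlin K u (\<sigma> * \<tau>)" by (simp add: nonlin_def mult_ac)
  show ?thesis
    unfolding ray_def 1 2 3 4 Hs_scale(2)[OF s' u] using \<sigma> \<tau>
    by (simp add: power_mult_distrib powr_mult algebra_simps)
qed

lemma ray_critical_max:
  assumes u: "u \<in> Hs s" "\<not> (AE x in lborel. u x = 0)" and adm: "admissible V" "admissible K" "admissible Q"
    and \<sigma>: "0 < \<sigma>" and crit: "(ray V K Q u has_real_derivative 0) (at \<sigma>)" and \<tau>: "0 < \<tau>"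
  shows "ray V K Q u \<tau> \<le> ray V K Q u \<sigma>"
proof -
  interpret fibering "kinetic s u + (LINT x|lborel. V x * (u x)\<^sup>2)" "riesz_energy t (\<lambda>x. (u x)\<^sup>2)"
    "LINT x|lborel. Q x * \<bar>u x\<bar> powr r" r "nonlin K u" "nonlin' K u"
    by (rule fibering_ray[OF u adm])
  have "ray V K Q u = h" by (simp add: fun_eq_iff ray_def h_def)
  then show ?thesis using critical_imp_max[OF \<sigma> _ \<tau>] crit by simp
qed

lemma ray_critical_exists:
  assumes u: "u \<in> Hs s" "\<not> (AE x in lborel. u x = 0)" and adm: "admissible V" "admissible K" "admissible Q"
  obtains \<sigma> where "0 < \<sigma>" "(ray V K Q u has_real_derivative 0) (at \<sigma>)" "0 < ray V K Q u \<sigma>"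
proof -
  interpret fibering "kinetic s u + (LINT x|lborel. V x * (u x)\<^sup>2)" "riesz_energy t (\<lambda>x. (u x)\<^sup>2)"
    "LINT x|lborel. Q x * \<bar>u x\<bar> powr r" r "nonlin K u" "nonlin' K u"
    by (rule fibering_ray[OF u adm])
  have "ray V K Q u = h" by (simp add: fun_eq_iff ray_def h_def)
  then show ?thesis using max_exists that by metis
qed

lemma ray_differentiable:
  assumes u: "u \<in> Hs s" "\<not> (AE x in lborel. u x = 0)" and adm: "admissible V" "admissible K" "admissible Q"
    and \<tau>: "0 < \<tau>"
  shows "\<exists>D. (ray V K Q u has_real_derivative D) (at \<tau>)"
proof -
  interpret fibering "kinetic s u + (LINT x|lborel. V x * (u x)\<^sup>2)" "riesz_energy t (\<lambda>x. (u x)\<^sup>2)"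
    "LINT x|lborel. Q x * \<bar>u x\<bar> powr r" r "nonlin K u" "nonlin' K u"
    by (rule fibering_ray[OF u adm])
  have "ray V K Q u = h" by (simp add: fun_eq_iff ray_def h_def)
  then show ?thesis using h_deriv[OF \<tau>] by auto
qed

end

section \<open>Admissible coefficients and bump functions\<close>

lemma admissible_const: "0 < a \<Longrightarrow> admissible (\<lambda>_. a)"
  by (auto simp: admissible_def)

lemma admissible_translate:
  assumes "admissible V" shows "admissible (\<lambda>x. V (x + a))"
proof -
  have [measurable]: "V \<in> borel_measurable borel" using assms by (simp add: admissible_def)
  have "(\<lambda>x. V (x + a)) \<in> borel_measurable borel" by measurable
  then show ?thesis using assms unfolding admissible_def by blast
qed

lemma bump_Hs:
  assumes s: "0 < s" "s < 1" and \<rho>: "0 < \<rho>"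
  shows "(\<lambda>x. max 0 (\<rho> - norm (x - z))) \<in> Hs s"
proof -
  let ?\<phi> = "\<lambda>x::R3. max 0 (\<rho> - norm (x - z))"
  let ?R = "norm z + \<rho>"
  have m[measurable]: "?\<phi> \<in> borel_measurable borel" by measurable
  have supp: "?\<phi> x = 0" if "?R \<le> norm x" for x
    using that norm_triangle_ineq2[of x z] by (simp add: max_def)
  have \<phi>2: "integrable lborel (\<lambda>x. (?\<phi> x)\<^sup>2)"
  proof (rule Bochner_Integration.integrable_bound)
    have "integrable lborel (indicat_real (ball (0::R3) ?R))"
      using emeasure_lborel_ball_finite[of "0::R3" ?R]
        by (intro integrable_real_indicator) (auto simp: less_top)
    then show "integrable lborel (\<lambda>x::R3. \<rho>\<^sup>2 * indicat_real (ball 0 ?R) x)" by simp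
    have "(?\<phi> x)\<^sup>2 \<le> \<rho>\<^sup>2" for x using \<rho> by (intro power_mono) auto
    then show "AE x in lborel. norm ((?\<phi> x)\<^sup>2) \<le> norm (\<rho>\<^sup>2 * indicat_real (ball 0 ?R) x)"
      using supp by (intro AE_I2) (auto simp: indicator_def)
  qed measurable
  have lip: "\<bar>?\<phi> x - ?\<phi> y\<bar> \<le> norm (x - y)" for x y
  proof -
    have "\<bar>norm (x - z) - norm (y - z)\<bar> \<le> norm (x - y)"
      using norm_triangle_ineq3[of "x - z" "y - z"] by simp
    then show ?thesis by linarith
  qed
  have "gagliardo s ?\<phi> < \<infinity>"
    by (rule gagliardo_lipschitz_finite[OF s _ lip supp \<phi>2]) measurable
  then show ?thesis unfolding Hs_iff[OF s] using \<phi>2 by simp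
qed

section \<open>The Nehari set, the ground level and rays\<close>

context schroedinger_poisson
begin

text \<open>The direction of differentiation is \<open>u\<close> itself and
  \<open>u + \<tau> u = (1 + \<tau>) u\<close>, so the Nehari condition only involves the ray of
  \<open>u\<close> at parameter 1.\<close>

lemma nehari_iff:
  assumes adm: "admissible (\<lambda>x. V (\<epsilon> *\<^sub>R x))" "admissible (\<lambda>x. K (\<epsilon> *\<^sub>R x))" "admissible (\<lambda>x. Q (\<epsilon> *\<^sub>R x))"
  shows "u \<in> nehari s t f V K Q \<epsilon> \<longleftrightarrow> u \<in> Hs s \<and> \<not> (AE x in lborel. u x = 0) \<and>
    (ray (\<lambda>x. V (\<epsilon> *\<^sub>R x)) (\<lambda>x. K (\<epsilon> *\<^sub>R x)) (\<lambda>x. Q (\<epsilon> *\<^sub>R x)) u has_real_derivative 0) (at 1)"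
proof -
  let ?ray = "ray (\<lambda>x. V (\<epsilon> *\<^sub>R x)) (\<lambda>x. K (\<epsilon> *\<^sub>R x)) (\<lambda>x. Q (\<epsilon> *\<^sub>R x)) u"
  have "energy_deriv s t f V K Q \<epsilon> u u = 0 \<longleftrightarrow> (?ray has_real_derivative 0) (at 1)"
    if u: "u \<in> Hs s" "\<not> (AE x in lborel. u x = 0)"
  proof -
    obtain D where D: "(?ray has_real_derivative D) (at 1)"
      using ray_differentiable[OF u adm, of 1] by auto
    have "(\<lambda>\<tau>. ?ray (1 + \<tau>)) = (\<lambda>\<tau>. ?ray (\<tau> + 1))" by (simp add: add.commute)
    then have "((\<lambda>\<tau>. ?ray (1 + \<tau>)) has_real_derivative D) (at 0)"
      using D DERIV_shift[of ?ray D 0 1] by simp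
    then have "((\<lambda>\<tau>. energy s t f V K Q \<epsilon> (\<lambda>x. u x + \<tau> * u x)) has_real_derivative D) (at 0)"
    \<comment> \<open>\<open>energy_ray\<close> needs \<open>1 + \<tau>\<close> positive. Since the
      derivative exists, \<open>deriv\<close> in \<open>energy_deriv\<close> is a genuine
      value.\<close>
    proof (rule has_field_derivative_transform_within_open[where S = "{-1<..}"])
      fix \<tau> :: real assume "\<tau> \<in> {-1<..}"
      then have "energy s t f V K Q \<epsilon> (\<lambda>x. (1 + \<tau>) * u x) = ?ray (1 + \<tau>)"
        by (intro energy_ray[OF u(1) adm(1)]) simp
      then show "?ray (1 + \<tau>) = energy s t f V K Q \<epsilon> (\<lambda>x. u x + \<tau> * u x)" by (simp add: distrib_right)
    qed auto
    then have "energy_deriv s t f V K Q \<epsilon> u u = D" unfolding energy_deriv_def by (rule DERIV_imp_deriv)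
    then show ?thesis using D by (metis DERIV_unique)
  qed
  then show ?thesis unfolding nehari_def by auto
qed

text \<open>The critical parameter \<open>\<sigma>\<close> of the ray of \<open>v\<close> puts
  \<open>\<sigma> * v\<close> on the Nehari set.\<close>

lemma ground_level_le_ray:
  assumes adm: "admissible (\<lambda>x. V (\<epsilon> *\<^sub>R x))" "admissible (\<lambda>x. K (\<epsilon> *\<^sub>R x))" "admissible (\<lambda>x. Q (\<epsilon> *\<^sub>R x))"
    and v: "v \<in> Hs s" "\<not> (AE x in lborel. v x = 0)"
  shows "\<exists>\<sigma>>0. ground_level s t f V K Q \<epsilon> \<le> ray (\<lambda>x. V (\<epsilon> *\<^sub>R x)) (\<lambda>x. K (\<epsilon> *\<^sub>R x)) (\<lambda>x. Q (\<epsilon> *\<^sub>R x)) v \<sigma>"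
proof -
  let ?ray = "ray (\<lambda>x. V (\<epsilon> *\<^sub>R x)) (\<lambda>x. K (\<epsilon> *\<^sub>R x)) (\<lambda>x. Q (\<epsilon> *\<^sub>R x))"
  let ?N = "nehari s t f V K Q \<epsilon>" and ?E = "energy s t f V K Q \<epsilon>"
  \<comment> \<open>A real INF bounds its members only if the set is bounded below. On the Nehari
    set the energy is the maximum of its ray, and every ray takes a positive value.\<close>
  have bdd: "bdd_below (?E ` ?N)"
  proof (rule bdd_belowI2)
    fix u assume "u \<in> ?N"
    then have u: "u \<in> Hs s" "\<not> (AE x in lborel. u x = 0)" and crit: "(?ray u has_real_derivative 0) (at 1)"
      unfolding nehari_iff[OF adm] by auto
    obtain \<sigma> where \<sigma>: "0 < \<sigma>" "0 < ?ray u \<sigma>" using ray_critical_exists[OF u adm] by metis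
    have "?ray u \<sigma> \<le> ?ray u 1" by (rule ray_critical_max[OF u adm _ crit \<sigma>(1)]) simp
    also have "\<dots> = ?E u" using energy_ray[OF u(1) adm(1), of 1] by simp
    finally show "0 \<le> ?E u" using \<sigma>(2) by simp
  qed
  obtain \<sigma> where \<sigma>: "0 < \<sigma>" "(?ray v has_real_derivative 0) (at \<sigma>)"
    using ray_critical_exists[OF v adm] by metis
  let ?w = "\<lambda>x. \<sigma> * v x"
  have "?w \<in> ?N"
    unfolding nehari_iff[OF adm]
  proof (intro conjI)
    show "?w \<in> Hs s" by (rule Hs_scale(1)[OF s' v(1)])
    show "\<not> (AE x in lborel. \<sigma> * v x = 0)" using v(2) \<sigma>(1) by simp
    have "((\<lambda>\<tau>. ?ray v (\<sigma> * \<tau>)) has_real_derivative 0 * \<sigma>) (at 1)"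
      by (rule DERIV_chain2[where g = "\<lambda>\<tau>. \<sigma> * \<tau>"]) (use \<sigma>(2) in \<open>auto intro!: derivative_eq_intros\<close>)
    then have "((\<lambda>\<tau>. ?ray v (\<sigma> * \<tau>)) has_real_derivative 0) (at 1)" by simp
    then show "(?ray ?w has_real_derivative 0) (at 1)"
      by (rule has_field_derivative_transform_within_open[where S = "{0<..}"])
         (auto simp: ray_scale[OF v(1) \<sigma>(1)])
  qed
  then have "ground_level s t f V K Q \<epsilon> \<le> ?E ?w"
    unfolding ground_level_def by (rule cINF_lower[OF bdd])
  also have "\<dots> = ?ray v \<sigma>" by (rule energy_ray[OF v(1) adm(1) \<sigma>(1)])
  finally show ?thesis using \<sigma>(1) by blast
qed

text \<open>The critical parameter 1 is a maximum of the ray, and the value there is the ground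
  level.\<close>

lemma ground_state_ray_le:
  assumes adm: "admissible (\<lambda>x. V (\<epsilon> *\<^sub>R x))" "admissible (\<lambda>x. K (\<epsilon> *\<^sub>R x))" "admissible (\<lambda>x. Q (\<epsilon> *\<^sub>R x))"
    and gs: "ground_state_solution s t f V K Q \<epsilon> u"
  shows "u \<in> Hs s" "\<not> (AE x in lborel. u x = 0)"
    "\<And>\<tau>. 0 < \<tau> \<Longrightarrow> ray (\<lambda>x. V (\<epsilon> *\<^sub>R x)) (\<lambda>x. K (\<epsilon> *\<^sub>R x)) (\<lambda>x. Q (\<epsilon> *\<^sub>R x)) u \<tau> \<le> ground_level s t f V K Q \<epsilon>"
proof -
  let ?ray = "ray (\<lambda>x. V (\<epsilon> *\<^sub>R x)) (\<lambda>x. K (\<epsilon> *\<^sub>R x)) (\<lambda>x. Q (\<epsilon> *\<^sub>R x))"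
  show u: "u \<in> Hs s" "\<not> (AE x in lborel. u x = 0)"
    using gs unfolding ground_state_solution_def nehari_iff[OF adm] by auto
  have crit: "(?ray u has_real_derivative 0) (at 1)"
    using gs unfolding ground_state_solution_def nehari_iff[OF adm] by auto
  fix \<tau> :: real assume "0 < \<tau>"
  then have "?ray u \<tau> \<le> ?ray u 1" using ray_critical_max[OF u adm _ crit] by simp
  also have "\<dots> = energy s t f V K Q \<epsilon> u" using energy_ray[OF u(1) adm(1), of 1] by simp
  finally show "?ray u \<tau> \<le> ground_level s t f V K Q \<epsilon>" using gs by (simp add: ground_state_solution_def)
qed

text \<open>\<open>F\<close> is nondecreasing, so the subtracted term does not shrink; the seminorm
  does not grow, and the other terms depend on \<open>\<bar>u\<bar>\<close> only.\<close>

lemma ray_abs_le: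
  assumes u: "u \<in> Hs s" and K: "admissible K" and \<tau>: "0 < \<tau>"
  shows "ray V K Q (\<lambda>x. \<bar>u x\<bar>) \<tau> \<le> ray V K Q u \<tau>"
proof -
  have "nonlin K u \<tau> \<le> nonlin K (\<lambda>x. \<bar>u x\<bar>) \<tau>"
    unfolding nonlin_def
    using admissible_pos[OF K] \<tau>
    by (intro integral_mono admissible_integrable[OF K] integrable_F u Hs_abs(1)[OF s' u] mult_left_mono
      F_mono)
       (auto simp: less_imp_le)
  moreover have "\<tau>\<^sup>2 / 2 * kinetic s (\<lambda>x. \<bar>u x\<bar>) \<le> \<tau>\<^sup>2 / 2 * kinetic s u"
    by (intro mult_left_mono Hs_abs(2)[OF s' u]) simp
  ultimately show ?thesis unfolding ray_def by (simp add: distrib_left)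
qed

lemma ray_translate:
  assumes u: "u \<in> Hs s" and [measurable]: "V \<in> borel_measurable borel" "K \<in> borel_measurable borel" "Q \<in>
    borel_measurable borel"
  shows "ray V K Q (\<lambda>x. u (x - a)) \<tau> = ray (\<lambda>x. V (x + a)) (\<lambda>x. K (x + a)) (\<lambda>x. Q (x + a)) u \<tau>"
proof -
  have [measurable]: "u \<in> borel_measurable borel" by (rule Hs_measurable[OF u])
  have *: "(LINT x|lborel. W x * g (u (x - a))) = (LINT x|lborel. W (x + a) * g (u x))"
    if [measurable]: "W \<in> borel_measurable borel" "g \<in> borel_measurable borel" for W and g :: "real \<Rightarrow> real"
    using integral_translate[of "\<lambda>x. W x * g (u (x - a))" a] by simp
  have "kinetic s (\<lambda>x. u (x - a)) = kinetic s u" using Hs_translate(2)[OF s' u, of "- a"] by simp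
  moreover have "riesz_energy t (\<lambda>x. (u (x - a))\<^sup>2) = riesz_energy t (\<lambda>x. (u x)\<^sup>2)"
    using riesz_energy_translate[of "\<lambda>x. (u x)\<^sup>2" t "- a"] by simp
  moreover have "(LINT x|lborel. V x * (u (x - a))\<^sup>2) = (LINT x|lborel. V (x + a) * (u x)\<^sup>2)"
    by (rule *[where g = "\<lambda>y. y\<^sup>2"]) measurable
  moreover have "(LINT x|lborel. Q x * \<bar>u (x - a)\<bar> powr r) = (LINT x|lborel. Q (x + a) * \<bar>u x\<bar> powr r)"
    by (rule *[where g = "\<lambda>y. \<bar>y\<bar> powr r"]) measurable
  moreover have "nonlin K (\<lambda>x. u (x - a)) \<tau> = nonlin (\<lambda>x. K (x + a)) u \<tau>"
    unfolding nonlin_def by (rule *[where g = "\<lambda>y. F (\<tau> * y)"]) measurable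
  ultimately show ?thesis by (simp add: ray_def)
qed

end

section \<open>Non-attainment of the minimax level\<close>

lemma admissible_integral_tendsto:
  assumes V: "admissible V" and g: "integrable lborel g"
    and lim: "\<And>x. (\<lambda>n. V (x + a n)) \<longlonglongrightarrow> Vi"
  shows "(\<lambda>n. LINT x|lborel. V (x + a n) * g x) \<longlonglongrightarrow> Vi * (LINT x|lborel. g x)"
proof -
  obtain m B where [measurable]: "V \<in> borel_measurable borel" and B: "0 < m" "\<And>x. m \<le> V x" "\<And>x. V x \<le> B"
    using V by (auto simp: admissible_def)
  have [measurable]: "g \<in> borel_measurable borel" using g by auto
  have "(\<lambda>n. LINT x|lborel. V (x + a n) * g x) \<longlonglongrightarrow> (LINT x|lborel. Vi * g x)"
  proof (rule integral_dominated_convergence[where w = "\<lambda>x. \<bar>B * g x\<bar>"])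
    show "integrable lborel (\<lambda>x. \<bar>B * g x\<bar>)" using g by simp
    show "AE x in lborel. (\<lambda>n. V (x + a n) * g x) \<longlonglongrightarrow> Vi * g x"
      by (intro AE_I2 tendsto_mult_right lim)
    show "AE x in lborel. norm (V (x + a n) * g x) \<le> \<bar>B * g x\<bar>" for n
    proof (rule AE_I2)
      fix x
      have "\<bar>V (x + a n)\<bar> \<le> \<bar>B\<bar>" using B(1) B(2,3)[of "x + a n"] by linarith
      then show "norm (V (x + a n) * g x) \<le> \<bar>B * g x\<bar>" by (simp add: abs_mult mult_right_mono)
    qed
  qed measurable
  then show ?thesis by simp
qed

lemma AE_mult_eq_0_of_integral:
  assumes i: "integrable lborel (\<lambda>x. D x * g x :: real)" and D: "\<And>x. 0 \<le> D x" and g: "\<And>x. 0 \<le> g x"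
    and le: "(LINT x|lborel. D x * g x) \<le> 0"
  shows "AE x in lborel. D x = 0 \<or> g x = 0"
proof -
  have nn: "AE x in lborel. 0 \<le> D x * g x" using D g by auto
  have "(LINT x|lborel. D x * g x) = 0" using le integral_nonneg_AE[OF nn] by simp
  then have "AE x in lborel. D x * g x = 0" using integral_nonneg_eq_0_iff_AE[OF i nn] by simp
  then show ?thesis by eventually_elim simp
qed

context schroedinger_poisson
begin

text \<open>The last two assumptions are all that the contradiction uses about the level: every
  nonzero ray reaches \<open>c\<close> somewhere, and the ray of \<open>u\<close> never exceeds
  it.\<close>

context
  fixes V K Q :: "R3 \<Rightarrow> real" and Vi Ki Qi c :: real and a :: "nat \<Rightarrow> R3" and u
  assumes adm: "admissible V" "admissible K" "admissible Q"
    and cont: "continuous_on UNIV V" "continuous_on UNIV K" "continuous_on UNIV Q"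
    and lim: "\<And>x. (\<lambda>n. V (x + a n)) \<longlonglongrightarrow> Vi" "\<And>x. (\<lambda>n. K (x + a n)) \<longlonglongrightarrow> Ki" "\<And>x. (\<lambda>n. Q (x + a n)) \<longlonglongrightarrow> Qi"
    and Vi: "0 < Vi" "\<And>x. Vi \<le> V x" and Ki: "0 < Ki" "\<And>x. K x \<le> Ki" and Qi: "0 < Qi" "\<And>x. Q x \<le> Qi"
    and minimax: "\<And>v. v \<in> Hs s \<Longrightarrow> \<not> (AE x in lborel. v x = 0) \<Longrightarrow> \<exists>\<sigma>>0. c \<le> ray V K Q v \<sigma>"
    and u: "u \<in> Hs s" "\<not> (AE x in lborel. u x = 0)" and ray_u: "\<And>\<tau>. 0 < \<tau> \<Longrightarrow> ray V K Q u \<tau> \<le> c"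
begin

definition w :: "R3 \<Rightarrow> real" where "w x = \<bar>u x\<bar>"

lemma w: "w \<in> Hs s" "\<not> (AE x in lborel. w x = 0)" "0 \<le> w x"
  using Hs_abs(1)[OF s' u(1)] u(2) by (auto simp: w_def[abs_def])

lemma w_measurable[measurable]: "w \<in> borel_measurable borel"
  by (rule Hs_measurable[OF w(1)])

lemma ray_w: "0 < \<tau> \<Longrightarrow> ray V K Q w \<tau> \<le> c"
  using ray_abs_le[OF u(1) adm(2), of \<tau> V Q] ray_u[of \<tau>] by (simp add: w_def[abs_def])

text \<open>Excludes the parameters beyond \<open>T\<close>, where the rays are nonpositive.\<close>

lemma c_pos: "0 < c"
proof -
  obtain \<sigma> where "0 < \<sigma>" "0 < ray V K Q w \<sigma>" using ray_critical_exists[OF w(1,2) adm] by metis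
  then show ?thesis using ray_w[of \<sigma>] by simp
qed

lemma integrable_w: "integrable lborel (\<lambda>x. (w x)\<^sup>2)" "integrable lborel (\<lambda>x. F (\<tau> * w x))"
  "integrable lborel (\<lambda>x. \<bar>w x\<bar> powr r)"
  by (rule Hs_square_integrable[OF w(1)], rule integrable_F[OF w(1)], rule integrable_u_powr[OF w(1)])

lemma nonlin_nonneg:
  assumes "admissible L" shows "0 \<le> nonlin L v \<tau>"
  unfolding nonlin_def using F_nonneg admissible_pos[OF assms]
  by (intro integral_nonneg_AE AE_I2 mult_nonneg_nonneg) (auto simp: less_imp_le)

text \<open>The parameter at which the ray of a translate reaches \<open>c\<close> depends on
  \<open>n\<close>. It is confined to \<open>(0, T)\<close> with \<open>T\<close> independent of
  \<open>n\<close>; there the rays of the translates exceed the limit ray by at most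
  \<open>err n\<close>, and the limit ray is bounded by its maximum.\<close>

lemma c_le_ray_infinity: "\<exists>\<sigma>>0. c \<le> ray (\<lambda>_. Vi) (\<lambda>_. Ki) (\<lambda>_. Qi) w \<sigma>"
proof -
  let ?W2 = "LINT x|lborel. (w x)\<^sup>2" and ?Wr = "LINT x|lborel. \<bar>w x\<bar> powr r"
  let ?R = "riesz_energy t (\<lambda>x. (w x)\<^sup>2)"
  have admi: "admissible (\<lambda>_. Vi)" "admissible (\<lambda>_. Ki)" "admissible (\<lambda>_. Qi)"
    using Vi Ki Qi by (auto intro: admissible_const)
  have meas: "V \<in> borel_measurable borel" "K \<in> borel_measurable borel" "Q \<in> borel_measurable borel"
    using adm by (auto simp: admissible_def)
  obtain \<sigma> where \<sigma>: "0 < \<sigma>" and crit: "(ray (\<lambda>_. Vi) (\<lambda>_. Ki) (\<lambda>_. Qi) w has_real_derivative 0) (at \<sigma>)"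
    using ray_critical_exists[OF w(1,2) admi] by metis
  have max: "ray (\<lambda>_. Vi) (\<lambda>_. Ki) (\<lambda>_. Qi) w \<tau> \<le> ray (\<lambda>_. Vi) (\<lambda>_. Ki) (\<lambda>_. Qi) w \<sigma>" if "0 < \<tau>" for \<tau>
    by (rule ray_critical_max[OF w(1,2) admi \<sigma> crit that])
  have admt: "admissible (\<lambda>x. V (x + a n))" "admissible (\<lambda>x. K (x + a n))" "admissible (\<lambda>x. Q (x
    + a n))" for n
    by (intro admissible_translate adm)+
  define A where "A n = (LINT x|lborel. V (x + a n) * (w x)\<^sup>2)" for n
  define D where "D n = (LINT x|lborel. Q (x + a n) * \<bar>w x\<bar> powr r)" for n
  have A_lim: "A \<longlonglongrightarrow> Vi * ?W2"
    unfolding A_def by (rule admissible_integral_tendsto[OF adm(1) integrable_w(1) lim(1)])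
  have D_lim: "D \<longlonglongrightarrow> Qi * ?Wr"
    unfolding D_def by (rule admissible_integral_tendsto[OF adm(3) integrable_w(3) lim(3)])
  obtain mV BV where BV: "\<And>x. V x \<le> BV" using adm(1) by (auto simp: admissible_def)
  obtain mQ BQ where mQ: "0 < mQ" "\<And>x. mQ \<le> Q x" using adm(3) by (auto simp: admissible_def)
  have wr_nz: "\<not> (AE x in lborel. \<bar>w x\<bar> powr r = 0)" using w(2) by auto
  have Wr: "0 < ?Wr" using admissible_integral_pos[OF admissible_const[of 1] integrable_w(3) _ wr_nz] by simp
  have A_le: "A n \<le> \<bar>BV\<bar> * ?W2" for n
  proof -
    have "A n \<le> (LINT x|lborel. \<bar>BV\<bar> * (w x)\<^sup>2)"
      unfolding A_def using integrable_w(1)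
      by (intro integral_mono admissible_integrable[OF admt(1)] mult_right_mono integrable_mult_right
        order_trans[OF BV]) auto
    then show ?thesis by simp
  qed
  have D_ge: "mQ * ?Wr \<le> D n" for n
  proof -
    have "(LINT x|lborel. mQ * \<bar>w x\<bar> powr r) \<le> D n"
      unfolding D_def using integrable_w(3) mQ(2)
      by (intro integral_mono admissible_integrable[OF admt(3)] mult_right_mono integrable_mult_right) auto
    then show ?thesis by simp
  qed
  have "0 \<le> ?R" by (rule riesz_energy_nonneg[OF t]) simp
  moreover have "0 \<le> kinetic s w + \<bar>BV\<bar> * ?W2"
    by (intro add_nonneg_nonneg kinetic_nonneg mult_nonneg_nonneg integral_nonneg_AE) auto
  \<comment> \<open>The bounds \<open>A_le\<close> and \<open>D_ge\<close> hold for all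
    \<open>n\<close>, which makes this \<open>T\<close> uniform.\<close>
  ultimately obtain T where T: "1 \<le> T" "\<And>\<tau>. T \<le> \<tau> \<Longrightarrow>
      \<tau>\<^sup>2 / 2 * (kinetic s w + \<bar>BV\<bar> * ?W2) + \<tau> ^ 4 / 4 * ?R - \<tau> powr r / r * (mQ * ?Wr) \<le> 0"
    using ray_eventually_nonpos[of "kinetic s w + \<bar>BV\<bar> * ?W2" ?R "mQ * ?Wr" r] mQ(1) Wr r by auto
  define E where "E n = (LINT x|lborel. K (x + a n) * F (T * w x))" for n
  have E_lim: "E \<longlonglongrightarrow> Ki * (LINT x|lborel. F (T * w x))"
    unfolding E_def by (rule admissible_integral_tendsto[OF adm(2) integrable_w(2) lim(2)])
  \<comment> \<open>Bounds the difference of the two rays for every \<open>\<tau>\<close> up to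
    \<open>T\<close>. The middle term carries no absolute value: \<open>Ki - K\<close> is
    nonnegative and \<open>F\<close> is nondecreasing, so the parameter \<open>T\<close> is the
    worst case.\<close>
  define err where "err n = T\<^sup>2 / 2 * \<bar>A n - Vi * ?W2\<bar> + (Ki * (LINT x|lborel. F (T * w x)) - E n)
    + T powr r / r * \<bar>D n - Qi * ?Wr\<bar>" for n
  have "err \<longlonglongrightarrow> T\<^sup>2 / 2 * \<bar>Vi * ?W2 - Vi * ?W2\<bar>
    + (Ki * (LINT x|lborel. F (T * w x)) - Ki * (LINT x|lborel. F (T * w x)))
      + T powr r / r * \<bar>Qi * ?Wr - Qi * ?Wr\<bar>"
    unfolding err_def by (intro tendsto_intros A_lim D_lim E_lim)
  then have err: "err \<longlonglongrightarrow> 0" by simp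
  have "c \<le> ray (\<lambda>_. Vi) (\<lambda>_. Ki) (\<lambda>_. Qi) w \<sigma> + err n" for n
  proof -
    let ?v = "\<lambda>x. w (x - a n)"
    have v: "?v \<in> Hs s" using Hs_translate(1)[OF s' w(1), of "- a n"] by simp
    have "\<not> (AE x in lborel. ?v x = 0)"
    proof
      assume "AE x in lborel. ?v x = 0"
      from AE_translate[OF this, of "a n"] show False using w(2) by simp
    qed
    then obtain \<tau> where \<tau>: "0 < \<tau>" "c \<le> ray V K Q ?v \<tau>" using minimax[OF v] by blast
    then have c_le: "c \<le> \<tau>\<^sup>2 / 2 * (kinetic s w + A n) + \<tau> ^ 4 / 4 * ?R - nonlin (\<lambda>x. K (x + a n)) w \<tau>
      - \<tau> powr r / r * D n"
      unfolding ray_translate[OF w(1) meas] by (simp add: ray_def A_def D_def)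
    have \<tau>T: "\<tau> < T"
    proof (rule ccontr)
      assume "\<not> \<tau> < T"
      then have neg: "\<tau>\<^sup>2 / 2 * (kinetic s w + \<bar>BV\<bar> * ?W2) + \<tau> ^ 4 / 4 * ?R - \<tau> powr r / r * (mQ * ?Wr) \<le> 0"
        by (intro T(2)) simp
      have "\<tau>\<^sup>2 / 2 * (kinetic s w + A n) \<le> \<tau>\<^sup>2 / 2 * (kinetic s w + \<bar>BV\<bar> * ?W2)"
        using A_le[of n] by (intro mult_left_mono) auto
      moreover have "\<tau> powr r / r * (mQ * ?Wr) \<le> \<tau> powr r / r * D n"
        using D_ge[of n] r by (intro mult_left_mono) auto
      ultimately show False using c_le neg nonlin_nonneg[OF admt(2), of n w \<tau>] c_pos by linarith
    qed
    have "\<tau>\<^sup>2 / 2 * A n \<le> \<tau>\<^sup>2 / 2 * (Vi * ?W2) + T\<^sup>2 / 2 * \<bar>A n - Vi * ?W2\<bar>"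
    proof -
      have "\<tau>\<^sup>2 \<le> T\<^sup>2" using \<tau> \<tau>T by (intro power_mono) auto
      then have "\<tau>\<^sup>2 / 2 * \<bar>A n - Vi * ?W2\<bar> \<le> T\<^sup>2 / 2 * \<bar>A n - Vi * ?W2\<bar>" by (intro mult_right_mono) auto
      moreover have "\<tau>\<^sup>2 / 2 * (A n - Vi * ?W2) \<le> \<tau>\<^sup>2 / 2 * \<bar>A n - Vi * ?W2\<bar>" by (intro mult_left_mono) auto
      ultimately show ?thesis by (simp add: right_diff_distrib)
    qed
    moreover have "- (\<tau> powr r / r * D n) \<le> - (\<tau> powr r / r * (Qi * ?Wr)) + T powr r / r * \<bar>D n - Qi * ?Wr\<bar>"
    proof -
      have "\<tau> powr r \<le> T powr r" using \<tau> \<tau>T r by (intro powr_mono2) auto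
      then have "\<tau> powr r / r * \<bar>D n - Qi * ?Wr\<bar> \<le> T powr r / r * \<bar>D n - Qi * ?Wr\<bar>"
        using r by (intro mult_right_mono divide_right_mono) auto
      moreover have "\<tau> powr r / r * (Qi * ?Wr - D n) \<le> \<tau> powr r / r * \<bar>D n - Qi * ?Wr\<bar>"
        using r by (intro mult_left_mono) auto
      ultimately show ?thesis by (simp add: right_diff_distrib)
    qed
    moreover have "nonlin (\<lambda>_. Ki) w \<tau> - nonlin (\<lambda>x. K (x + a n)) w \<tau>
      \<le> Ki * (LINT x|lborel. F (T * w x)) - E n"
    proof -
      have i: "integrable lborel (\<lambda>x. (Ki - K (x + a n)) * F (\<tau> * w x))" for \<tau>
        using admissible_integrable[OF admi(2) integrable_w(2), of \<tau>] admissible_integrable[OF admt(2)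
          integrable_w(2), of n \<tau>]
        by (simp add: left_diff_distrib)
      have eq: "nonlin (\<lambda>_. Ki) w \<tau> - nonlin (\<lambda>x. K (x + a n)) w \<tau>
        = (LINT x|lborel. (Ki - K (x + a n)) * F (\<tau> * w x))" for \<tau>
        unfolding nonlin_def left_diff_distrib
        by (rule Bochner_Integration.integral_diff[symmetric])
           (rule admissible_integrable[OF admi(2) integrable_w(2)], rule admissible_integrable[OF admt(2)
             integrable_w(2)])
      have "(LINT x|lborel. (Ki - K (x + a n)) * F (\<tau> * w x))
        \<le> (LINT x|lborel. (Ki - K (x + a n)) * F (T * w x))"
        using Ki(2) \<tau>T w(3) by (intro integral_mono i mult_left_mono F_mono mult_right_mono) auto
      then show ?thesis unfolding eq[symmetric] by (simp add: nonlin_def E_def)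
    qed
    ultimately have "c \<le> ray (\<lambda>_. Vi) (\<lambda>_. Ki) (\<lambda>_. Qi) w \<tau> + err n"
      using c_le unfolding ray_def err_def by (simp add: distrib_left)
    then show ?thesis using max[OF \<tau>(1)] by simp
  qed
  moreover have "(\<lambda>n. ray (\<lambda>_. Vi) (\<lambda>_. Ki) (\<lambda>_. Qi) w \<sigma> + err n) \<longlonglongrightarrow> ray (\<lambda>_. Vi) (\<lambda>_. Ki) (\<lambda>_. Qi) w \<sigma> + 0"
    by (intro tendsto_intros err)
  ultimately have "c \<le> ray (\<lambda>_. Vi) (\<lambda>_. Ki) (\<lambda>_. Qi) w \<sigma>"
    by (intro LIMSEQ_le_const) auto
  then show ?thesis using \<sigma> by blast
qed

text \<open>The two rays are compared at a single parameter \<open>\<sigma>\<close>, where the one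
  with the constant coefficients reaches \<open>c\<close>.\<close>

lemma w_vanishes: "AE x in lborel. Vi < V x \<or> K x < Ki \<or> Q x < Qi \<longrightarrow> w x = 0"
proof -
  obtain \<sigma> where \<sigma>: "0 < \<sigma>" "c \<le> ray (\<lambda>_. Vi) (\<lambda>_. Ki) (\<lambda>_. Qi) w \<sigma>" using c_le_ray_infinity by blast
  have admi: "admissible (\<lambda>_. Vi)" "admissible (\<lambda>_. Ki)" "admissible (\<lambda>_. Qi)"
    using Vi Ki Qi by (auto intro: admissible_const)
  have iV: "integrable lborel (\<lambda>x. (V x - Vi) * (w x)\<^sup>2)"
    using admissible_integrable[OF adm(1) integrable_w(1)] integrable_w(1) by (simp add: left_diff_distrib)
  have iK: "integrable lborel (\<lambda>x. (Ki - K x) * F (\<sigma> * w x))"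
    using admissible_integrable[OF adm(2) integrable_w(2)] integrable_w(2) by (simp add: left_diff_distrib)
  have iQ: "integrable lborel (\<lambda>x. (Qi - Q x) * \<bar>w x\<bar> powr r)"
    using admissible_integrable[OF adm(3) integrable_w(3)] integrable_w(3) by (simp add: left_diff_distrib)
  let ?IV = "LINT x|lborel. (V x - Vi) * (w x)\<^sup>2"
  let ?IK = "LINT x|lborel. (Ki - K x) * F (\<sigma> * w x)"
  let ?IQ = "LINT x|lborel. (Qi - Q x) * \<bar>w x\<bar> powr r"
  have V: "(LINT x|lborel. V x * (w x)\<^sup>2) - (LINT x|lborel. Vi * (w x)\<^sup>2) = ?IV"
    unfolding left_diff_distrib
    by (rule Bochner_Integration.integral_diff[symmetric]) (rule admissible_integrable[OF adm(1)
      integrable_w(1)], rule admissible_integrable[OF admi(1) integrable_w(1)])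
  have K: "nonlin (\<lambda>_. Ki) w \<sigma> - nonlin K w \<sigma> = ?IK"
    unfolding left_diff_distrib nonlin_def
    by (rule Bochner_Integration.integral_diff[symmetric]) (rule admissible_integrable[OF admi(2)
      integrable_w(2)], rule admissible_integrable[OF adm(2) integrable_w(2)])
  have Q: "(LINT x|lborel. Qi * \<bar>w x\<bar> powr r) - (LINT x|lborel. Q x * \<bar>w x\<bar> powr r) = ?IQ"
    unfolding left_diff_distrib
    by (rule Bochner_Integration.integral_diff[symmetric]) (rule admissible_integrable[OF admi(3)
      integrable_w(3)], rule admissible_integrable[OF adm(3) integrable_w(3)])
  have "ray V K Q w \<sigma> - ray (\<lambda>_. Vi) (\<lambda>_. Ki) (\<lambda>_. Qi) w \<sigma> = \<sigma>\<^sup>2 / 2 * ?IV + ?IK + \<sigma> powr r / r * ?IQ"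
    unfolding V[symmetric] K[symmetric] Q[symmetric] ray_def by (simp add: distrib_left right_diff_distrib)
  \<comment> \<open>The first ray is at most \<open>c\<close> by \<open>ray_w\<close> and the second
    at least \<open>c\<close>; as the three integrals are nonnegative, each of them
    vanishes.\<close>
  then have le: "\<sigma>\<^sup>2 / 2 * ?IV + ?IK + \<sigma> powr r / r * ?IQ \<le> 0" using \<sigma> ray_w[of \<sigma>] by simp
  have nn: "0 \<le> ?IV" "0 \<le> ?IK" "0 \<le> ?IQ"
    using Vi(2) Ki(2) Qi(2) F_nonneg by (auto intro!: integral_nonneg_AE mult_nonneg_nonneg)
  have sc: "0 < \<sigma>\<^sup>2 / 2" "0 < \<sigma> powr r / r" using \<sigma> r by auto
  have p: "0 \<le> \<sigma>\<^sup>2 / 2 * ?IV" "0 \<le> \<sigma> powr r / r * ?IQ"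
    by (rule mult_nonneg_nonneg[OF less_imp_le[OF sc(1)] nn(1)], rule mult_nonneg_nonneg[OF less_imp_le[OF
      sc(2)] nn(3)])
  have zV: "\<sigma>\<^sup>2 / 2 * ?IV \<le> 0" and zK: "?IK \<le> 0" and zQ: "\<sigma> powr r / r * ?IQ \<le> 0" using le nn p by linarith+
  have zV: "?IV \<le> 0" using zV sc(1) by (simp add: mult_le_0_iff)
  have zQ: "?IQ \<le> 0" using zQ sc(2) by (meson mult_pos_pos not_le)
  have "AE x in lborel. V x - Vi = 0 \<or> (w x)\<^sup>2 = 0"
    by (rule AE_mult_eq_0_of_integral[OF iV _ _ zV]) (use Vi(2) in auto)
  moreover have "AE x in lborel. Ki - K x = 0 \<or> F (\<sigma> * w x) = 0"
    by (rule AE_mult_eq_0_of_integral[OF iK _ _ zK]) (use Ki(2) F_nonneg in auto)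
  moreover have "AE x in lborel. Qi - Q x = 0 \<or> \<bar>w x\<bar> powr r = 0"
    by (rule AE_mult_eq_0_of_integral[OF iQ _ _ zQ]) (use Qi(2) in auto)
  ultimately show ?thesis
  proof eventually_elim
    case (elim x)
    have "w x = 0" if "F (\<sigma> * w x) = 0"
    proof (rule ccontr)
      assume "w x \<noteq> 0"
      then have "0 < \<sigma> * w x" using \<sigma>(1) w(3)[of x] by (simp add: order_less_le)
      then show False using F_pos that by fastforce
    qed
    then show ?case using elim by auto
  qed
qed

text \<open>Adding a bump supported where \<open>w\<close> vanishes changes the energy by \<open>O(\<delta>\<^sup>2)\<close> except for the
  interaction in the Gagliardo seminorm, which is negative of order \<open>\<delta>\<close>; this replaces the strong
  maximum principle.\<close>

lemma no_strict_point:
  assumes strict: "Vi < V z \<or> K z < Ki \<or> Q z < Qi"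
  shows False
proof -
  let ?\<Omega> = "{x. Vi < V x} \<union> {x. K x < Ki} \<union> {x. Q x < Qi}"
  have "open ?\<Omega>"
    using cont by (intro open_Un open_Collect_less continuous_on_const) auto
  moreover have "z \<in> ?\<Omega>" using strict by auto
  ultimately obtain \<rho> where \<rho>: "0 < \<rho>" "ball z \<rho> \<subseteq> ?\<Omega>" by (meson open_contains_ball)
  define \<phi> where "\<phi> x = max 0 (\<rho> - norm (x - z))" for x
  have \<phi>: "\<phi> \<in> Hs s" unfolding \<phi>_def[abs_def] by (rule bump_Hs[OF s' \<rho>(1)])
  have [measurable]: "\<phi> \<in> borel_measurable borel" by (rule Hs_measurable[OF \<phi>])
  have [measurable]: "V \<in> borel_measurable borel" using adm(1) by (simp add: admissible_def)
  have \<phi>0: "0 \<le> \<phi> x" for x by (simp add: \<phi>_def)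
  have \<phi>_pos: "0 < \<phi> x" if "x \<in> ball z \<rho>" for x
    using that by (simp add: \<phi>_def dist_norm norm_minus_commute)
  have disj: "AE x in lborel. w x * \<phi> x = 0"
    using w_vanishes
  proof eventually_elim
    case (elim x)
    show ?case
    proof (cases "x \<in> ball z \<rho>")
      case True
      then have "x \<in> ?\<Omega>" using \<rho>(2) by blast
      then show ?thesis using elim by auto
    next
      case False
      then have "\<phi> x = 0" by (simp add: \<phi>_def dist_norm norm_minus_commute)
      then show ?thesis by simp
    qed
  qed
  obtain C where C: "0 < C" and vHs: "\<And>\<delta>. 0 \<le> \<delta> \<Longrightarrow> (\<lambda>x. w x + \<delta> * \<phi> x) \<in> Hs s"
    and kin: "\<And>\<delta>. 0 \<le> \<delta> \<Longrightarrow> kinetic s (\<lambda>x. w x + \<delta> * \<phi> x) = kinetic s w - C * \<delta> + \<delta>\<^sup>2 * kinetic s \<phi>"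
    by (rule kinetic_add_disjoint[where z
      = z, OF s' w(1) \<phi> w(3) \<phi>0 disj w(2) \<rho>(1) \<phi>_pos], assumption) (rule that)
  let ?R = "riesz_energy t (\<lambda>x. (w x)\<^sup>2)"
  \<comment> \<open>The coefficient of \<open>\<delta>^2\<close> from
    \<open>riesz_energy_convex\<close>; the absolute value makes its sign evident.\<close>
  define R1 where "R1 = \<bar>riesz_energy t (\<lambda>x. (w x)\<^sup>2 + (\<phi> x)\<^sup>2) - ?R\<bar>"
  define P where "P = (LINT x|lborel. V x * (\<phi> x)\<^sup>2)"
  define W2 where "W2 = (LINT x|lborel. V x * (w x)\<^sup>2)"
  define D where "D = (LINT x|lborel. Q x * \<bar>w x\<bar> powr r)"
  have wr_nz: "\<not> (AE x in lborel. \<bar>w x\<bar> powr r = 0)" using w(2) by auto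
  have D: "0 < D" unfolding D_def by (rule admissible_integral_pos[OF adm(3) integrable_w(3) _ wr_nz]) simp
  have nn: "0 \<le> P" "0 \<le> W2" "0 \<le> ?R" "0 \<le> R1" "0 \<le> kinetic s \<phi>" "0 \<le> kinetic s w"
    unfolding P_def W2_def R1_def using admissible_pos[OF adm(1)]
    by (auto intro!: integral_nonneg_AE mult_nonneg_nonneg riesz_energy_nonneg t kinetic_nonneg simp:
      less_imp_le)
  \<comment> \<open>The bump is counted in full, as for \<open>\<delta> = 1\<close>, and the gain
    \<open>C * \<delta>\<close> is ignored. So \<open>T\<close> serves all
    \<open>\<delta> \<le> 1\<close> and can be fixed before \<open>\<delta>\<close>, whose choice
    depends on \<open>T\<close> through \<open>S\<close>.\<close>
  obtain T where T: "1 \<le> T" "\<And>\<tau>. T \<le> \<tau> \<Longrightarrow>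
      \<tau>\<^sup>2 / 2 * (kinetic s w + kinetic s \<phi> + W2 + P) + \<tau> ^ 4 / 4 * (?R + R1) - \<tau> powr r / r * D \<le> 0"
    using ray_eventually_nonpos[of "kinetic s w + kinetic s \<phi> + W2 + P" "?R + R1" D r] nn D r by auto
  \<comment> \<open>All second-order contributions, with \<open>\<tau>^2 / 2\<close> taken out as a
    common factor; in the quartic Coulomb term the other \<open>\<tau>^2\<close> is bounded by
    \<open>T^2\<close>.\<close>
  define S where "S = kinetic s \<phi> + P + T\<^sup>2 / 2 * R1"
  have S: "0 \<le> S" using nn by (simp add: S_def)
  define \<delta> where "\<delta> = min 1 (C / (2 * (S + 1)))"
  have \<delta>: "0 < \<delta>" "\<delta> \<le> 1" using C S by (auto simp: \<delta>_def)
  have \<delta>S: "\<delta> * S < C"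
  proof -
    have "\<delta> * S \<le> C / (2 * (S + 1)) * S" using S by (intro mult_right_mono) (auto simp: \<delta>_def)
    also have "\<dots> = C * (S / (2 * (S + 1)))" by simp
    also have "\<dots> < C * 1" using C S by (intro mult_strict_left_mono) auto
    also have "\<dots> = C" by simp
    finally show ?thesis .
  qed
  have \<delta>2: "\<delta>\<^sup>2 \<le> 1" "0 \<le> \<delta>\<^sup>2" using \<delta> by (auto simp: power_le_one)
  let ?v = "\<lambda>x. w x + \<delta> * \<phi> x"
  have v: "?v \<in> Hs s" using \<delta> by (intro vHs) simp
  have vm[measurable]: "?v \<in> borel_measurable borel" by measurable
  have v_ge: "w x \<le> ?v x" for x using \<phi>0[of x] \<delta> by simp
  have vnz: "\<not> (AE x in lborel. ?v x = 0)"
  proof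
    assume "AE x in lborel. ?v x = 0"
    then have "AE x in lborel. w x = 0"
      by eventually_elim (use v_ge w(3) in \<open>metis order_antisym\<close>)
    then show False using w(2) by simp
  qed
  obtain \<tau> where \<tau>: "0 < \<tau>" "c \<le> ray V K Q ?v \<tau>" using minimax[OF v vnz] by blast
  have sq: "AE x in lborel. (?v x)\<^sup>2 = (w x)\<^sup>2 + \<delta>\<^sup>2 * (\<phi> x)\<^sup>2"
    using disj by eventually_elim (auto simp: power2_sum power_mult_distrib)
  have \<phi>2: "integrable lborel (\<lambda>x. (\<phi> x)\<^sup>2)" by (rule Hs_square_integrable[OF \<phi>])
  have fourth: "integrable lborel (\<lambda>x. ((g x)\<^sup>2)\<^sup>2)" if "g \<in> Hs s" for g
  proof -
    have "((g x)\<^sup>2)\<^sup>2 = \<bar>g x\<bar> powr 4" for x by simp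
    then show ?thesis using Hs_powr_integrable[OF s' that, of 4] r by simp
  qed
  have pot: "(LINT x|lborel. V x * (?v x)\<^sup>2) = W2 + \<delta>\<^sup>2 * P"
  proof -
    have ae: "AE x in lborel. V x * (?v x)\<^sup>2 = V x * (w x)\<^sup>2 + \<delta>\<^sup>2 * (V x * (\<phi> x)\<^sup>2)"
      using sq by eventually_elim (simp add: algebra_simps)
    have "(LINT x|lborel. V x * (?v x)\<^sup>2) = (LINT x|lborel. V x * (w x)\<^sup>2 + \<delta>\<^sup>2 * (V x * (\<phi> x)\<^sup>2))"
      by (rule integral_cong_AE[OF _ _ ae]) measurable
    also have "\<dots> = W2 + \<delta>\<^sup>2 * P"
      unfolding W2_def P_def
      using admissible_integrable[OF adm(1) integrable_w(1)] admissible_integrable[OF adm(1) \<phi>2] by simp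
    finally show ?thesis .
  qed
  have rie: "riesz_energy t (\<lambda>x. (?v x)\<^sup>2) \<le> ?R + \<delta>\<^sup>2 * R1"
  proof -
    have "riesz_energy t (\<lambda>x. (?v x)\<^sup>2) = riesz_energy t (\<lambda>x. (w x)\<^sup>2 + \<delta>\<^sup>2 * (\<phi> x)\<^sup>2)"
      by (rule riesz_energy_cong_AE[OF _ _ sq]) measurable
    also have "\<dots> \<le> ?R + \<delta>\<^sup>2 * (riesz_energy t (\<lambda>x. (w x)\<^sup>2 + (\<phi> x)\<^sup>2) - ?R)"
      by (rule riesz_energy_convex[OF t]) (use integrable_w(1) \<phi>2 fourth[OF w(1)] fourth[OF \<phi>] \<delta>2 in auto)
    also have "\<dots> \<le> ?R + \<delta>\<^sup>2 * R1" unfolding R1_def using \<delta>2 by (intro add_left_mono mult_left_mono) auto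
    finally show ?thesis .
  qed
  \<comment> \<open>This and \<open>crit\<close> concern terms that enter with a minus sign, so
    \<open>w \<le> ?v\<close> and monotonicity replace an expansion in
    \<open>\<delta>\<close>.\<close>
  have non: "nonlin K w \<tau> \<le> nonlin K ?v \<tau>"
    unfolding nonlin_def using admissible_pos[OF adm(2)] \<tau> v_ge
    by (intro integral_mono admissible_integrable[OF adm(2)] integrable_F w(1) v mult_left_mono F_mono)
       (auto simp: less_imp_le)
  have crit: "D \<le> (LINT x|lborel. Q x * \<bar>?v x\<bar> powr r)"
    unfolding D_def
  proof (intro integral_mono admissible_integrable[OF adm(3)] integrable_u_powr w(1) v mult_left_mono
    powr_mono2)
    fix x
    show "\<bar>w x\<bar> \<le> \<bar>?v x\<bar>" using v_ge[of x] w(3)[of x] by linarith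
    show "0 \<le> Q x" using admissible_pos[OF adm(3), of x] by simp
  qed (use r in auto)
  have kinv: "kinetic s ?v = kinetic s w - C * \<delta> + \<delta>\<^sup>2 * kinetic s \<phi>" using \<delta> by (intro kin) simp
  have "\<tau> powr r / r * D \<le> \<tau> powr r / r * (LINT x|lborel. Q x * \<bar>?v x\<bar> powr r)"
    using crit r by (intro mult_left_mono) auto
  moreover have "\<tau> ^ 4 / 4 * riesz_energy t (\<lambda>x. (?v x)\<^sup>2) \<le> \<tau> ^ 4 / 4 * (?R + \<delta>\<^sup>2 * R1)"
    using rie by (intro mult_left_mono) auto
  ultimately have c_le: "c \<le> \<tau>\<^sup>2 / 2 * (kinetic s w - C * \<delta> + \<delta>\<^sup>2 * kinetic s \<phi> + (W2 + \<delta>\<^sup>2 * P))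
      + \<tau> ^ 4 / 4 * (?R + \<delta>\<^sup>2 * R1) - nonlin K w \<tau> - \<tau> powr r / r * D"
    using \<tau>(2) non unfolding ray_def pot kinv by linarith
  have \<tau>T: "\<tau> < T"
  proof (rule ccontr)
    assume "\<not> \<tau> < T"
    then have neg: "\<tau>\<^sup>2 / 2 * (kinetic s w + kinetic s \<phi> + W2 + P) + \<tau> ^ 4 / 4 * (?R + R1) - \<tau> powr r / r
      * D \<le> 0"
      by (intro T(2)) simp
    have "\<delta>\<^sup>2 * kinetic s \<phi> \<le> kinetic s \<phi>" "\<delta>\<^sup>2 * P \<le> P" "\<delta>\<^sup>2 * R1 \<le> R1" "0 \<le> C * \<delta>"
      using nn \<delta>2 C \<delta> by (auto intro: mult_left_le_one_le)
    then have "\<tau>\<^sup>2 / 2 * (kinetic s w - C * \<delta> + \<delta>\<^sup>2 * kinetic s \<phi> + (W2 + \<delta>\<^sup>2 * P))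
      \<le> \<tau>\<^sup>2 / 2 * (kinetic s w + kinetic s \<phi> + W2 + P)"
      "\<tau> ^ 4 / 4 * (?R + \<delta>\<^sup>2 * R1) \<le> \<tau> ^ 4 / 4 * (?R + R1)"
      by (intro mult_left_mono; simp)+
    then show False using c_le neg nonlin_nonneg[OF adm(2), of w \<tau>] c_pos by linarith
  qed
  have "c \<le> ray V K Q w \<tau> + (\<tau>\<^sup>2 / 2 * (- C * \<delta> + \<delta>\<^sup>2 * (kinetic s \<phi> + P)) + \<tau> ^ 4 / 4 * (\<delta>\<^sup>2 * R1))"
    using c_le unfolding ray_def W2_def D_def by (simp add: algebra_simps)
  also have "\<dots> \<le> c + (\<tau>\<^sup>2 / 2 * (- C * \<delta> + \<delta>\<^sup>2 * (kinetic s \<phi> + P)) + \<tau>\<^sup>2 / 2 * (\<delta>\<^sup>2 * (T\<^sup>2 / 2 * R1)))"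
  proof -
    have "\<tau>\<^sup>2 \<le> T\<^sup>2" using \<tau> \<tau>T by (intro power_mono) auto
    then have "\<tau>\<^sup>2 * \<tau>\<^sup>2 * (\<delta>\<^sup>2 * R1) \<le> \<tau>\<^sup>2 * T\<^sup>2 * (\<delta>\<^sup>2 * R1)"
      using nn \<delta>2 by (intro mult_right_mono mult_left_mono) auto
    then have "\<tau> ^ 4 / 4 * (\<delta>\<^sup>2 * R1) \<le> \<tau>\<^sup>2 / 2 * (\<delta>\<^sup>2 * (T\<^sup>2 / 2 * R1))"
      by (simp add: power4_eq_xxxx power2_eq_square mult_ac)
    then show ?thesis using ray_w[OF \<tau>(1)] by linarith
  qed
  \<comment> \<open>Because \<open>\<tau>^2 / 2\<close> factors out of gain and loss alike, the sign
    does not depend on the unknown \<open>\<tau>\<close>, which may be arbitrarily small.\<close>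
  also have "\<dots> = c + \<tau>\<^sup>2 / 2 * \<delta> * (\<delta> * S - C)"
    by (simp add: S_def power2_eq_square algebra_simps)
  also have "\<dots> < c"
    using \<tau>(1) \<delta>(1) \<delta>S by (simp add: mult_pos_neg)
  finally show False by simp
qed

end

end

text \<open>Outside a large ball the positive limit gives both bounds, inside it compactness
  does.\<close>

lemma admissible_rescaled:
  fixes V :: "R3 \<Rightarrow> real"
  assumes cont: "continuous_on UNIV V" and pos: "\<And>x. 0 < V x" and lim: "(V \<longlongrightarrow> L) at_infinity" and L: "0 < L"
  shows "admissible (\<lambda>x. V (\<epsilon> *\<^sub>R x))"
proof -
  have "eventually (\<lambda>x. L / 2 < V x \<and> V x < L + 1) at_infinity"
    by (intro eventually_conj order_tendstoD[OF lim]) (use L in simp_all)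
  then obtain R where R: "\<And>x. R \<le> norm x \<Longrightarrow> L / 2 < V x \<and> V x < L + 1"
    unfolding eventually_at_infinity by blast
  have ne: "cball (0::R3) \<bar>R\<bar> \<noteq> {}" by simp
  have c: "continuous_on (cball 0 \<bar>R\<bar>) V" by (rule continuous_on_subset[OF cont]) simp
  obtain x1 where x1: "\<And>x. x \<in> cball 0 \<bar>R\<bar> \<Longrightarrow> V x1 \<le> V x"
    using continuous_attains_inf[OF compact_cball ne c] by blast
  obtain x2 where x2: "\<And>x. x \<in> cball 0 \<bar>R\<bar> \<Longrightarrow> V x \<le> V x2"
    using continuous_attains_sup[OF compact_cball ne c] by blast
  have bounds: "min (V x1) (L / 2) \<le> V x \<and> V x \<le> max (V x2) (L + 1)" for x
  proof (cases "norm x \<le> \<bar>R\<bar>")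
    case True
    then show ?thesis using x1[of x] x2[of x] by auto
  next
    case False
    then have "R \<le> norm x" by simp
    then show ?thesis using R[of x] by auto
  qed
  have [measurable]: "V \<in> borel_measurable borel" by (rule borel_measurable_continuous_onI[OF cont])
  have "(\<lambda>x. V (\<epsilon> *\<^sub>R x)) \<in> borel_measurable borel" by measurable
  moreover have "0 < min (V x1) (L / 2)" using pos L by simp
  ultimately show ?thesis unfolding admissible_def using bounds by blast
qed

lemma filterlim_rescaled_translates:
  fixes e :: R3
  assumes \<epsilon>: "0 < \<epsilon>" and e: "norm e = 1"
  shows "filterlim (\<lambda>n. \<epsilon> *\<^sub>R (x + real n *\<^sub>R e)) at_infinity sequentially"
proof (rule filterlim_norm_at_top_imp_at_infinity, rule filterlim_at_top_mono)
  show "filterlim (\<lambda>n. \<epsilon> * (- norm x + real n)) at_top sequentially"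
    by (intro filterlim_tendsto_pos_mult_at_top[OF tendsto_const \<epsilon>]
        filterlim_tendsto_add_at_top[OF tendsto_const] filterlim_real_sequentially)
  show "eventually (\<lambda>n. \<epsilon> * (- norm x + real n) \<le> norm (\<epsilon> *\<^sub>R (x + real n *\<^sub>R e))) sequentially"
  proof (intro always_eventually allI)
    fix n
    have "norm (real n *\<^sub>R e) - norm x \<le> norm (x + real n *\<^sub>R e)"
      using norm_triangle_ineq2[of "real n *\<^sub>R e" "- x"] by (simp add: add.commute)
    then show "\<epsilon> * (- norm x + real n) \<le> norm (\<epsilon> *\<^sub>R (x + real n *\<^sub>R e))"
      using \<epsilon> e by simp
  qed
qed

theorem theorem1p2:
  fixes s t p q c0 c1 Vinf Kinf Qinf :: real
    and f :: "real \<Rightarrow> real"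
    and V K Q :: "real ^ 3 \<Rightarrow> real"
  assumes s: "3 / 4 < s" "s < 1"
    and t: "0 < t" "t < 1"
    and f0_C1: "\<And>\<tau>. f differentiable (at \<tau>)" "continuous_on UNIV (deriv f)"
    and f0_zero: "f \<in> o[at 0](\<lambda>\<tau>. \<tau> ^ 3)"
    and f0_pos: "\<And>\<tau>. \<tau> > 0 \<Longrightarrow> f \<tau> * \<tau> > 0"
    and f0_neg: "\<And>\<tau>. \<tau> \<le> 0 \<Longrightarrow> f \<tau> = 0"
    and f1: "strict_mono_on {0<..} (\<lambda>\<tau>. f \<tau> / \<tau> ^ 3)"
    and f2_exps: "4 < q" "q < p" "p < crit_exp s"
    and f2_consts: "c0 > 0" "c1 > 0"
    and f2_lower: "\<And>\<tau>. \<tau> \<ge> 0 \<Longrightarrow> f \<tau> \<ge> c0 * \<tau> powr (q - 1)"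
    and f2_growth: "\<And>\<tau>. \<bar>deriv f \<tau>\<bar> \<le> c1 * (1 + \<bar>\<tau>\<bar> powr (p - 2))"
    and cont: "continuous_on UNIV V" "continuous_on UNIV K" "continuous_on UNIV Q"
    and pos: "\<And>x. V x > 0" "\<And>x. K x > 0" "\<And>x. Q x > 0"
    and V0: "(INF x. V x) > 0"
    and V_lim: "(V \<longlongrightarrow> Vinf) at_infinity" "Vinf = (INF x. V x)"
    and K_lim: "(K \<longlongrightarrow> Kinf) at_infinity" "Kinf > 0"
    and Q_lim: "(Q \<longlongrightarrow> Qinf) at_infinity" "Qinf > 0"
    and V_ge: "\<And>x. V x \<ge> Vinf"
    and K_le: "\<And>x. K x \<le> Kinf"
    and Q_le: "\<And>x. Q x \<le> Qinf"
    and strict: "emeasure lborel {x. V x > Vinf} > 0 \<or>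
                 emeasure lborel {x. K x < Kinf} > 0 \<or>
                 emeasure lborel {x. Q x < Qinf} > 0"
  shows "\<forall>\<epsilon>>0. \<not> (\<exists>u. ground_state_solution s t f V K Q \<epsilon> u)"
proof (intro allI impI notI)
  fix \<epsilon> :: real assume \<epsilon>: "0 < \<epsilon>"
  assume "\<exists>u. ground_state_solution s t f V K Q \<epsilon> u"
  then obtain u where gs: "ground_state_solution s t f V K Q \<epsilon> u" ..
  interpret schroedinger_poisson s t p c1 f
    using s t f0_C1(1) f0_pos f0_neg f1 f2_exps f2_consts f2_growth by unfold_locales auto
  let ?V = "\<lambda>x. V (\<epsilon> *\<^sub>R x)" and ?K = "\<lambda>x. K (\<epsilon> *\<^sub>R x)" and ?Q = "\<lambda>x. Q (\<epsilon> *\<^sub>R x)"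
  have Vinf: "0 < Vinf" using V0 V_lim(2) by simp
  have adm: "admissible ?V" "admissible ?K" "admissible ?Q"
    using admissible_rescaled[OF cont(1) pos(1) V_lim(1) Vinf] admissible_rescaled[OF cont(2) pos(2) K_lim]
      admissible_rescaled[OF cont(3) pos(3) Q_lim] by auto
  have cont': "continuous_on UNIV ?V" "continuous_on UNIV ?K" "continuous_on UNIV ?Q"
    by (auto intro!: continuous_on_compose2[OF cont(1)] continuous_on_compose2[OF cont(2)]
        continuous_on_compose2[OF cont(3)] continuous_intros)
  \<comment> \<open>Any unit vector would serve as direction; for each fixed \<open>x\<close> the
    points \<open>x + a n\<close> tend to infinity, so the limits of the coefficients hold
    pointwise.\<close>
  define a where "a n = real n *\<^sub>R (axis 1 1 :: R3)" for n
  have esc: "filterlim (\<lambda>n. \<epsilon> *\<^sub>R (x + a n)) at_infinity sequentially" for x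
    unfolding a_def by (rule filterlim_rescaled_translates[OF \<epsilon>]) (simp add: norm_axis_1)
  have lim: "(\<lambda>n. ?V (x + a n)) \<longlonglongrightarrow> Vinf" "(\<lambda>n. ?K (x + a n)) \<longlonglongrightarrow> Kinf" "(\<lambda>n. ?Q (x + a n)) \<longlonglongrightarrow> Qinf" for x
    using filterlim_compose[OF V_lim(1) esc] filterlim_compose[OF K_lim(1) esc] filterlim_compose[OF
      Q_lim(1) esc] by auto
  \<comment> \<open>A set of positive measure contains a point; \<open>no_strict_point\<close> finds
    a ball around it by continuity.\<close>
  have "\<exists>y. Vinf < V y \<or> K y < Kinf \<or> Q y < Qinf"
  proof (rule ccontr)
    assume "\<not> ?thesis"
    then have "{x. V x > Vinf} = {}" "{x. K x < Kinf} = {}" "{x. Q x < Qinf} = {}" by auto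
    then show False using strict by (simp only: emeasure_empty less_irrefl simp_thms)
  qed
  then obtain y where "Vinf < V y \<or> K y < Kinf \<or> Q y < Qinf" ..
  \<comment> \<open>Undoes the scaling, since the coefficients in the locale are already
    rescaled.\<close>
  then have "Vinf < ?V (y /\<^sub>R \<epsilon>) \<or> ?K (y /\<^sub>R \<epsilon>) < Kinf \<or> ?Q (y /\<^sub>R \<epsilon>) < Qinf"
    using \<epsilon> by simp
  from no_strict_point[OF adm cont' lim Vinf V_ge K_lim(2) K_le Q_lim(2) Q_le
      ground_level_le_ray[OF adm] ground_state_ray_le[OF adm gs] this]
  show False by simp
qed

end
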